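(* The problem $\mathrm{SharedSynth}(\mathrm{FO}^2[\sim])$ is undecidable; that is, there is no algorithm which, given a finite alphabet $A=A_S\uplus A_E$ of actions and a sentence $\varphi\in\mathrm{FO}^2[\sim]$ over $A$, decides whether there exists a finite set $\mathbb{P}_{SE}$ of shared processes (with no processes private to System or Environment) such that System has a winning strategy for $\varphi$.
   Context: **Data words.** $A$ is a finite alphabet of actions, partitioned into System actions $A_S$ and Environment actions $A_E$. Processes are shared: there is a finite set $\mathbb{P}_{SE}$ of processes on which both players can play, and no other processes (the sets $\mathbb{P}_S$, $\mathbb{P}_E$ of private processes of System and Environment are empty). Let $\Sigma_S := A_S\times\mathbb{P}_{SE}$, $\Sigma_E := A_E\times\mathbb{P}_{SE}$, $\Sigma:=\Sigma_S\cup\Sigma_E$. A data word is a finite or infinite sequence $w=(a_0,p_0)(a_1,p_1)\cdots$ over $\Sigma$; each pair $(a_i,p_i)$ in the sequence is called a position. **Logic.** Formulas of $\mathrm{FO}^2[\sim]$ are first-order formulas (connectives $\neg,\land,\lor,\exists,\forall$) using only two (reusable) variables $x,y$, built from the atoms $a(x)$ for $a\in A$, $x=y$, $x\sim y$, $\mathbb{P}_{SE}(x)$ (and $\mathbb{P}_S(x)$, $\mathbb{P}_E(x)$, which are interpreted as the empty set here), up to renaming of the two variables; neither an order nor a successor relation on positions is available. A data word is represented as a structure whose domain has one element for each position and one element for each process in $\mathbb{P}_{SE}$ (including processes on which no action is played). $\mathbb{P}_{SE}$ is interpreted as the set of process elements; $a$ is interpreted as the set of positions whose action is $a$; $\sim$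 is the equivalence relation such that two positions $(a_i,p_i)$, $(a_j,p_j)$ are related iff $p_i=p_j$, and each process element $p$ is related to all positions of the form $(a,p)$. **Strategies.** A strategy for System is a function $\mathcal{S}:\Sigma^*\to\Sigma_S\cup\{\varepsilon\}$. An execution (data word) $w=\sigma_0\sigma_1\cdots$ is $\mathcal{S}$-compatible if (i) for all $0\le i<|w|$, $\sigma_i\in\Sigma_S$ implies $\sigma_i=\mathcal{S}(\sigma_0\cdots\sigma_{i-1})$, and (ii) if $w$ is finite then $\mathcal{S}(w)=\varepsilon$. It is fair for $\mathcal{S}$ if, whenever there are infinitely many $i$ with $\mathcal{S}(\sigma_0\cdots\sigma_{i-1})\neq\varepsilon$, there are infinitely many positions of $w$ in $\Sigma_S$. $\mathcal{S}$ is winning for $\varphi$ if all executions that are $\mathcal{S}$-compatible and fair for $\mathcal{S}$ satisfy $\varphi$. **Problem.** For a logic $\mathcal{L}$, $\mathrm{SharedSynth}(\mathcal{L})$ is the problem: given $A=A_S\uplus A_E$ and a sentence $\varphi\in\mathcal{L}$, decide whether System has a winning strategy for $\varphi$ with $\mathbb{P}_S=\mathbb{P}_E=\emptyset$ and some finite set $\mathbb{P}_{SE}$. *)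

theory Defs
  imports "HOL-Library.Nat_Bijection" "HOL-Library.Extended_Nat"
begin

datatype 'a word = FinWord "'a list" | InfWord "nat \<Rightarrow> 'a"

fun wlen :: "'a word \<Rightarrow> enat" where
  "wlen (FinWord u) = enat (length u)"
| "wlen (InfWord s) = \<infinity>"

fun wnth :: "'a word \<Rightarrow> nat \<Rightarrow> 'a" where
  "wnth (FinWord u) i = u ! i"
| "wnth (InfWord s) i = s i"

fun wtake :: "nat \<Rightarrow> 'a word \<Rightarrow> 'a list" where
  "wtake n (FinWord u) = take n u"
| "wtake n (InfWord s) = map s [0..<n]"

definition positions :: "'a word \<Rightarrow> nat set" where
  "positions w = {i. enat i < wlen w}"

definition words_over :: "'a set \<Rightarrow> 'a word set" where
  "words_over Sig = {w. \<forall>i\<in>positions w. wnth w i \<in> Sig}"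

text \<open>Actions and processes are named by natural numbers, so that every finite alphabet
  and every finite set of processes is represented up to renaming.\<close>

type_synonym action = nat
type_synonym process = nat
type_synonym letter = "action \<times> process"

datatype elem = Pos nat | Proc process

definition domain :: "process set \<Rightarrow> letter word \<Rightarrow> elem set" where
  "domain P w = Pos ` positions w \<union> Proc ` P"

text \<open>Two elements are equivalent iff they belong to the same process. In particular, distinct
  process elements are never equivalent.\<close>

fun process_of :: "letter word \<Rightarrow> elem \<Rightarrow> process" where
  "process_of w (Pos i) = snd (wnth w i)"
| "process_of w (Proc p) = p"

fun has_action :: "letter word \<Rightarrow> action \<Rightarrow> elem \<Rightarrow> bool" where
  "has_action w a (Pos i) = (fst (wnth w i) = a)"
| "has_action w a (Proc p) = False"

datatype var = X | Y

datatype fm =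
    Act action var
  | Eq var var
  | Sim var var
  | InPS var
  | InPE var
  | InPSE var
  | Neg fm
  | And fm fm
  | Or fm fm
  | Exists var fm
  | Forall var fm

fun free_vars :: "fm \<Rightarrow> var set" where
  "free_vars (Act a v) = {v}"
| "free_vars (Eq u v) = {u, v}"
| "free_vars (Sim u v) = {u, v}"
| "free_vars (InPS v) = {v}"
| "free_vars (InPE v) = {v}"
| "free_vars (InPSE v) = {v}"
| "free_vars (Neg f) = free_vars f"
| "free_vars (And f g) = free_vars f \<union> free_vars g"
| "free_vars (Or f g) = free_vars f \<union> free_vars g"
| "free_vars (Exists v f) = free_vars f - {v}"
| "free_vars (Forall v f) = free_vars f - {v}"

fun actions_of :: "fm \<Rightarrow> action set" where
  "actions_of (Act a v) = {a}"
| "actions_of (Eq u v) = {}"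
| "actions_of (Sim u v) = {}"
| "actions_of (InPS v) = {}"
| "actions_of (InPE v) = {}"
| "actions_of (InPSE v) = {}"
| "actions_of (Neg f) = actions_of f"
| "actions_of (And f g) = actions_of f \<union> actions_of g"
| "actions_of (Or f g) = actions_of f \<union> actions_of g"
| "actions_of (Exists v f) = actions_of f"
| "actions_of (Forall v f) = actions_of f"

text \<open>All processes are shared, so \<open>InPS\<close> and \<open>InPE\<close> denote the empty set.\<close>

fun sat :: "process set \<Rightarrow> letter word \<Rightarrow> (var \<Rightarrow> elem) \<Rightarrow> fm \<Rightarrow> bool" where
  "sat P w e (Act a v) = has_action w a (e v)"
| "sat P w e (Eq u v) = (e u = e v)"
| "sat P w e (Sim u v) = (process_of w (e u) = process_of w (e v))"
| "sat P w e (InPS v) = False"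
| "sat P w e (InPE v) = False"
| "sat P w e (InPSE v) = (e v \<in> Proc ` P)"
| "sat P w e (Neg f) = (\<not> sat P w e f)"
| "sat P w e (And f g) = (sat P w e f \<and> sat P w e g)"
| "sat P w e (Or f g) = (sat P w e f \<or> sat P w e g)"
| "sat P w e (Exists v f) = (\<exists>d\<in>domain P w. sat P w (e(v := d)) f)"
| "sat P w e (Forall v f) = (\<forall>d\<in>domain P w. sat P w (e(v := d)) f)"

lemma sat_cong_free_vars:
  "(\<And>v. v \<in> free_vars f \<Longrightarrow> e v = e' v) \<Longrightarrow> sat P w e f = sat P w e' f"
proof (induction f arbitrary: e e')
  case (Exists v f)
  have "sat P w (e(v := d)) f = sat P w (e'(v := d)) f" for d
    by (rule Exists.IH) (use Exists.prems in auto)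
  then show ?case by simp
next
  case (Forall v f)
  have "sat P w (e(v := d)) f = sat P w (e'(v := d)) f" for d
    by (rule Forall.IH) (use Forall.prems in auto)
  then show ?case by simp
next
  case (Neg f)
  then show ?case by (metis free_vars.simps(7) sat.simps(7))
next
  case (And f g)
  then show ?case by (metis UnCI free_vars.simps(8) sat.simps(8))
next
  case (Or f g)
  then show ?case by (metis UnCI free_vars.simps(9) sat.simps(9))
qed auto

text \<open>The assignment is irrelevant for sentences (lemma above); quantifying over all assignments,
  including those outside the domain, also covers the empty domain.\<close>

definition models :: "process set \<Rightarrow> letter word \<Rightarrow> fm \<Rightarrow> bool" where
  "models P w f \<longleftrightarrow> (\<forall>e. sat P w e f)"

text \<open>\<open>None\<close> is the empty move \<open>\<epsilon>\<close>.\<close>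

type_synonym strategy = "letter list \<Rightarrow> letter option"

definition is_strategy :: "action set \<Rightarrow> action set \<Rightarrow> process set \<Rightarrow> strategy \<Rightarrow> bool" where
  "is_strategy AS AE P S \<longleftrightarrow>
     (\<forall>u\<in>lists ((AS \<union> AE) \<times> P). S u \<in> insert None (Some ` (AS \<times> P)))"

definition compatible :: "action set \<Rightarrow> process set \<Rightarrow> strategy \<Rightarrow> letter word \<Rightarrow> bool" where
  "compatible AS P S w \<longleftrightarrow>
     (\<forall>i\<in>positions w. wnth w i \<in> AS \<times> P \<longrightarrow> S (wtake i w) = Some (wnth w i)) \<and>
     (\<forall>u. w = FinWord u \<longrightarrow> S u = None)"

definition fair :: "action set \<Rightarrow> process set \<Rightarrow> strategy \<Rightarrow> letter word \<Rightarrow> bool" where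
  "fair AS P S w \<longleftrightarrow>
     (infinite {i. enat i \<le> wlen w \<and> S (wtake i w) \<noteq> None} \<longrightarrow>
      infinite {i\<in>positions w. wnth w i \<in> AS \<times> P})"

definition winning ::
  "action set \<Rightarrow> action set \<Rightarrow> process set \<Rightarrow> fm \<Rightarrow> strategy \<Rightarrow> bool" where
  "winning AS AE P f S \<longleftrightarrow>
     (\<forall>w\<in>words_over ((AS \<union> AE) \<times> P). compatible AS P S w \<and> fair AS P S w \<longrightarrow> models P w f)"

type_synonym synth_instance = "action set \<times> action set \<times> fm"

definition synth_instances :: "synth_instance set" where
  "synth_instances =
     {(AS, AE, f). finite AS \<and> finite AE \<and> AS \<inter> AE = {} \<and>
        actions_of f \<subseteq> AS \<union> AE \<and> free_vars f = {}}"

definition shared_synth :: "synth_instance \<Rightarrow> bool" where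
  "shared_synth = (\<lambda>(AS, AE, f).
     \<exists>P. finite P \<and> (\<exists>S. is_strategy AS AE P S \<and> winning AS AE P f S))"

datatype recf =
    Zero
  | Succ
  | Proj nat
  | Comp recf "recf list"
  | Prim recf recf
  | Mu recf

text \<open>\<open>None\<close> means divergence or an ill-formed application. There is no static arity check, which
  does not enlarge the class of partial functions computed. The recursion argument
  of \<open>Prim\<close> and the search variable of \<open>Mu\<close> come first.\<close>

fun reval :: "recf \<Rightarrow> nat list \<Rightarrow> nat option" where
  "reval Zero xs = Some 0"
| "reval Succ xs = (case xs of [x] \<Rightarrow> Some (Suc x) | _ \<Rightarrow> None)"
| "reval (Proj i) xs = (if i < length xs then Some (xs ! i) else None)"
| "reval (Comp f gs) xs =
     (if \<forall>g\<in>set gs. reval g xs \<noteq> None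
      then reval f (map (\<lambda>g. the (reval g xs)) gs) else None)"
| "reval (Prim f g) xs =
     (case xs of [] \<Rightarrow> None
      | n # ys \<Rightarrow>
          rec_nat (reval f ys) (\<lambda>m r. case r of None \<Rightarrow> None | Some k \<Rightarrow> reval g (m # k # ys)) n)"
| "reval (Mu f) xs =
     (if \<exists>n. reval f (n # xs) = Some 0 \<and> (\<forall>i<n. reval f (i # xs) \<noteq> None)
      then Some (LEAST n. reval f (n # xs) = Some 0) else None)"

text \<open>The algorithm has to halt with the correct answer on instances only; on numbers that do
  not encode an instance it may do anything.\<close>

definition decidable_problem :: "('i \<Rightarrow> nat) \<Rightarrow> 'i set \<Rightarrow> ('i \<Rightarrow> bool) \<Rightarrow> bool" where
  "decidable_problem code I Q \<longleftrightarrow>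
     (\<exists>f. \<forall>i\<in>I. reval f [code i] = Some (if Q i then 1 else 0))"

fun var_code :: "var \<Rightarrow> nat" where
  "var_code X = 0"
| "var_code Y = 1"

fun fm_code :: "fm \<Rightarrow> nat" where
  "fm_code (Act a v) = prod_encode (0, prod_encode (a, var_code v))"
| "fm_code (Eq u v) = prod_encode (1, prod_encode (var_code u, var_code v))"
| "fm_code (Sim u v) = prod_encode (2, prod_encode (var_code u, var_code v))"
| "fm_code (InPS v) = prod_encode (3, var_code v)"
| "fm_code (InPE v) = prod_encode (4, var_code v)"
| "fm_code (InPSE v) = prod_encode (5, var_code v)"
| "fm_code (Neg f) = prod_encode (6, fm_code f)"
| "fm_code (And f g) = prod_encode (7, prod_encode (fm_code f, fm_code g))"
| "fm_code (Or f g) = prod_encode (8, prod_encode (fm_code f, fm_code g))"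
| "fm_code (Exists v f) = prod_encode (9, prod_encode (var_code v, fm_code f))"
| "fm_code (Forall v f) = prod_encode (10, prod_encode (var_code v, fm_code f))"

definition instance_code :: "synth_instance \<Rightarrow> nat" where
  "instance_code = (\<lambda>(AS, AE, f).
     prod_encode (set_encode AS, prod_encode (set_encode AE, fm_code f)))"

lemma var_code_eq_iff [simp]: "var_code u = var_code v \<longleftrightarrow> u = v"
  by (cases u; cases v) auto

lemma fm_code_inject: "fm_code f = fm_code g \<Longrightarrow> f = g"
proof (induction f arbitrary: g)
qed (case_tac g; auto simp: prod_encode_eq)+

lemma inj_on_instance_code: "inj_on instance_code synth_instances"
  by (auto simp: inj_on_def instance_code_def synth_instances_def prod_encode_eq set_encode_eq
      dest: fm_code_inject)

end

theory Submission
  imports Defs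
begin

text \<open>
  The problem is undecidable by diagonalisation over counter machines. A machine is described by a
  formula \<open>f\<close> that the set of System letters has to satisfy at all times of a play; a run is a play
  in which counter values are numbers of processes in a given state. The formula of the game
  cannot see the order of the moves, but Environment can: it must acknowledge each System
  move, and a System that moves without acknowledgement loses. So Environment can stop at any time and
  have the current set of letters tested, and System wins iff there is a sequence of single
  insertions through sets that satisfy \<open>f\<close>, ending in an accepting one.

  From a decision procedure one builds a machine that, on the code \<open>x\<close> of such a formula \<open>f\<close>, computes
  the code of the instance \<open>f\<close> with input \<open>x\<close>, decides it, and accepts iff the answer is no. Since the
  input is added to \<open>f\<close> by the acceptance formula, the map from \<open>x\<close> to the instance is primitive
  recursive without any coding of machines, and the formula of this machine, run on its own code,
  is a contradiction.
\<close>

section \<open>Computable functions\<close>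

text \<open>Letters are never withdrawn, so a configuration has to be readable from a set that only
  grows. This is why a decrement is recorded by adding a further letter to a process that was
  incremented. System chooses the finite process set with no bound fixed in advance, which makes the
  counters unbounded; once it is chosen, only finitely many System letters exist, and the ban on
  repeating them keeps System from playing on forever.

  Diagonalising directly takes the place of a reduction from a halting problem, whose own
  undecidability would need the same machinery. The circle closes because the formula
  \<open>f\<close> depends only on the decision procedure, while its code \<open>x\<close> enters
  afterwards. An alphabet with \<open>2 * x\<close> actions per player is large enough without any
  inspection of \<open>f\<close>: an action occurring in \<open>f\<close> is at most the code of
  \<open>f\<close>, and the labels of the input stay below \<open>4 * x\<close>. Correctness of the
  machine is required at this one input, where the decision procedure halts because it is asked
  about a genuine instance.\<close>

definition computable1 :: "(nat \<Rightarrow> nat) \<Rightarrow> bool" where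
  "computable1 f \<longleftrightarrow> (\<exists>r. \<forall>x. reval r [x] = Some (f x))"

definition computable2 :: "(nat \<Rightarrow> nat \<Rightarrow> nat) \<Rightarrow> bool" where
  "computable2 g \<longleftrightarrow> (\<exists>r. \<forall>x y. reval r [x, y] = Some (g x y))"

lemma computable1_id [intro]: "computable1 (\<lambda>x. x)"
  unfolding computable1_def by (rule exI[of _ "Proj 0"]) simp

lemma ex_const_recf: "\<exists>r. \<forall>xs. reval r xs = Some c"
proof (induction c)
  case 0
  show ?case by (rule exI[of _ Zero]) simp
next
  case (Suc c)
  then obtain r where "\<forall>xs. reval r xs = Some c" by blast
  then show ?case by (intro exI[of _ "Comp Succ [r]"]) simp
qed

lemma computable1_const [intro]: "computable1 (\<lambda>x. c)"
  unfolding computable1_def using ex_const_recf by blast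

lemma computable1_comp: "computable1 f \<Longrightarrow> computable1 g \<Longrightarrow> computable1 (\<lambda>x. f (g x))"
proof -
  assume "computable1 f" "computable1 g"
  then obtain r q where "\<forall>x. reval r [x] = Some (f x)" "\<forall>x. reval q [x] = Some (g x)"
    unfolding computable1_def by blast
  then show ?thesis unfolding computable1_def by (intro exI[of _ "Comp r [q]"]) simp
qed

lemma computable1_comp2: "computable2 g \<Longrightarrow> computable1 f1 \<Longrightarrow> computable1 f2 \<Longrightarrow> computable1 (\<lambda>x. g (f1 x) (f2 x))"
proof -
  assume "computable2 g" "computable1 f1" "computable1 f2"
  then obtain r q1 q2 where "\<forall>x y. reval r [x, y] = Some (g x y)"
      "\<forall>x. reval q1 [x] = Some (f1 x)" "\<forall>x. reval q2 [x] = Some (f2 x)"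
    unfolding computable1_def computable2_def by blast
  then show ?thesis unfolding computable1_def by (intro exI[of _ "Comp r [q1, q2]"]) simp
qed

lemma computable2_fst: "computable1 f \<Longrightarrow> computable2 (\<lambda>x y. f x)"
proof -
  assume "computable1 f"
  then obtain r where "\<forall>x. reval r [x] = Some (f x)" unfolding computable1_def by blast
  then show ?thesis unfolding computable2_def by (intro exI[of _ "Comp r [Proj 0]"]) simp
qed

lemma computable2_snd: "computable1 f \<Longrightarrow> computable2 (\<lambda>x y. f y)"
proof -
  assume "computable1 f"
  then obtain r where "\<forall>x. reval r [x] = Some (f x)" unfolding computable1_def by blast
  then show ?thesis unfolding computable2_def by (intro exI[of _ "Comp r [Proj 1]"]) simp
qed

lemma computable2_comp2: "computable2 g \<Longrightarrow> computable2 f1 \<Longrightarrow> computable2 f2 \<Longrightarrow> computable2 (\<lambda>x y. g (f1 x y) (f2 x y))"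
proof -
  assume "computable2 g" "computable2 f1" "computable2 f2"
  then obtain r q1 q2 where "\<forall>x y. reval r [x, y] = Some (g x y)"
      "\<forall>x y. reval q1 [x, y] = Some (f1 x y)" "\<forall>x y. reval q2 [x, y] = Some (f2 x y)"
    unfolding computable2_def by blast
  then show ?thesis unfolding computable2_def by (intro exI[of _ "Comp r [q1, q2]"]) simp
qed

lemma computable2_add: "computable2 (+)"
proof -
  have "reval (Prim (Proj 0) (Comp Succ [Proj 1])) [x, y] = Some (x + y)" for x y
    by (induction x) auto
  then show ?thesis unfolding computable2_def by blast
qed

text \<open>Apart from addition, every recursion needed here runs on the only argument, so no
  parameters have to be threaded through \<open>Prim\<close>.\<close>

lemma computable1_primrec:
  assumes "computable2 G" and "h 0 = c" and "\<And>n. h (Suc n) = G n (h n)"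
  shows "computable1 h"
proof -
  from assms(1) obtain g where g: "\<forall>x y. reval g [x, y] = Some (G x y)" unfolding computable2_def by blast
  obtain f where f: "\<forall>xs. reval f xs = Some c" using ex_const_recf by blast
  have "reval (Prim f g) [x] = Some (h x)" for x
    by (induction x) (use f g assms in auto)
  then show ?thesis unfolding computable1_def by blast
qed

lemma computable1_add [intro]: "computable1 f \<Longrightarrow> computable1 g \<Longrightarrow> computable1 (\<lambda>x. f x + g x)"
  by (rule computable1_comp2[OF computable2_add])

lemma computable2_plus: "computable2 f \<Longrightarrow> computable2 g \<Longrightarrow> computable2 (\<lambda>x y. f x y + g x y)"
  by (rule computable2_comp2[OF computable2_add])

lemma computable1_Suc [intro]: "computable1 f \<Longrightarrow> computable1 (\<lambda>x. Suc (f x))"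
  using computable1_add[of f "\<lambda>_. 1"] by (simp add: computable1_const)

lemma computable1_mult_const [intro]: "computable1 f \<Longrightarrow> computable1 (\<lambda>x. c * f x)"
  by (induction c) (auto intro: computable1_const computable1_add)

text \<open>Triangular numbers enter through Cantor pairing:
  \<open>prod_encode (x, y) = triangle (x + y) + x\<close>.\<close>

lemma computable1_triangle: "computable1 triangle"
proof (rule computable1_primrec)
  show "computable2 (\<lambda>n t. t + Suc n)"
    by (intro computable2_plus computable2_fst[of "Suc"] computable2_snd[of "\<lambda>x. x"] computable1_Suc computable1_id)
qed auto

lemma computable2_prod_encode: "computable2 (\<lambda>x y. prod_encode (x, y))"
proof -
  obtain t where t: "\<forall>x. reval t [x] = Some (triangle x)" using computable1_triangle unfolding computable1_def by blast
  obtain a where a: "\<forall>x y. reval a [x, y] = Some (x + y)" using computable2_add unfolding computable2_def by blast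
  show ?thesis unfolding computable2_def prod_encode_def
    by (rule exI[of _ "Comp a [Comp t [a], Proj 0]"]) (simp add: t a)
qed

lemma computable1_prod_encode [intro]: "computable1 f \<Longrightarrow> computable1 g \<Longrightarrow> computable1 (\<lambda>x. prod_encode (f x, g x))"
  by (rule computable1_comp2[OF computable2_prod_encode])

text \<open>Iterating over an initial segment of the indices, as here and in \<open>bigAnd\<close>,
  makes the code of the formula primitive recursive in the length. The base sentences are closed,
  contain no action, and are false and true respectively on every domain, including the empty
  one.\<close>

fun bigOr :: "(nat \<Rightarrow> fm) \<Rightarrow> nat \<Rightarrow> fm" where
  "bigOr F 0 = Exists X (Neg (Sim X X))"
| "bigOr F (Suc n) = Or (F n) (bigOr F n)"

fun bigAnd :: "(nat \<Rightarrow> fm) \<Rightarrow> nat \<Rightarrow> fm" where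
  "bigAnd F 0 = Forall X (Sim X X)"
| "bigAnd F (Suc n) = And (F n) (bigAnd F n)"

text \<open>Each step of an iterated connective wraps the code obtained so far in a fixed tag
  \<open>k\<close>, which \<open>fm_code\<close> sets to 8 for \<open>Or\<close> and to 7 for
  \<open>And\<close>.\<close>

lemma computable1_fold:
  assumes "computable1 f" "h 0 = c" "\<And>n. h (Suc n) = prod_encode (k, prod_encode (f n, h n))"
  shows "computable1 h"
proof (rule computable1_primrec)
  show "computable2 (\<lambda>n y. prod_encode (k, prod_encode (f n, y)))"
    by (intro computable2_comp2[OF computable2_prod_encode] computable2_fst[of "\<lambda>_. k"] computable2_fst[OF assms(1)]
        computable2_snd[of "\<lambda>x. x"] computable1_const computable1_id)
qed (use assms in auto)

lemma computable1_bigOr: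
  assumes "computable1 (\<lambda>i. fm_code (F i))" and "computable1 f" shows "computable1 (\<lambda>x. fm_code (bigOr F (f x)))"
  by (rule computable1_comp[OF computable1_fold[OF assms(1), of _ _ 8] assms(2)]) simp_all

lemma computable1_bigAnd:
  assumes "computable1 (\<lambda>i. fm_code (F i))" and "computable1 f" shows "computable1 (\<lambda>x. fm_code (bigAnd F (f x)))"
  by (rule computable1_comp[OF computable1_fold[OF assms(1), of _ _ 7] assms(2)]) simp_all

text \<open>With even actions for System and odd ones for Environment, acknowledging is adding one,
  and the codes of both action sets are geometric sums in powers of 4.\<close>

definition sys_acts :: "nat \<Rightarrow> action set" where "sys_acts n = (\<lambda>l. 2 * l) ` {..<n}"
definition env_acts :: "nat \<Rightarrow> action set" where "env_acts n = (\<lambda>l. 2 * l + 1) ` {..<n}"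

lemma computable1_power: "computable1 (\<lambda>n. k ^ n)"
proof (rule computable1_primrec)
  show "computable2 (\<lambda>n y. k * y)" by (intro computable2_snd[of "\<lambda>y. k * y"] computable1_mult_const computable1_id)
qed auto

lemma computable1_sum: "computable1 f \<Longrightarrow> computable1 (\<lambda>n. \<Sum>i<n. f i)"
  by (rule computable1_primrec[where G = "\<lambda>n y. y + f n"])
    (auto intro!: computable2_plus computable2_fst computable2_snd[of "\<lambda>x. x"] computable1_id)

lemma set_encode_sys: "set_encode (sys_acts n) = (\<Sum>l<n. 4 ^ l)"
  by (simp add: sys_acts_def set_encode_def sum.reindex inj_on_def power_mult)

lemma set_encode_env: "set_encode (env_acts n) = 2 * (\<Sum>l<n. 4 ^ l)"
  by (simp add: env_acts_def set_encode_def sum.reindex inj_on_def power_mult sum_distrib_left)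

lemma computable1_set_encode: "computable1 f \<Longrightarrow> computable1 (\<lambda>x. set_encode (sys_acts (f x)))"
  "computable1 f \<Longrightarrow> computable1 (\<lambda>x. set_encode (env_acts (f x)))"
  unfolding set_encode_sys set_encode_env
  by (auto intro!: computable1_mult_const computable1_comp[OF computable1_sum] computable1_power)

section \<open>Counter machines for recursive functions\<close>

datatype com = SKIP | INC nat | SEQ com com | LOOP nat com

type_synonym store = "nat \<Rightarrow> nat"

text \<open>Entering the body of \<open>LOOP r c\<close> decrements \<open>r\<close>.\<close>

inductive exec :: "com \<Rightarrow> store \<Rightarrow> store \<Rightarrow> bool" where
  Skip: "exec SKIP s s"
| Inc: "exec (INC r) s (s(r := Suc (s r)))"
| Seq: "exec c s s' \<Longrightarrow> exec d s' s'' \<Longrightarrow> exec (SEQ c d) s s''"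
| Loop0: "s r = 0 \<Longrightarrow> exec (LOOP r c) s s"
| LoopS: "s r = Suc k \<Longrightarrow> exec c (s(r := k)) s' \<Longrightarrow> exec (LOOP r c) s' s'' \<Longrightarrow> exec (LOOP r c) s s''"

definition CLEAR :: "nat \<Rightarrow> com" where "CLEAR r = LOOP r SKIP"
definition MOVE :: "nat \<Rightarrow> nat \<Rightarrow> com" where "MOVE r q = LOOP r (INC q)"
text \<open>The only way to read a register is a loop that empties it. A copy therefore doubles the
  value into \<open>q\<close> and \<open>t\<close> and restores \<open>r\<close> from
  \<open>t\<close>.\<close>

definition COPY :: "nat \<Rightarrow> nat \<Rightarrow> nat \<Rightarrow> com" where
  "COPY r q t = SEQ (LOOP r (SEQ (INC q) (INC t))) (MOVE t r)"

text \<open>The rules of \<open>exec\<close> produce final stores as nested updates; this exchanges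
  them for the extensionally equal store that is wanted.\<close>

lemma exec_eq: "exec c s s' \<Longrightarrow> s' = s'' \<Longrightarrow> exec c s s''" by simp

lemma exec_CLEAR: "exec (CLEAR r) s (s(r := 0))"
  unfolding CLEAR_def
proof (induction "s r" arbitrary: s)
  case 0
  then have "s(r := 0) = s" by auto
  then show ?case using 0 by (metis Loop0)
next
  case (Suc k)
  show ?case using LoopS[of s r k, OF _ Skip Suc.hyps(1)[of "s(r := k)"]] Suc.hyps(2) by simp
qed

lemma exec_MOVE: "r \<noteq> q \<Longrightarrow> exec (MOVE r q) s (s(r := 0, q := s q + s r))"
  unfolding MOVE_def
proof (induction "s r" arbitrary: s)
  case 0
  then have "s(r := 0, q := s q + s r) = s" by auto
  then show ?case using 0 by (metis Loop0)
next
  case (Suc k)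
  let ?s = "s(r := k, q := Suc (s q))"
  have "exec (INC q) (s(r := k)) ?s" using Inc[of q "s(r := k)"] Suc.prems by simp
  moreover have "exec (LOOP r (INC q)) ?s (?s(r := 0, q := ?s q + ?s r))"
    using Suc.hyps(1)[of ?s] Suc.prems by simp
  moreover have "?s(r := 0, q := ?s q + ?s r) = s(r := 0, q := s q + s r)"
    using Suc.prems Suc.hyps(2) by (auto simp: fun_eq_iff)
  ultimately show ?case using LoopS Suc.hyps(2) by metis
qed

lemma exec_COPY:
  assumes "distinct [r, q, t]" "s q = 0" "s t = 0"
  shows "exec (COPY r q t) s (s(q := s r))"
proof -
  have "exec (LOOP r (SEQ (INC q) (INC t))) s (s(r := 0, q := s q + s r, t := s t + s r))" for s
  proof (induction "s r" arbitrary: s)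
    case 0
    then have "s(r := 0, q := s q + s r, t := s t + s r) = s" by auto
    then show ?case using 0 by (metis Loop0)
  next
    case (Suc k)
    let ?s = "s(r := k, q := Suc (s q), t := Suc (s t))"
    have "exec (SEQ (INC q) (INC t)) (s(r := k)) ?s"
      by (rule exec_eq[OF Seq[OF Inc Inc]]) (use assms in auto)
    moreover have "exec (LOOP r (SEQ (INC q) (INC t))) ?s
        (?s(r := 0, q := ?s q + ?s r, t := ?s t + ?s r))"
      using Suc.hyps(1)[of ?s] assms by simp
    moreover have "?s(r := 0, q := ?s q + ?s r, t := ?s t + ?s r)
        = s(r := 0, q := s q + s r, t := s t + s r)"
      using assms Suc.hyps(2) by (auto simp: fun_eq_iff)
    ultimately show ?case using LoopS Suc.hyps(2) by metis
  qed
  then have "exec (COPY r q t) s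
    ((s(r := 0, q := s q + s r, t := s t + s r))(t := 0, r := 0 + (s t + s r)))"
    unfolding COPY_def
    by (rule Seq) (rule exec_eq[OF exec_MOVE], use assms in auto)
  then show ?thesis by (rule exec_eq) (use assms in auto)
qed

section \<open>Compilation of recursive functions\<close>

fun CLEARS :: "nat \<Rightarrow> nat \<Rightarrow> com" where
  "CLEARS b 0 = SKIP"
| "CLEARS b (Suc n) = SEQ (CLEAR (b + n)) (CLEARS b n)"

lemma exec_CLEARS: "exec (CLEARS b n) s (\<lambda>r. if b \<le> r \<and> r < b + n then 0 else s r)"
proof (induction n arbitrary: s)
  case 0
  show ?case unfolding CLEARS.simps by (rule exec_eq[OF Skip]) auto
next
  case (Suc n)
  show ?case
    unfolding CLEARS.simps
    by (rule exec_eq[OF Seq[OF exec_CLEAR Suc]]) (auto simp: fun_eq_iff)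
qed

text \<open>\<open>cmp f rs q b\<close> evaluates \<open>f\<close> on the registers \<open>rs\<close>, with its result in register \<open>q\<close>, and may use
  the registers from \<open>b\<close> on, which are zero before and after.\<close>

fun cmp :: "recf \<Rightarrow> nat list \<Rightarrow> nat \<Rightarrow> nat \<Rightarrow> com"
  and cmps :: "recf list \<Rightarrow> nat list \<Rightarrow> nat \<Rightarrow> nat \<Rightarrow> com" where
  "cmp Zero rs q b = SKIP"
| "cmp Succ rs q b = SEQ (COPY (hd rs) q b) (INC q)"
| "cmp (Proj i) rs q b = COPY (rs ! i) q b"
| "cmp (Comp f gs) rs q b =
     SEQ (cmps gs rs b (b + length gs))
      (SEQ (cmp f [b..<b + length gs] q (b + length gs)) (CLEARS b (length gs)))"
| "cmp (Prim f g) rs q b =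
     SEQ (COPY (hd rs) b (b + 3))
      (SEQ (cmp f (tl rs) (b + 2) (b + 4))
        (SEQ (LOOP b
               (SEQ (cmp g ((b + 1) # (b + 2) # tl rs) (b + 3) (b + 4))
                 (SEQ (CLEAR (b + 2)) (SEQ (MOVE (b + 3) (b + 2)) (INC (b + 1))))))
          (SEQ (CLEAR (b + 1)) (MOVE (b + 2) q))))"
| "cmp (Mu f) rs q b =
     SEQ (cmp f (b # rs) (b + 1) (b + 2))
      (SEQ (LOOP (b + 1) (SEQ (CLEAR (b + 1)) (SEQ (INC b) (cmp f (b # rs) (b + 1) (b + 2)))))
        (MOVE b q))"
| "cmps [] rs a b = SKIP"
| "cmps (g # gs) rs a b = SEQ (cmp g rs a b) (cmps gs rs (Suc a) b)"

text \<open>\<open>q\<close> has to start at zero because results are produced by increments and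
  moves that add to it; for the same reason \<open>Zero\<close> compiles to
  \<open>SKIP\<close>.\<close>

definition ready :: "nat list \<Rightarrow> nat \<Rightarrow> nat \<Rightarrow> store \<Rightarrow> bool" where
  "ready rs q b s \<longleftrightarrow> (\<forall>r\<in>set rs. r < b \<and> r \<noteq> q) \<and> q < b \<and> s q = 0 \<and> (\<forall>r\<ge>b. s r = 0)"

lemma map_upd_notin: "r \<notin> set rs \<Longrightarrow> map (s(r := v)) rs = map s rs"
  by (induction rs) auto

text \<open>Only converging evaluations are simulated, which suffices for a machine that is run at a
  point where its value exists. In the second part the results fill the block from \<open>a\<close>
  on, and scratch space starts at \<open>b\<close> above the whole block, so that later expressions
  leave earlier results alone.\<close>

lemma exec_cmp:
  "reval f (map s rs) = Some v \<Longrightarrow> ready rs q b s \<Longrightarrow> exec (cmp f rs q b) s (s(q := v))"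
  "\<forall>g\<in>set gs. reval g (map s rs) \<noteq> None \<Longrightarrow> \<forall>r\<in>set rs. r < a \<Longrightarrow> a + length gs \<le> b \<Longrightarrow>
   \<forall>r\<ge>a. s r = 0 \<Longrightarrow>
   exec (cmps gs rs a b) s
     (\<lambda>r. if a \<le> r \<and> r < a + length gs then the (reval (gs ! (r - a)) (map s rs)) else s r)"
proof (induction f rs q b and gs rs a b arbitrary: s v and s rule: cmp_cmps.induct)
  case (1 rs q b)
  then have "s(q := v) = s" by (auto simp: ready_def fun_eq_iff)
  then show ?case using Skip[of s] by simp
next
  case (2 rs q b)
  then obtain r where rs: "rs = [r]" "v = Suc (s r)"
    by (auto split: list.splits)
  have "exec (COPY r q b) s (s(q := s r))"
    by (rule exec_COPY) (use 2 rs in \<open>auto simp: ready_def\<close>)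
  show ?case unfolding cmp.simps rs(1) list.sel
    by (rule exec_eq[OF Seq[OF \<open>exec (COPY r q b) s _\<close> Inc]]) (auto simp: rs)
next
  case (3 i rs q b)
  then have i: "i < length rs" "v = s (rs ! i)" by (auto split: if_splits)
  then have "rs ! i \<in> set rs" by simp
  then have "exec (COPY (rs ! i) q b) s (s(q := s (rs ! i)))"
    by (intro exec_COPY) (use 3(2) in \<open>auto simp: ready_def\<close>)
  then show ?case by (simp add: i fun_upd_def)
next
  case (4 f gs rs q b)
  from 4(3) have gs: "\<forall>g\<in>set gs. reval g (map s rs) \<noteq> None"
    and v: "reval f (map (\<lambda>g. the (reval g (map s rs))) gs) = Some v"
    by (auto split: if_splits)
  let ?s = "\<lambda>r. if b \<le> r \<and> r < b + length gs then the (reval (gs ! (r - b)) (map s rs)) else s r"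
  have e1: "exec (cmps gs rs b (b + length gs)) s ?s"
    by (rule 4(1)) (use gs 4(4) in \<open>auto simp: ready_def\<close>)
  have "map ?s [b..<b + length gs] = map (\<lambda>g. the (reval g (map s rs))) gs"
    by (rule nth_equalityI) auto
  then have e2: "exec (cmp f [b..<b + length gs] q (b + length gs)) ?s (?s(q := v))"
    by (intro 4(2)) (use v 4(4) in \<open>auto simp: ready_def\<close>)
  show ?case unfolding cmp.simps
    by (rule exec_eq[OF Seq[OF e1 Seq[OF e2 exec_CLEARS]]])
      (use 4(4) in \<open>auto simp: fun_eq_iff ready_def\<close>)
next
  case (5 f g rs q b)
  from 5(3) obtain n ys where xs: "map s rs = n # ys" by (auto split: list.splits)
  then obtain r ts where rs: "rs = r # ts" "n = s r" "ys = map s ts" by (cases rs) auto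
  \<comment> \<open>\<open>h i\<close> is the value after \<open>i\<close> rounds of the recursion.
    Divergence propagates upwards, so convergence of \<open>h n\<close> makes all earlier values
    defined.\<close>
  define h where "h i = rec_nat (reval f ys)
      (\<lambda>m r. case r of None \<Rightarrow> None | Some k \<Rightarrow> reval g (m # k # ys)) i" for i
  have hn: "h n = Some v" using 5(3)[unfolded xs] by (simp add: h_def)
  have hS: "h (Suc i) = (case h i of None \<Rightarrow> None | Some k \<Rightarrow> reval g (i # k # ys))" for i
    by (simp add: h_def)
  have h_some: "i \<le> n \<Longrightarrow> h i \<noteq> None" for i
  proof (induction "n - i" arbitrary: i)
    case 0 then show ?case using hn by simp
  next
    case (Suc k)
    then have "h (Suc i) \<noteq> None" by simp
    then show ?case unfolding hS by (auto split: option.splits)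
  qed
  have rd: "r < b" "r \<noteq> q" "q < b" "s q = 0" "\<forall>r\<ge>b. s r = 0" "\<forall>r\<in>set ts. r < b \<and> r \<noteq> q"
    using 5(4) by (auto simp: ready_def rs)
  \<comment> \<open>Register \<open>b\<close> holds the number of remaining rounds,
    \<open>b + 1\<close> the index of the round and \<open>b + 2\<close> the value so far;
    \<open>b + 3\<close> receives the next value and is zero between rounds.\<close>
  define st where "st k m a = s(b := k, b + 1 := m, b + 2 := a)" for k m a
  have mapst: "map (st k m a) ts = ys" for k m a
    using rd(6) unfolding rs(3) st_def by fastforce
  have e1: "exec (COPY r b (b + 3)) s (st n 0 0)"
    by (rule exec_eq[OF exec_COPY]) (use rd in \<open>auto simp: st_def fun_eq_iff rs\<close>)
  obtain a0 where a0: "h 0 = Some a0" using h_some[of 0] by auto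
  have e2: "exec (cmp f (tl rs) (b + 2) (b + 4)) (st n 0 0) (st n 0 a0)"
  proof (rule exec_eq[OF 5(1)])
    show "reval f (map (st n 0 0) (tl rs)) = Some a0"
      using a0 by (simp add: rs(1) mapst h_def)
    show "ready (tl rs) (b + 2) (b + 4) (st n 0 0)"
      using rd by (fastforce simp: ready_def rs(1) st_def)
    show "(st n 0 0)(b + 2 := a0) = st n 0 a0" by (simp add: st_def)
  qed
  let ?body = "SEQ (cmp g ((b + 1) # (b + 2) # tl rs) (b + 3) (b + 4))
                 (SEQ (CLEAR (b + 2)) (SEQ (MOVE (b + 3) (b + 2)) (INC (b + 1))))"
  have e3: "k + i = n \<Longrightarrow> h i = Some a \<Longrightarrow> exec (LOOP b ?body) (st k i a) (st 0 n v)" for k i a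
  proof (induction k arbitrary: i a)
    case 0
    then have "st 0 i a = st 0 n v" using hn by simp
    moreover have "st 0 i a b = 0" by (simp add: st_def)
    ultimately show ?case using Loop0 by metis
  next
    case (Suc k)
    obtain a' where a': "h (Suc i) = Some a'" using h_some[of "Suc i"] Suc.prems by auto
    then have g: "reval g (i # a # ys) = Some a'" using hS[of i] Suc.prems by simp
    have e: "exec (cmp g ((b + 1) # (b + 2) # tl rs) (b + 3) (b + 4)) (st k i a) ((st k i a)(b + 3 := a'))"
    proof (rule 5(2))
      show "reval g (map (st k i a) ((b + 1) # (b + 2) # tl rs)) = Some a'"
        using g mapst[of k i a] by (simp add: rs(1)) (simp add: st_def)
      show "ready ((b + 1) # (b + 2) # tl rs) (b + 3) (b + 4) (st k i a)"
        using rd by (fastforce simp: ready_def rs(1) st_def)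
    qed
    have "exec ?body (st k i a) (st k (Suc i) a')"
      by (rule exec_eq[OF Seq[OF e Seq[OF exec_CLEAR Seq[OF exec_MOVE Inc]]]])
        (use rd in \<open>auto simp: st_def fun_eq_iff\<close>)
    moreover have "(st (Suc k) i a)(b := k) = st k i a" "st (Suc k) i a b = Suc k"
      by (auto simp: st_def fun_eq_iff)
    moreover have "exec (LOOP b ?body) (st k (Suc i) a') (st 0 n v)"
      using Suc.IH[of "Suc i" a'] Suc.prems a' by simp
    ultimately show ?case using LoopS by metis
  qed
  have e4: "exec (SEQ (CLEAR (b + 1)) (MOVE (b + 2) q)) (st 0 n v) (s(q := v))"
    by (rule exec_eq[OF Seq[OF exec_CLEAR exec_MOVE]])
      (use rd in \<open>auto simp: st_def fun_eq_iff\<close>)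
  show ?case unfolding cmp.simps
    using Seq[OF e1 Seq[OF e2 Seq[OF e3[of n 0 a0] e4]]] a0 by (simp add: rs(1) fun_upd_def)
next
  case (6 f rs q b)
  let ?xs = "map s rs"
  from 6(3) have ex: "\<exists>n. reval f (n # ?xs) = Some 0 \<and> (\<forall>i<n. reval f (i # ?xs) \<noteq> None)"
    and v: "v = (LEAST n. reval f (n # ?xs) = Some 0)"
    by (auto split: if_splits)
  have v0: "reval f (v # ?xs) = Some 0" unfolding v by (rule LeastI_ex) (use ex in blast)
  \<comment> \<open>Below the minimum the value is not zero by minimality, and it is defined because
    the witness \<open>n\<close> of convergence is at least the minimum.\<close>
  have lt: "i < v \<Longrightarrow> \<exists>k. reval f (i # ?xs) = Some (Suc k)" for i
  proof -
    assume "i < v"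
    then have "reval f (i # ?xs) \<noteq> Some 0" unfolding v using not_less_Least by blast
    moreover obtain n where n: "reval f (n # ?xs) = Some 0" "\<forall>i<n. reval f (i # ?xs) \<noteq> None"
      using ex by blast
    have "v \<le> n" unfolding v using n(1) by (rule Least_le)
    then have "reval f (i # ?xs) \<noteq> None" using n(2) \<open>i < v\<close> by (meson less_le_trans)
    ultimately show ?thesis by (metis not0_implies_Suc option.exhaust)
  qed
  have rd: "q < b" "s q = 0" "\<forall>r\<ge>b. s r = 0" "\<forall>r\<in>set rs. r < b \<and> r \<noteq> q"
    using 6(4) by (auto simp: ready_def)
  \<comment> \<open>\<open>b\<close> holds the candidate and \<open>b + 1\<close> the value of
    \<open>f\<close> there. A nonzero value enters the loop, which clears what is left of it after
    the decrement on entry and tries the next candidate.\<close>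
  define st where "st n a = s(b := n, b + 1 := a)" for n a
  have mapst: "map (st n a) rs = ?xs" for n a
    using rd(4) unfolding st_def by fastforce
  have ef: "reval f (n # ?xs) = Some a \<Longrightarrow>
      exec (cmp f (b # rs) (b + 1) (b + 2)) (st n 0) (st n a)" for n a
  proof (rule exec_eq[OF 6(1)])
    assume "reval f (n # ?xs) = Some a"
    then show "reval f (map (st n 0) (b # rs)) = Some a"
      unfolding list.map mapst by (simp add: st_def)
    show "ready (b # rs) (b + 1) (b + 2) (st n 0)"
      using rd by (fastforce simp: ready_def st_def)
    show "(st n 0)(b + 1 := a) = st n a" by (simp add: st_def)
  qed
  let ?body = "SEQ (CLEAR (b + 1)) (SEQ (INC b) (cmp f (b # rs) (b + 1) (b + 2)))"
  have loop: "n \<le> v \<Longrightarrow> reval f (n # ?xs) = Some a \<Longrightarrow>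
      exec (LOOP (b + 1) ?body) (st n a) (st v 0)" for n a
  proof (induction "v - n" arbitrary: n a)
    case 0
    then have "n = v" by simp
    then have "a = 0" using v0 0(3) by simp
    have "st v 0 (b + 1) = 0" by (simp add: st_def)
    then show ?case unfolding \<open>n = v\<close> \<open>a = 0\<close> by (rule Loop0)
  next
    case (Suc k)
    then have "n < v" by simp
    then obtain a' where a': "a = Suc a'" using lt[of n] Suc.prems(2) by (metis option.inject)
    obtain a2 where a2: "reval f (Suc n # ?xs) = Some a2"
      using lt[of "Suc n"] v0 \<open>n < v\<close> by (metis Suc_lessI)
    have i: "exec (INC b) (st n 0) (st (Suc n) 0)"
      by (rule exec_eq[OF Inc]) (auto simp: st_def fun_eq_iff)
    have c: "exec (CLEAR (b + 1)) ((st n a)(b + 1 := a')) (st n 0)"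
      by (rule exec_eq[OF exec_CLEAR]) (auto simp: st_def fun_eq_iff)
    have "exec ?body ((st n a)(b + 1 := a')) (st (Suc n) a2)"
      by (rule Seq[OF c Seq[OF i ef[OF a2]]])
    moreover have "exec (LOOP (b + 1) ?body) (st (Suc n) a2) (st v 0)"
      using Suc.hyps(1)[of "Suc n" a2] Suc.hyps(2) \<open>n < v\<close> a2 by simp
    moreover have "st n a (b + 1) = Suc a'" by (simp add: st_def a')
    ultimately show ?case using LoopS by metis
  qed
  obtain a0 where a0: "reval f (0 # ?xs) = Some a0" using lt[of 0] v0 by (metis gr0I)
  have m: "exec (MOVE b q) (st v 0) (s(q := v))"
    by (rule exec_eq[OF exec_MOVE]) (use rd in \<open>auto simp: st_def fun_eq_iff\<close>)
  have "st 0 0 = s" using rd by (auto simp: st_def fun_eq_iff)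
  then show ?case unfolding cmp.simps
    using Seq[OF ef[OF a0] Seq[OF loop[of 0 a0] m]] a0 by (simp add: fun_upd_def)
next
  case (7 rs a b)
  have "(\<lambda>r. if a \<le> r \<and> r < a + length [] then the (reval ([] ! (r - a)) (map s rs)) else s r) = s"
    by auto
  then show ?case using Skip[of s] by (simp del: reval.simps)
next
  case (8 g gs rs a b)
  then obtain w where w: "reval g (map s rs) = Some w" by auto
  have e1: "exec (cmp g rs a b) s (s(a := w))"
    by (rule 8(1)[OF w]) (use 8 in \<open>auto simp: ready_def\<close>)
  let ?s = "s(a := w)"
  have "a \<notin> set rs" using 8(4) by auto
  then have mp: "map ?s rs = map s rs" by (rule map_upd_notin)
  have e2: "exec (cmps gs rs (Suc a) b) ?s
     (\<lambda>r. if Suc a \<le> r \<and> r < Suc a + length gs then the (reval (gs ! (r - Suc a)) (map ?s rs)) else ?s r)"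
  proof (rule 8(2))
    show "\<forall>g\<in>set gs. reval g (map ?s rs) \<noteq> None" unfolding mp using 8(3) by simp
  qed (use 8(4-6) in auto)
  show ?case unfolding cmps.simps
    by (rule exec_eq[OF Seq[OF e1 e2]])
      (unfold mp, auto simp: fun_eq_iff w nth_Cons' Suc_le_eq)
qed

section \<open>Transition systems with zero tests\<close>

datatype oper = Incr nat | Decr nat | IsZero nat | Nop

type_synonym trans = "nat \<times> oper \<times> nat"

fun oper_sem :: "oper \<Rightarrow> store \<Rightarrow> store \<Rightarrow> bool" where
  "oper_sem (Incr r) s s' = (s' = s(r := Suc (s r)))"
| "oper_sem (Decr r) s s' = (s r > 0 \<and> s' = s(r := s r - 1))"
| "oper_sem (IsZero r) s s' = (s r = 0 \<and> s' = s)"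
| "oper_sem Nop s s' = (s' = s)"

inductive step :: "trans set \<Rightarrow> nat \<times> store \<Rightarrow> nat \<times> store \<Rightarrow> bool" for T where
  "(q, a, q') \<in> T \<Longrightarrow> oper_sem a s s' \<Longrightarrow> step T (q, s) (q', s')"

fun sz :: "com \<Rightarrow> nat" where
  "sz SKIP = 0"
| "sz (INC r) = 1"
| "sz (SEQ c d) = sz c + sz d"
| "sz (LOOP r c) = sz c + 2"

text \<open>The code occupies the locations from \<open>a\<close> up to, but excluding,
  \<open>a + sz c\<close>, which is its exit. A loop adds two locations: its head \<open>a\<close>
  and the jump back at \<open>a + 1 + sz c\<close>.\<close>

fun code :: "com \<Rightarrow> nat \<Rightarrow> trans list" where
  "code SKIP a = []"
| "code (INC r) a = [(a, Incr r, a + 1)]"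
| "code (SEQ c d) a = code c a @ code d (a + sz c)"
| "code (LOOP r c) a =
     (a, Decr r, a + 1) # (a, IsZero r, a + 2 + sz c) # (a + 1 + sz c, Nop, a) # code c (a + 1)"

lemma steps_code:
  "exec c s s' \<Longrightarrow> set (code c a) \<subseteq> T \<Longrightarrow> (step T)\<^sup>*\<^sup>* (a, s) (a + sz c, s')"
proof (induction arbitrary: a rule: exec.induct)
  case (Seq c s s' d s'')
  have "(step T)\<^sup>*\<^sup>* (a, s) (a + sz c, s')" using Seq.IH(1)[of a] Seq.prems by simp
  moreover have "(step T)\<^sup>*\<^sup>* (a + sz c, s') (a + sz c + sz d, s'')"
    using Seq.IH(2)[of "a + sz c"] Seq.prems by simp
  ultimately show ?case by (simp add: add.assoc)
next
  case (Inc r s)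
  then show ?case by (auto intro!: r_into_rtranclp step.intros[where a = "Incr r"] simp: fun_eq_iff)
next
  case (Loop0 s r c)
  then show ?case by (auto intro!: r_into_rtranclp step.intros[where a = "IsZero r"] simp: add.assoc)
next
  case (LoopS s r k c s' s'')
  have "step T (a, s) (a + 1, s(r := k))"
    by (rule step.intros[where a = "Decr r"]) (use LoopS in auto)
  moreover have "(step T)\<^sup>*\<^sup>* (a + 1, s(r := k)) (a + 1 + sz c, s')"
    using LoopS.IH(1)[of "a + 1"] LoopS.prems by (simp add: fun_upd_def)
  moreover have "step T (a + 1 + sz c, s') (a, s')"
    by (rule step.intros[where a = Nop]) (use LoopS in auto)
  ultimately show ?case using LoopS.IH(2)[OF LoopS.prems]
    by (meson converse_rtranclp_into_rtranclp rtranclp_trans)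
qed auto

text \<open>These are the two branches of a test of one counter: distinct operations that are never
  enabled in the same store.\<close>

fun compatible_ops :: "oper \<Rightarrow> oper \<Rightarrow> bool" where
  "compatible_ops (Decr r) (IsZero r') = (r = r')"
| "compatible_ops (IsZero r) (Decr r') = (r = r')"
| "compatible_ops _ _ = False"

definition deterministic :: "trans set \<Rightarrow> bool" where
  "deterministic T \<longleftrightarrow> (\<forall>q a b q' q''. (q, a, q') \<in> T \<longrightarrow> (q, b, q'') \<in> T \<longrightarrow>
     a = b \<and> q' = q'' \<or> compatible_ops a b)"

lemma code_bounds: "(q, a, q') \<in> set (code c n) \<Longrightarrow> n \<le> q \<and> q < n + sz c \<and> n \<le> q'"
proof (induction c arbitrary: n)
  case (SEQ c d)
  then consider "(q, a, q') \<in> set (code c n)" | "(q, a, q') \<in> set (code d (n + sz c))" by auto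
  then show ?case using SEQ.IH[of n] SEQ.IH(2)[of "n + sz c"] by cases auto
next
  case (LOOP r c)
  then show ?case using LOOP.IH[of "n + 1"] by fastforce
qed auto

lemma deterministic_code: "deterministic (set (code c n))"
proof (induction c arbitrary: n)
  case (SEQ c d)
  have "n \<le> q \<and> q < n + sz c" if "(q, a, q') \<in> set (code c n)" for q a q'
    using code_bounds[OF that] by simp
  moreover have "n + sz c \<le> q" if "(q, a, q') \<in> set (code d (n + sz c))" for q a q'
    using code_bounds[OF that] by simp
  ultimately show ?case
    using SEQ.IH(1)[of n] SEQ.IH(2)[of "n + sz c"] unfolding deterministic_def
    by (simp, meson leD)
next
  case (LOOP r c)
  have "n + 1 \<le> q \<and> q < n + 1 + sz c" if "(q, a, q') \<in> set (code c (n + 1))" for q a q'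
    using code_bounds[OF that] by simp
  then show ?case
    using LOOP.IH[of "n + 1"] unfolding deterministic_def
    by (simp, metis (no_types) Suc_eq_plus1 add.commute add_Suc_right compatible_ops.simps(1,2) lessI less_irrefl not_less_eq_eq order_refl)
qed (auto simp: deterministic_def)

lemma step_deterministic:
  "deterministic T \<Longrightarrow> step T c c' \<Longrightarrow> step T c c'' \<Longrightarrow> c' = c''"
proof -
  assume d: "deterministic T" and c: "step T c c'" "step T c c''"
  from c obtain q s a b q' q'' s' s'' where *: "c = (q, s)" "c' = (q', s')" "c'' = (q'', s'')"
    "(q, a, q') \<in> T" "(q, b, q'') \<in> T" "oper_sem a s s'" "oper_sem b s s''"
    by (auto elim!: step.cases)
  with d have "a = b \<and> q' = q'' \<or> compatible_ops a b" unfolding deterministic_def by blast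
  then show ?thesis
    using * by (cases a; cases b) auto
qed

text \<open>A deterministic system has only one path from \<open>a\<close>, and whatever is
  reachable from \<open>a\<close> lies on the part of this path that leads to the stuck
  \<open>z\<close>.\<close>

lemma steps_to_stuck:
  assumes "deterministic T" "(step T)\<^sup>*\<^sup>* a z" "\<And>c. \<not> step T z c" "(step T)\<^sup>*\<^sup>* a b"
  shows "(step T)\<^sup>*\<^sup>* b z"
  using assms(4)
proof induction
  case (step b c)
  from step.IH step.hyps(2) show ?case
    by (metis assms(1,3) converse_rtranclpE step_deterministic)
qed (use assms in auto)

section \<open>The acknowledgement game\<close>

text \<open>Formulas about processes only. Since \<open>fm_of\<close> renders equality as \<open>Sim\<close>, a quantifier over the
  whole domain is as good as one over processes.\<close>

datatype pfm =
    PAct action var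
  | PEq var var
  | PNeg pfm
  | PAnd pfm pfm
  | POr pfm pfm
  | PEx var pfm
  | PAll var pfm

fun psat :: "process set \<Rightarrow> letter set \<Rightarrow> (var \<Rightarrow> process) \<Rightarrow> pfm \<Rightarrow> bool" where
  "psat P B e (PAct a v) = ((a, e v) \<in> B)"
| "psat P B e (PEq u v) = (e u = e v)"
| "psat P B e (PNeg f) = (\<not> psat P B e f)"
| "psat P B e (PAnd f g) = (psat P B e f \<and> psat P B e g)"
| "psat P B e (POr f g) = (psat P B e f \<or> psat P B e g)"
| "psat P B e (PEx v f) = (\<exists>p\<in>P. psat P B (e(v := p)) f)"
| "psat P B e (PAll v f) = (\<forall>p\<in>P. psat P B (e(v := p)) f)"

fun other :: "var \<Rightarrow> var" where
  "other X = Y"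
| "other Y = X"

fun fm_of :: "pfm \<Rightarrow> fm" where
  "fm_of (PAct a v) = Exists (other v) (And (Sim X Y) (Act a (other v)))"
| "fm_of (PEq u v) = Sim u v"
| "fm_of (PNeg f) = Neg (fm_of f)"
| "fm_of (PAnd f g) = And (fm_of f) (fm_of g)"
| "fm_of (POr f g) = Or (fm_of f) (fm_of g)"
| "fm_of (PEx v f) = Exists v (fm_of f)"
| "fm_of (PAll v f) = Forall v (fm_of f)"

definition letters :: "letter word \<Rightarrow> letter set" where
  "letters w = wnth w ` positions w"

text \<open>Surjectivity is due to the process elements of the domain, which represent even the
  processes on which nothing is played; the hypothesis on \<open>w\<close> keeps the positions
  inside \<open>P\<close>.\<close>

lemma process_of_domain:
  assumes "w \<in> words_over (A \<times> P)" shows "process_of w ` domain P w = P"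
proof -
  have "process_of w d \<in> P" if "d \<in> domain P w" for d
    using that assms by (auto simp: domain_def words_over_def mem_Times_iff)
  moreover have "p \<in> process_of w ` domain P w" if "p \<in> P" for p
    using that by (intro image_eqI[of _ _ "Proc p"]) (auto simp: domain_def)
  ultimately show ?thesis by blast
qed

lemma ball_domain:
  assumes "w \<in> words_over (A \<times> P)"
  shows "(\<forall>d\<in>domain P w. R (process_of w d)) \<longleftrightarrow> (\<forall>p\<in>P. R p)"
proof -
  have "(\<forall>p\<in>process_of w ` domain P w. R p) \<longleftrightarrow> (\<forall>d\<in>domain P w. R (process_of w d))" by auto
  then show ?thesis unfolding process_of_domain[OF assms] by simp
qed

lemma on_process_iff:
  "(\<exists>d\<in>domain P w. process_of w d = p \<and> has_action w a d) \<longleftrightarrow> (a, p) \<in> letters w"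
proof
  assume "(a, p) \<in> letters w"
  then obtain i where "i \<in> positions w" "wnth w i = (a, p)" unfolding letters_def by fastforce
  then show "\<exists>d\<in>domain P w. process_of w d = p \<and> has_action w a d"
    by (intro bexI[of _ "Pos i"]) (auto simp: domain_def)
next
  assume "\<exists>d\<in>domain P w. process_of w d = p \<and> has_action w a d"
  then obtain i where "i \<in> positions w" "snd (wnth w i) = p" "fst (wnth w i) = a"
    by (auto simp: domain_def)
  then show "(a, p) \<in> letters w" unfolding letters_def by (metis image_eqI prod.collapse)
qed

lemma on_process_iff':
  "(\<exists>d\<in>domain P w. p = process_of w d \<and> has_action w a d) \<longleftrightarrow> (a, p) \<in> letters w"
  unfolding on_process_iff[of P, symmetric] by (simp add: eq_commute)

text \<open>The translated formulas depend on an element only through its process: an atom asks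
  whether some element of the class carries the action. A quantifier over the domain can thus be
  replaced by one over its image \<open>P\<close> under \<open>process_of\<close>.\<close>

lemma sat_fm_of:
  assumes w: "w \<in> words_over (A \<times> P)"
  shows "sat P w e (fm_of f) = psat P (letters w) (process_of w \<circ> e) f"
proof (induction f arbitrary: e)
  case (PAct a v)
  show ?case by (cases v) (simp_all add: on_process_iff on_process_iff')
next
  case (PEx v f)
  have "(\<exists>d\<in>domain P w. R (process_of w d)) = (\<exists>p\<in>P. R p)" for R
    using ball_domain[OF w, of "\<lambda>p. \<not> R p"] ball_domain[OF w, of R] by blast
  then show ?case unfolding fm_of.simps sat.simps psat.simps PEx fun_upd_comp .
next
  case (PAll v f)
  have "(\<forall>d\<in>domain P w. R (process_of w d)) = (\<forall>p\<in>P. R p)" for R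
    using ball_domain[OF w, of "\<lambda>p. \<not> R p"] ball_domain[OF w, of R] by blast
  then show ?case unfolding fm_of.simps sat.simps psat.simps PAll fun_upd_comp .
qed auto

lemma psat_cong:
  "(\<And>a p. a \<in> actions_of (fm_of f) \<Longrightarrow> (a, p) \<in> B \<longleftrightarrow> (a, p) \<in> B') \<Longrightarrow> psat P B e f = psat P B' e f"
  by (induction f arbitrary: e) auto

definition pmodels :: "process set \<Rightarrow> letter set \<Rightarrow> pfm \<Rightarrow> bool" where
  "pmodels P B f \<longleftrightarrow> (\<forall>e. psat P B e f)"

lemma pmodels_cong:
  "(\<And>a p. a \<in> actions_of (fm_of f) \<Longrightarrow> (a, p) \<in> B \<longleftrightarrow> (a, p) \<in> B') \<Longrightarrow> pmodels P B f = pmodels P B' f"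
  unfolding pmodels_def using psat_cong by blast

lemma sat_bigOr: "sat P w e (bigOr F n) \<longleftrightarrow> (\<exists>i<n. sat P w e (F i))"
  by (induction n) (auto simp: less_Suc_eq)

lemma sat_bigAnd: "sat P w e (bigAnd F n) \<longleftrightarrow> (\<forall>i<n. sat P w e (F i))"
  by (induction n) (auto simp: less_Suc_eq)

text \<open>Environment has to answer each System letter \<open>2 l\<close> with the letter \<open>2 l + 1\<close> on the same process.
  By falling silent it freezes the play: any further System move leaves two letters pending, so
  \<open>f\<close> is tested on the current set of letters although the formula sees no order.\<close>

definition ack_fault :: "nat \<Rightarrow> fm" where
  "ack_fault l = Exists X (And (Act (2 * l + 1) X)
     (Or (Neg (Exists Y (And (Sim X Y) (Act (2 * l) Y))))
         (Exists Y (And (Sim X Y) (And (Neg (Eq X Y)) (Act (2 * l + 1) Y))))))"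

definition pending :: "var \<Rightarrow> nat \<Rightarrow> fm" where
  "pending v l = And (Act (2 * l) v)
     (Neg (Exists (other v) (And (Sim X Y) (Act (2 * l + 1) (other v)))))"

definition no_repeat :: "nat \<Rightarrow> fm" where
  "no_repeat l = Forall X (Forall Y
     (Or (Neg (And (Act (2 * l) X) (And (Act (2 * l) Y) (Sim X Y)))) (Eq X Y)))"

text \<open>A fault of Environment releases System from everything else. Otherwise at most one
  System move may be unanswered, \<open>f\<close> has to hold, and \<open>g\<close> has to hold when
  no move is unanswered. \<open>no_repeat\<close> closes a gap: a letter played again after its
  acknowledgement would not count as pending.\<close>

definition game_fm :: "nat \<Rightarrow> fm \<Rightarrow> fm \<Rightarrow> fm" where
  "game_fm n f g = Or (bigOr ack_fault n)
     (And (Forall X (Forall Y (Or (Neg (And (bigOr (pending X) n) (bigOr (pending Y) n))) (Eq X Y))))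
       (And (bigAnd no_repeat n)
         (And f (Or (Exists X (bigOr (pending X) n)) g))))"

definition ack :: "letter \<Rightarrow> letter" where "ack \<sigma> = (Suc (fst \<sigma>), snd \<sigma>)"

definition is_pending :: "nat \<Rightarrow> letter word \<Rightarrow> nat \<Rightarrow> bool" where
  "is_pending n w i \<longleftrightarrow> i \<in> positions w \<and> fst (wnth w i) \<in> sys_acts n \<and> ack (wnth w i) \<notin> letters w"

text \<open>As no order is visible, an acknowledgement is at fault only if its System letter occurs
  nowhere in the play or if it is given twice. One given too early becomes correct when System plays
  the letter later.\<close>

definition env_fault :: "nat \<Rightarrow> letter word \<Rightarrow> bool" where
  "env_fault n w \<longleftrightarrow> (\<exists>i\<in>positions w. \<exists>\<sigma>. fst \<sigma> \<in> sys_acts n \<and> wnth w i = ack \<sigma> \<and>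
     (\<sigma> \<notin> letters w \<or> (\<exists>j\<in>positions w. j \<noteq> i \<and> wnth w j = ack \<sigma>)))"

definition repetition_free :: "nat \<Rightarrow> letter word \<Rightarrow> bool" where
  "repetition_free n w \<longleftrightarrow> (\<forall>i\<in>positions w. \<forall>j\<in>positions w.
     fst (wnth w i) \<in> sys_acts n \<longrightarrow> wnth w i = wnth w j \<longrightarrow> i = j)"

lemma sat_ack_fault:
  "sat P w e (ack_fault l) \<longleftrightarrow> (\<exists>i\<in>positions w. \<exists>p. wnth w i = (2 * l + 1, p) \<and>
     ((2 * l, p) \<notin> letters w \<or> (\<exists>j\<in>positions w. j \<noteq> i \<and> wnth w j = (2 * l + 1, p))))"
proof -
  have "sat P w e (ack_fault l) \<longleftrightarrow> (\<exists>d\<in>domain P w. has_action w (2 * l + 1) d \<and>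
     ((2 * l, process_of w d) \<notin> letters w \<or>
      (\<exists>d'\<in>domain P w. process_of w d = process_of w d' \<and> d \<noteq> d' \<and> has_action w (2 * l + 1) d')))"
    by (simp add: ack_fault_def on_process_iff')
  also have "\<dots> \<longleftrightarrow> (\<exists>i\<in>positions w. fst (wnth w i) = 2 * l + 1 \<and>
     ((2 * l, snd (wnth w i)) \<notin> letters w \<or>
      (\<exists>j\<in>positions w. j \<noteq> i \<and> wnth w j = (2 * l + 1, snd (wnth w i)))))"
    by (simp add: domain_def bex_Un prod_eq_iff) metis
  also have "\<dots> \<longleftrightarrow> (\<exists>i\<in>positions w. \<exists>p. wnth w i = (2 * l + 1, p) \<and>
     ((2 * l, p) \<notin> letters w \<or> (\<exists>j\<in>positions w. j \<noteq> i \<and> wnth w j = (2 * l + 1, p))))"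
    by (rule bex_cong[OF refl]) (simp add: prod_eq_iff)
  finally show ?thesis .
qed

lemma sat_pending:
  "sat P w e (pending v l) \<longleftrightarrow>
     (\<exists>i. e v = Pos i \<and> fst (wnth w i) = 2 * l \<and> ack (wnth w i) \<notin> letters w)"
proof -
  have "sat P w e (pending v l) \<longleftrightarrow>
      has_action w (2 * l) (e v) \<and> (2 * l + 1, process_of w (e v)) \<notin> letters w"
    by (cases v) (simp_all add: pending_def on_process_iff on_process_iff')
  then show ?thesis by (cases "e v") (auto simp: ack_def)
qed

lemma sat_bigOr_pending:
  "e v \<in> domain P w \<Longrightarrow> sat P w e (bigOr (pending v) n) \<longleftrightarrow> (\<exists>i. e v = Pos i \<and> is_pending n w i)"
  unfolding sat_bigOr sat_pending is_pending_def sys_acts_def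
  by (auto simp: domain_def)

lemma ex_sys_letter: "(\<exists>\<sigma>. fst \<sigma> \<in> sys_acts n \<and> R \<sigma>) \<longleftrightarrow> (\<exists>l<n. \<exists>p. R (2 * l, p))"
  by (auto simp: sys_acts_def)

lemma sat_bigOr_ack_fault: "sat P w e (bigOr ack_fault n) \<longleftrightarrow> env_fault n w"
  unfolding env_fault_def ex_sys_letter sat_bigOr sat_ack_fault by (simp add: ack_def) blast

lemma sat_no_repeat: "sat P w e (no_repeat l) \<longleftrightarrow>
  (\<forall>i\<in>positions w. \<forall>j\<in>positions w. fst (wnth w i) = 2 * l \<longrightarrow> wnth w i = wnth w j \<longrightarrow> i = j)"
  by (simp add: no_repeat_def domain_def ball_Un prod_eq_iff) metis

lemma sat_bigAnd_no_repeat: "sat P w e (bigAnd no_repeat n) \<longleftrightarrow> repetition_free n w"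
  unfolding repetition_free_def sat_bigAnd sat_no_repeat sys_acts_def by blast

lemma sat_one_pending:
  "sat P w e (Forall X (Forall Y (Or (Neg (And (bigOr (pending X) n) (bigOr (pending Y) n))) (Eq X Y))))
    \<longleftrightarrow> (\<forall>i j. is_pending n w i \<longrightarrow> is_pending n w j \<longrightarrow> i = j)"
proof -
  have "is_pending n w i \<Longrightarrow> Pos i \<in> domain P w" for i
    by (auto simp: is_pending_def domain_def)
  then show ?thesis by (simp add: sat_bigOr_pending) blast
qed

lemma sat_some_pending:
  "sat P w e (Exists X (bigOr (pending X) n)) \<longleftrightarrow> (\<exists>i. is_pending n w i)"
proof -
  have "is_pending n w i \<Longrightarrow> Pos i \<in> domain P w" for i
    by (auto simp: is_pending_def domain_def)
  then show ?thesis by (simp add: sat_bigOr_pending) blast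
qed

lemma sat_game_fm:
  "sat P w e (game_fm n f g) \<longleftrightarrow> env_fault n w \<or>
    (\<forall>i j. is_pending n w i \<longrightarrow> is_pending n w j \<longrightarrow> i = j) \<and> repetition_free n w \<and>
    sat P w e f \<and> ((\<exists>i. is_pending n w i) \<or> sat P w e g)"
  unfolding game_fm_def sat.simps(8,9) sat_bigOr_ack_fault sat_bigAnd_no_repeat
    sat_one_pending sat_some_pending by simp

lemma models_game_fm:
  assumes w: "w \<in> words_over (A \<times> P)"
  shows "models P w (game_fm n (fm_of f) (fm_of g)) \<longleftrightarrow> env_fault n w \<or>
    (\<forall>i j. is_pending n w i \<longrightarrow> is_pending n w j \<longrightarrow> i = j) \<and> repetition_free n w \<and>
    pmodels P (letters w) f \<and> ((\<exists>i. is_pending n w i) \<or> pmodels P (letters w) g)"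
proof -
  have "(\<forall>e. sat P w e (fm_of f)) \<longleftrightarrow> pmodels P (letters w) f" for f
  proof
    assume *: "\<forall>e. sat P w e (fm_of f)"
    have "psat P (letters w) e f" for e
    proof -
      have "process_of w \<circ> (Proc \<circ> e) = e" by auto
      then show ?thesis using * sat_fm_of[OF w] by metis
    qed
    then show "pmodels P (letters w) f" unfolding pmodels_def by blast
  qed (auto simp: pmodels_def sat_fm_of[OF w])
  then show ?thesis unfolding models_def sat_game_fm by blast
qed

text \<open>Environment may fall silent after any history consistent with \<open>S\<close>. System
  then goes on alone: either \<open>S\<close> passes at some point and the finite word is
  compatible, or System moves forever and the infinite word is fair.\<close>

lemma strategy_extension:
  assumes S: "is_strategy AS AE P S" and u: "u \<in> lists ((AS \<union> AE) \<times> P)"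
    and gen: "\<And>i. i < length u \<Longrightarrow> u ! i \<in> AS \<times> P \<Longrightarrow> S (take i u) = Some (u ! i)"
  obtains w where "w \<in> words_over ((AS \<union> AE) \<times> P)" "compatible AS P S w" "fair AS P S w"
    "enat (length u) \<le> wlen w" "wtake (length u) w = u"
    "\<And>i. i \<in> positions w \<Longrightarrow> length u \<le> i \<Longrightarrow> wnth w i \<in> AS \<times> P"
proof -
  define nxt where "nxt v = (case S v of None \<Rightarrow> v | Some \<sigma> \<Rightarrow> v @ [\<sigma>])" for v
  define ext where "ext k = (nxt ^^ k) u" for k
  have ext_Suc: "ext (Suc k) = nxt (ext k)" for k by (simp add: ext_def)
  have inv: "ext k \<in> lists ((AS \<union> AE) \<times> P) \<and>
      (\<forall>i<length (ext k). ext k ! i \<in> AS \<times> P \<longrightarrow> S (take i (ext k)) = Some (ext k ! i)) \<and>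
      (\<exists>r. ext k = u @ r \<and> set r \<subseteq> AS \<times> P)" for k
  proof (induction k)
    case 0
    show ?case using u gen by (simp add: ext_def)
  next
    case (Suc k)
    show ?case
    proof (cases "S (ext k)")
      case None
      then show ?thesis using Suc by (simp add: ext_Suc nxt_def)
    next
      case (Some \<sigma>)
      have "ext k \<in> lists ((AS \<union> AE) \<times> P)" using Suc by blast
      then have "Some \<sigma> \<in> insert None (Some ` (AS \<times> P))"
        using S Some unfolding is_strategy_def by metis
      then have \<sigma>: "\<sigma> \<in> AS \<times> P" by blast
      have ext: "ext (Suc k) = ext k @ [\<sigma>]" by (simp add: ext_Suc nxt_def Some)
      obtain r where "ext k = u @ r" "set r \<subseteq> AS \<times> P" using Suc by blast
      then have "ext (Suc k) = u @ (r @ [\<sigma>]) \<and> set (r @ [\<sigma>]) \<subseteq> AS \<times> P"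
        using \<sigma> by (simp add: ext)
      moreover have "ext (Suc k) \<in> lists ((AS \<union> AE) \<times> P)"
        using Suc \<sigma> by (auto simp: ext)
      moreover have "S (take i (ext (Suc k))) = Some (ext (Suc k) ! i)"
        if "i < length (ext (Suc k))" "ext (Suc k) ! i \<in> AS \<times> P" for i
      proof (cases "i < length (ext k)")
        case True
        then show ?thesis using Suc that by (simp add: ext nth_append)
      next
        case False
        then have "i = length (ext k)" using that by (simp add: ext)
        then show ?thesis using Some by (simp add: ext)
      qed
      ultimately show ?thesis by blast
    qed
  qed
  show thesis
  proof (cases "\<exists>k. S (ext k) = None")
    case True
    then obtain k where k: "S (ext k) = None" by blast
    obtain r where r: "ext k = u @ r" "set r \<subseteq> AS \<times> P" using inv by blast
    show thesis
    proof (rule that[of "FinWord (ext k)"])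
      show "FinWord (ext k) \<in> words_over ((AS \<union> AE) \<times> P)"
        using inv[of k] by (auto simp: words_over_def positions_def in_lists_conv_set)
      show "compatible AS P S (FinWord (ext k))"
        using inv[of k] k by (auto simp: compatible_def positions_def)
      show "fair AS P S (FinWord (ext k))" by (simp add: fair_def)
      show "wnth (FinWord (ext k)) i \<in> AS \<times> P"
        if "i \<in> positions (FinWord (ext k))" "length u \<le> i" for i
        using that r by (auto simp: positions_def nth_append)
    qed (auto simp: r)
  next
    case False
    have len: "length (ext k) = length u + k" for k
      by (induction k) (use False in \<open>auto simp: ext_def nxt_def split: option.splits\<close>)
    \<comment> \<open>\<open>ext (Suc i)\<close> is long enough to have a position \<open>i\<close>
      even if \<open>u\<close> is empty.\<close>
    define s where "s i = ext (Suc i) ! i" for i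
    have pre: "j \<le> k \<Longrightarrow> \<exists>r. ext k = ext j @ r" for j k
    proof (induction k)
      case (Suc k)
      then show ?case by (cases "j = Suc k") (auto simp: ext_Suc nxt_def split: option.splits)
    qed auto
    have map_s: "map s [0..<length u + k] = ext k" for k
    proof (rule nth_equalityI)
      fix i assume "i < length (map s [0..<length u + k])"
      then have i: "i < length u + k" by simp
      have "ext (Suc i) ! i = ext k ! i"
      proof (cases "Suc i \<le> k")
        case True
        then obtain r where "ext k = ext (Suc i) @ r" using pre by blast
        then show ?thesis by (simp add: nth_append len)
      next
        case False
        then obtain r where "ext (Suc i) = ext k @ r" using pre[of k "Suc i"] by auto
        then show ?thesis using i by (simp add: nth_append len)
      qed
      then show "map s [0..<length u + k] ! i = ext k ! i" using i by (simp add: s_def)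
    qed (simp add: len)
    have take: "map s [0..<i] = take i (ext (Suc i))" for i
      by (simp add: map_s[symmetric] take_map del: upt_Suc)
    have late: "s i \<in> AS \<times> P" if "length u \<le> i" for i
    proof -
      obtain r where r: "ext (Suc i) = u @ r" "set r \<subseteq> AS \<times> P" using inv by blast
      have "length r = Suc i" using len[of "Suc i"] r by simp
      then have "ext (Suc i) ! i \<in> set r" using r that by (simp add: nth_append)
      then show ?thesis using r unfolding s_def by blast
    qed
    show thesis
    proof (rule that[of "InfWord s"])
      have "s i \<in> (AS \<union> AE) \<times> P" for i
      proof -
        have "s i \<in> set (ext (Suc i))" using len[of "Suc i"] by (simp add: s_def)
        then show ?thesis using inv[of "Suc i"] by blast
      qed
      then show "InfWord s \<in> words_over ((AS \<union> AE) \<times> P)" by (simp add: words_over_def)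
      have "S (map s [0..<i]) = Some (s i)" if "s i \<in> AS \<times> P" for i
        using inv[of "Suc i"] len[of "Suc i"] that by (simp add: take s_def)
      then show "compatible AS P S (InfWord s)" by (simp add: compatible_def)
      have "{length u..} \<subseteq> {i \<in> positions (InfWord s). wnth (InfWord s) i \<in> AS \<times> P}"
        using late by (auto simp: positions_def)
      then show "fair AS P S (InfWord s)"
        unfolding fair_def by (meson infinite_Ici infinite_super)
      show "wtake (length u) (InfWord s) = u"
        using map_s[of 0] by (simp add: ext_def)
    qed (use late in auto)
  qed
qed

section \<open>Acknowledged histories and their continuations\<close>

definition history :: "letter list \<Rightarrow> letter list" where
  "history \<sigma>s = concat (map (\<lambda>\<sigma>. [\<sigma>, ack \<sigma>]) \<sigma>s)"

lemma history_simps [simp]: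
  "history [] = []" "history (\<sigma> # \<sigma>s) = \<sigma> # ack \<sigma> # history \<sigma>s"
  "history (\<sigma>s @ \<tau>s) = history \<sigma>s @ history \<tau>s"
  by (auto simp: history_def)

lemma length_history [simp]: "length (history \<sigma>s) = 2 * length \<sigma>s"
  by (induction \<sigma>s) auto

lemma set_history: "set (history \<sigma>s) = set \<sigma>s \<union> ack ` set \<sigma>s"
  by (induction \<sigma>s) auto

lemma nth_history:
  "k < length \<sigma>s \<Longrightarrow> history \<sigma>s ! (2 * k) = \<sigma>s ! k \<and> history \<sigma>s ! (Suc (2 * k)) = ack (\<sigma>s ! k)"
proof (induction \<sigma>s arbitrary: k)
  case (Cons \<sigma> \<sigma>s)
  then show ?case by (cases k) auto
qed simp

lemma take_history: "take (2 * k) (history \<sigma>s) = history (take k \<sigma>s)"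
proof (induction \<sigma>s arbitrary: k)
  case (Cons \<sigma> \<sigma>s)
  then show ?case by (cases k) auto
qed simp


lemma ack_not_sys: "fst \<sigma> \<in> sys_acts n \<Longrightarrow> fst (ack \<sigma>) \<notin> sys_acts n"
  by (auto simp: ack_def sys_acts_def) presburger

lemma ack_env: "\<sigma> \<in> sys_acts n \<times> P \<Longrightarrow> ack \<sigma> \<in> env_acts n \<times> P"
  by (auto simp: ack_def sys_acts_def env_acts_def)

lemma env_is_ack: "\<tau> \<in> env_acts n \<times> P \<Longrightarrow> \<exists>\<sigma>\<in>sys_acts n \<times> P. \<tau> = ack \<sigma>"
  by (auto simp: ack_def sys_acts_def env_acts_def)

lemma ack_inject [simp]: "ack \<sigma> = ack \<tau> \<longleftrightarrow> \<sigma> = \<tau>"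
  by (auto simp: ack_def prod_eq_iff)

text \<open>A chain is the sequence of System moves in a play in which Environment answers each of them
  with the acknowledgement of the same move.\<close>

definition chain :: "nat \<Rightarrow> pfm \<Rightarrow> process set \<Rightarrow> letter list \<Rightarrow> bool" where
  "chain n f P \<sigma>s \<longleftrightarrow> distinct \<sigma>s \<and> set \<sigma>s \<subseteq> sys_acts n \<times> P \<and>
     (\<forall>k\<le>length \<sigma>s. pmodels P (set (take k \<sigma>s)) f)"

text \<open>The formula speaks of System actions only, so the acknowledgements in \<open>B\<close>
  do not influence its truth.\<close>

lemma pmodels_sys_letters:
  assumes "actions_of (fm_of f) \<subseteq> sys_acts n" "set \<sigma>s \<subseteq> sys_acts n \<times> P" "B \<inter> sys_acts n \<times> UNIV = set \<sigma>s"
  shows "pmodels P B f \<longleftrightarrow> pmodels P (set \<sigma>s) f"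
  by (rule pmodels_cong) (use assms in auto)

lemma wtake_nth:
  "enat i \<le> wlen w \<Longrightarrow> length (wtake i w) = i"
  "enat i \<le> wlen w \<Longrightarrow> j < i \<Longrightarrow> wtake i w ! j = wnth w j"
  by (cases w; simp)+

lemma positions_less: "i \<in> positions w \<Longrightarrow> j \<le> i \<Longrightarrow> j \<in> positions w"
  unfolding positions_def by simp (meson enat_ord_simps(1) le_less_trans)

lemma positions_wlen: "i \<in> positions w \<Longrightarrow> enat i \<le> wlen w"
  unfolding positions_def by simp

lemma history_cases:
  assumes "i < 2 * length \<sigma>s"
  obtains k where "k < length \<sigma>s" "i = 2 * k" "history \<sigma>s ! i = \<sigma>s ! k"
  | k where "k < length \<sigma>s" "i = Suc (2 * k)" "history \<sigma>s ! i = ack (\<sigma>s ! k)"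
proof (cases "even i")
  case True
  then obtain k where "i = 2 * k" by blast
  then show ?thesis using that(1)[of k] assms nth_history[of k \<sigma>s] by simp
next
  case False
  then obtain k where "i = Suc (2 * k)" by (metis oddE Suc_eq_plus1)
  then show ?thesis using that(2)[of k] assms nth_history[of k \<sigma>s] by simp
qed

text \<open>The common shape of the plays in both directions of the game: an answered history, then
  System moves only. The tail is empty in a completed play, a single move in a frozen one, and a
  priori arbitrary when an unknown strategy is left to move alone.\<close>

definition follows :: "nat \<Rightarrow> letter list \<Rightarrow> letter word \<Rightarrow> bool" where
  "follows n \<sigma>s w \<longleftrightarrow> distinct \<sigma>s \<and> (\<forall>\<sigma>\<in>set \<sigma>s. fst \<sigma> \<in> sys_acts n) \<and>
     enat (2 * length \<sigma>s) \<le> wlen w \<and> wtake (2 * length \<sigma>s) w = history \<sigma>s \<and>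
     (\<forall>i\<in>positions w. 2 * length \<sigma>s \<le> i \<longrightarrow> fst (wnth w i) \<in> sys_acts n)"

lemma distinct_history:
  "distinct \<sigma>s \<Longrightarrow> \<forall>\<sigma>\<in>set \<sigma>s. fst \<sigma> \<in> sys_acts n \<Longrightarrow> distinct (history \<sigma>s)"
proof (induction \<sigma>s)
  case (Cons \<sigma> \<sigma>s)
  have \<sigma>: "fst \<sigma> \<in> sys_acts n" using Cons.prems(2) by simp
  have "ack \<sigma> \<notin> set (\<sigma> # \<sigma>s)" using ack_not_sys[OF \<sigma>] Cons.prems(2) by blast
  moreover have "\<sigma> \<notin> ack ` set (\<sigma> # \<sigma>s)"
  proof
    assume "\<sigma> \<in> ack ` set (\<sigma> # \<sigma>s)"
    then obtain \<tau> where "\<tau> \<in> set (\<sigma> # \<sigma>s)" "\<sigma> = ack \<tau>" by blast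
    then show False using ack_not_sys[of \<tau> n] Cons.prems(2) \<sigma> by metis
  qed
  moreover have "ack \<sigma> \<notin> ack ` set \<sigma>s" using Cons.prems(1) by auto
  ultimately show ?case using Cons by (simp add: set_history)
qed simp

lemma follows_nth: "follows n \<sigma>s w \<Longrightarrow> i < 2 * length \<sigma>s \<Longrightarrow> wnth w i = history \<sigma>s ! i"
  unfolding follows_def by (metis wtake_nth(2))

lemma follows_positions: "follows n \<sigma>s w \<Longrightarrow> i < 2 * length \<sigma>s \<Longrightarrow> i \<in> positions w"
  unfolding follows_def positions_def by (simp, meson enat_ord_simps(2) less_le_trans)

text \<open>The tail consists of System actions and the history alternates, so an acknowledgement
  can stand only at an odd position of the history.\<close>

lemma follows_ack:
  assumes w: "follows n \<sigma>s w" and i: "i \<in> positions w" "wnth w i = ack \<sigma>" "fst \<sigma> \<in> sys_acts n"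
  obtains k where "k < length \<sigma>s" "i = Suc (2 * k)" "\<sigma> = \<sigma>s ! k"
proof -
  have "i < 2 * length \<sigma>s"
    using w i ack_not_sys unfolding follows_def by (metis not_less)
  then show thesis
  proof (cases rule: history_cases)
    case (1 k)
    then have "ack \<sigma> \<in> set \<sigma>s" using follows_nth[OF w \<open>i < 2 * length \<sigma>s\<close>] i
      by (metis nth_mem)
    then show ?thesis using w i ack_not_sys unfolding follows_def by blast
  next
    case (2 k)
    then show ?thesis using that follows_nth[OF w \<open>i < 2 * length \<sigma>s\<close>] i by simp
  qed
qed

lemma follows_letters: "follows n \<sigma>s w \<Longrightarrow> set (history \<sigma>s) \<subseteq> letters w"
proof
  fix \<sigma> assume w: "follows n \<sigma>s w" and "\<sigma> \<in> set (history \<sigma>s)"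
  then obtain i where "i < 2 * length \<sigma>s" "history \<sigma>s ! i = \<sigma>" by (auto simp: in_set_conv_nth)
  then show "\<sigma> \<in> letters w"
    using follows_nth[OF w] follows_positions[OF w] unfolding letters_def by (metis image_eqI)
qed

lemma follows_ack_letters:
  assumes "follows n \<sigma>s w" "fst \<sigma> \<in> sys_acts n"
  shows "ack \<sigma> \<in> letters w \<longleftrightarrow> \<sigma> \<in> set \<sigma>s"
proof
  assume "ack \<sigma> \<in> letters w"
  then obtain i where i: "i \<in> positions w" "wnth w i = ack \<sigma>" unfolding letters_def by auto
  show "\<sigma> \<in> set \<sigma>s" by (rule follows_ack[OF assms(1) i assms(2)]) simp
next
  assume "\<sigma> \<in> set \<sigma>s"
  then show "ack \<sigma> \<in> letters w" using follows_letters[OF assms(1)] by (auto simp: set_history)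
qed

lemma follows_no_fault:
  assumes w: "follows n \<sigma>s w" shows "\<not> env_fault n w"
proof
  assume "env_fault n w"
  then obtain i \<sigma> where i: "i \<in> positions w" "fst \<sigma> \<in> sys_acts n" "wnth w i = ack \<sigma>"
    and "\<sigma> \<notin> letters w \<or> (\<exists>j\<in>positions w. j \<noteq> i \<and> wnth w j = ack \<sigma>)"
    unfolding env_fault_def by blast
  obtain k where k: "k < length \<sigma>s" "i = Suc (2 * k)" "\<sigma> = \<sigma>s ! k"
    using follows_ack[OF w i(1,3,2)] by blast
  then have "\<sigma> \<in> letters w" using follows_letters[OF w] by (auto simp: set_history)
  then obtain j where j: "j \<in> positions w" "j \<noteq> i" "wnth w j = ack \<sigma>"
    using \<open>\<sigma> \<notin> letters w \<or> _\<close> by blast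
  obtain k' where "k' < length \<sigma>s" "j = Suc (2 * k')" "\<sigma> = \<sigma>s ! k'"
    using follows_ack[OF w j(1,3) i(2)] by blast
  then show False using k j(2) w unfolding follows_def by (metis nth_eq_iff_index_eq)
qed

text \<open>All acknowledgements stem from the history. Its own moves are therefore answered, and a
  move of the tail is unanswered exactly if it does not repeat one of them.\<close>

lemma follows_pending:
  assumes w: "follows n \<sigma>s w"
  shows "is_pending n w i \<longleftrightarrow> i \<in> positions w \<and> 2 * length \<sigma>s \<le> i \<and> wnth w i \<notin> set \<sigma>s"
proof
  assume p: "is_pending n w i"
  then have "wnth w i \<notin> set \<sigma>s"
    using follows_ack_letters[OF w] unfolding is_pending_def by blast
  moreover have "2 * length \<sigma>s \<le> i"
  proof (rule ccontr)
    assume "\<not> 2 * length \<sigma>s \<le> i"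
    then have l: "i < 2 * length \<sigma>s" by simp
    from l show False
    proof (cases rule: history_cases)
      case (1 k)
      then show ?thesis using follows_nth[OF w l] \<open>wnth w i \<notin> set \<sigma>s\<close> by simp
    next
      case (2 k)
      then have "fst (\<sigma>s ! k) \<in> sys_acts n" using w unfolding follows_def by simp
      then show ?thesis using follows_nth[OF w l] p ack_not_sys 2 unfolding is_pending_def by metis
    qed
  qed
  ultimately show "i \<in> positions w \<and> 2 * length \<sigma>s \<le> i \<and> wnth w i \<notin> set \<sigma>s"
    using p unfolding is_pending_def by blast
next
  assume "i \<in> positions w \<and> 2 * length \<sigma>s \<le> i \<and> wnth w i \<notin> set \<sigma>s"
  then show "is_pending n w i"
    using w follows_ack_letters[OF w] unfolding is_pending_def follows_def by blast
qed

lemma follows_sys_letters: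
  assumes w: "follows n \<sigma>s w" and "positions w = {..<2 * length \<sigma>s} \<union> I" "\<forall>i\<in>I. 2 * length \<sigma>s \<le> i"
  shows "letters w \<inter> sys_acts n \<times> UNIV = set \<sigma>s \<union> wnth w ` I"
proof -
  have "wnth w ` {..<2 * length \<sigma>s} = set (history \<sigma>s)"
    unfolding set_conv_nth using follows_nth[OF w] by force
  then have "letters w = set \<sigma>s \<union> ack ` set \<sigma>s \<union> wnth w ` I"
    unfolding letters_def assms(2) image_Un by (simp add: set_history)
  moreover have "ack ` set \<sigma>s \<inter> sys_acts n \<times> UNIV = {}"
  proof -
    have "ack \<sigma> \<notin> sys_acts n \<times> UNIV" if "\<sigma> \<in> set \<sigma>s" for \<sigma>
      using that w ack_not_sys[of \<sigma> n] unfolding follows_def by (metis mem_Times_iff)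
    then have "\<tau> \<notin> sys_acts n \<times> UNIV" if "\<tau> \<in> ack ` set \<sigma>s" for \<tau>
      using that by (metis imageE)
    then show ?thesis by (intro equals0I) (metis IntE)
  qed
  moreover have "\<sigma> \<in> sys_acts n \<times> UNIV" if "\<sigma> \<in> set \<sigma>s" for \<sigma>
    using w that unfolding follows_def by (simp add: mem_Times_iff)
  moreover have "wnth w i \<in> sys_acts n \<times> UNIV" if "i \<in> I" for i
  proof -
    have "i \<in> positions w" "2 * length \<sigma>s \<le> i" using that assms(2,3) by auto
    then show ?thesis using w unfolding follows_def by (simp add: mem_Times_iff)
  qed
  ultimately show ?thesis by blast
qed

text \<open>System replays the chain while the play is a prefix of the acknowledged history and is
  silent otherwise. A play that never leaves the history is completed, or it is frozen at one
  pending move; the chain supplies \<open>f\<close> in both cases and the hypothesis supplies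
  \<open>g\<close> in the first. If the play leaves the history, the first wrong letter is one of
  Environment, and the silence of System makes it a permanent fault.\<close>

lemma chain_winning:
  assumes chain: "chain n f P \<sigma>s" and g: "pmodels P (set \<sigma>s) g"
    and acts: "actions_of (fm_of f) \<subseteq> sys_acts n" "actions_of (fm_of g) \<subseteq> sys_acts n"
  shows "\<exists>S. is_strategy (sys_acts n) (env_acts n) P S \<and>
    winning (sys_acts n) (env_acts n) P (game_fm n (fm_of f) (fm_of g)) S"
proof -
  let ?A = "sys_acts n \<times> P"
  define h where "h = history \<sigma>s"
  define N where "N = length \<sigma>s"
  define S where "S u = (if \<exists>k<N. u = take (2 * k) h then Some (\<sigma>s ! (length u div 2)) else None)" for u
  have len: "length h = 2 * N" by (simp add: h_def N_def)
  have sub: "set \<sigma>s \<subseteq> ?A" and dist: "distinct \<sigma>s" using chain by (auto simp: chain_def)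
  have S_take: "S (take (2 * k) h) = Some (\<sigma>s ! k)" if "k < N" for k
    using that len by (auto simp: S_def)
  have S_None: "S (take m h) = None" if "m \<le> 2 * N" "\<forall>k<N. m \<noteq> 2 * k" for m
  proof -
    have "length (take m h) \<noteq> length (take (2 * k') h)" if "k' < N" for k'
      using \<open>m \<le> 2 * N\<close> \<open>\<forall>k<N. m \<noteq> 2 * k\<close> that len by simp
    then show ?thesis unfolding S_def by (metis (no_types))
  qed
  have strat: "is_strategy (sys_acts n) (env_acts n) P S"
  proof -
    have "S u \<in> insert None (Some ` ?A)" for u
    proof (cases "\<exists>k<N. u = take (2 * k) h")
      case True
      then obtain k where k: "k < N" "u = take (2 * k) h" by blast
      then have "\<sigma>s ! k \<in> ?A" using sub by (auto simp: N_def)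
      then show ?thesis using S_take[OF k(1)] k(2) by simp
    next
      case False
      then have "S u = None" unfolding S_def by (rule if_not_P)
      then show ?thesis by simp
    qed
    then show ?thesis unfolding is_strategy_def by blast
  qed
  have "models P w (game_fm n (fm_of f) (fm_of g))"
    if w: "w \<in> words_over ((sys_acts n \<union> env_acts n) \<times> P)" and comp: "compatible (sys_acts n) P S w" for w
  proof (cases "\<exists>m\<le>2 * N. w = FinWord (take m h)")
    case True
    then obtain m where m: "m \<le> 2 * N" "w = FinWord (take m h)" by blast
    then have stop: "S (take m h) = None" using comp unfolding compatible_def by blast
    define k where "k = m div 2"
    define \<tau>s where "\<tau>s = take k \<sigma>s"
    have k: "k \<le> N" "2 * k \<le> m" using m(1) by (auto simp: k_def)
    have sys: "\<forall>\<sigma>\<in>set \<sigma>s. fst \<sigma> \<in> sys_acts n" using sub by auto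
    have rep: "repetition_free n w"
      using distinct_history[OF dist sys] unfolding repetition_free_def m(2) positions_def
      by (simp add: h_def nth_eq_iff_index_eq)
    have \<tau>s_len: "length \<tau>s = k" using k by (simp add: \<tau>s_def N_def)
    have fol: "follows n \<tau>s w"
      unfolding follows_def
    proof (intro conjI ballI impI)
      show "distinct \<tau>s" using dist by (simp add: \<tau>s_def)
      show "fst \<sigma> \<in> sys_acts n" if "\<sigma> \<in> set \<tau>s" for \<sigma>
        using that sys unfolding \<tau>s_def by (meson in_set_takeD)
      show "enat (2 * length \<tau>s) \<le> wlen w" using k m len by (simp add: \<tau>s_len)
      show "wtake (2 * length \<tau>s) w = history \<tau>s"
        using k take_history[of k \<sigma>s]
        by (simp add: \<tau>s_len m(2) min_absorb1 h_def \<tau>s_def[symmetric])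
      show "fst (wnth w i) \<in> sys_acts n" if "i \<in> positions w" "2 * length \<tau>s \<le> i" for i
      proof -
        have "i < m" using that m len by (simp add: positions_def)
        then have "i = 2 * k" "k < N" using that(2) m(1) by (auto simp: \<tau>s_len k_def)
        then have "wnth w i = \<sigma>s ! k" "\<sigma>s ! k \<in> set \<sigma>s"
          using \<open>i < m\<close> nth_history[of k \<sigma>s] by (auto simp: m(2) h_def N_def)
        then show ?thesis using sys by simp
      qed
    qed
    show ?thesis
    proof (cases "m = 2 * N")
      case True
      then have "k = N" by (simp add: k_def)
      then have \<tau>s: "\<tau>s = \<sigma>s" by (simp add: \<tau>s_def N_def)
      have pos: "positions w = {..<2 * length \<tau>s}"
        using True len by (auto simp: m(2) positions_def \<tau>s N_def)
      have "letters w \<inter> sys_acts n \<times> UNIV = set \<sigma>s"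
        using follows_sys_letters[OF fol, of "{}"] pos \<tau>s by simp
      then have "pmodels P (letters w) f" "pmodels P (letters w) g"
        using pmodels_sys_letters[OF acts(1) sub] pmodels_sys_letters[OF acts(2) sub] chain g
        by (auto simp: chain_def)
      moreover have "\<not> is_pending n w i" for i
        unfolding follows_pending[OF fol] pos by simp
      ultimately show ?thesis unfolding models_game_fm[OF w] using rep by blast
    next
      case False
      \<comment> \<open>A finite compatible play ends where \<open>S\<close> passes. After an even
        proper prefix of \<open>h\<close> it does not pass, so the play must have stopped right
        after an unanswered move.\<close>
      have "m \<noteq> 2 * k"
        using S_take[of k] stop k m(1) False by auto
      then have mk: "m = Suc (2 * k)" "k < N" using k m(1) by (auto simp: k_def)
      let ?\<sigma> = "\<sigma>s ! k"
      have pos: "positions w = {..<2 * length \<tau>s} \<union> {2 * k}"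
        using mk len by (auto simp: m(2) positions_def \<tau>s_len)
      have nth: "wnth w (2 * k) = ?\<sigma>"
        using mk len nth_history[of k \<sigma>s] by (simp add: m(2) h_def N_def)
      have app: "take (Suc k) \<sigma>s = \<tau>s @ [?\<sigma>]"
        using mk by (simp add: \<tau>s_def N_def take_Suc_conv_app_nth)
      then have notin: "?\<sigma> \<notin> set \<tau>s"
        using distinct_take[OF dist, of "Suc k"] by simp
      have pend: "is_pending n w i \<longleftrightarrow> i = 2 * k" for i
        unfolding follows_pending[OF fol] using pos nth notin \<tau>s_len by auto
      have "letters w \<inter> sys_acts n \<times> UNIV = set (take (Suc k) \<sigma>s)"
        using follows_sys_letters[OF fol, of "{2 * k}"] pos \<tau>s_len nth app by simp
      moreover have "set (take (Suc k) \<sigma>s) \<subseteq> ?A" using sub by (meson set_take_subset order_trans)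
      ultimately have "pmodels P (letters w) f"
        using pmodels_sys_letters[OF acts(1)] chain mk by (auto simp: chain_def N_def)
      then show ?thesis unfolding models_game_fm[OF w] pend using rep by blast
    qed
  next
    case False
    \<comment> \<open>\<open>Q i\<close> says that the play leaves \<open>h\<close> at
      \<open>i\<close>, by a different letter or by going beyond the end. At the least such
      \<open>i\<close> the letter belongs to Environment, since the moves of \<open>S\<close> agree
      with \<open>h\<close>.\<close>
    define Q where "Q i \<longleftrightarrow> i \<in> positions w \<and> (2 * N \<le> i \<or> wnth w i \<noteq> h ! i)" for i
    have "\<exists>i. Q i"
    proof (rule ccontr)
      assume none: "\<nexists>i. Q i"
      show False
      proof (cases w)
        case (InfWord s)
        then have "Q (2 * N)" by (simp add: Q_def positions_def)
        then show ?thesis using none by blast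
      next
        case (FinWord u)
        have "length u \<le> 2 * N"
        proof (rule ccontr)
          assume "\<not> length u \<le> 2 * N"
          then have "Q (2 * N)" by (simp add: Q_def positions_def FinWord)
          then show False using none by blast
        qed
        moreover have "u = take (length u) h"
        proof (rule nth_equalityI)
          fix i assume "i < length u"
          moreover have "\<not> Q i" using none by blast
          ultimately show "u ! i = take (length u) h ! i" by (simp add: Q_def positions_def FinWord)
        qed (use \<open>length u \<le> 2 * N\<close> len in simp)
        ultimately show ?thesis using \<open>\<not> (\<exists>m\<le>2 * N. _ m)\<close> FinWord by blast
      qed
    qed
    define i where "i = (LEAST i. Q i)"
    have Qi: "Q i" unfolding i_def by (rule LeastI_ex) fact
    have notQ: "j < i \<Longrightarrow> \<not> Q j" for j unfolding i_def by (rule not_less_Least)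
    have pos: "i \<in> positions w" using Qi by (simp add: Q_def)
    have i2N: "i \<le> 2 * N"
    proof (rule ccontr)
      assume "\<not> i \<le> 2 * N"
      then have "Q (2 * N)" using positions_less[OF pos, of "2 * N"] by (simp add: Q_def)
      then show False using notQ[of "2 * N"] \<open>\<not> i \<le> 2 * N\<close> by simp
    qed
    have before: "wnth w j = h ! j" if "j < i" for j
      using notQ[OF that] positions_less[OF pos, of j] that by (simp add: Q_def)
    have pre: "wtake i w = take i h"
    proof (rule nth_equalityI)
      show "length (wtake i w) = length (take i h)"
        using wtake_nth(1)[OF positions_wlen[OF pos]] i2N len by simp
      fix j assume "j < length (wtake i w)"
      then have "j < i" using wtake_nth(1)[OF positions_wlen[OF pos]] by simp
      then show "wtake i w ! j = take i h ! j"
        using wtake_nth(2)[OF positions_wlen[OF pos]] before by simp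
    qed
    have env: "wnth w i \<notin> ?A"
    proof
      assume "wnth w i \<in> ?A"
      then have *: "S (take i h) = Some (wnth w i)"
        using comp pos pre unfolding compatible_def by metis
      then obtain k where k: "k < N" "i = 2 * k" using S_None[OF i2N] by force
      then have "wnth w i = h ! i"
        using * S_take[OF k(1)] nth_history[of k \<sigma>s] by (simp add: h_def N_def)
      then show False using Qi k by (simp add: Q_def)
    qed
    moreover have "wnth w i \<in> (sys_acts n \<union> env_acts n) \<times> P"
      using w pos unfolding words_over_def by simp
    ultimately have "wnth w i \<in> env_acts n \<times> P" by (auto simp: mem_Times_iff)
    then obtain \<sigma> where \<sigma>: "\<sigma> \<in> ?A" "wnth w i = ack \<sigma>"
      using env_is_ack[of "wnth w i"] by metis
    \<comment> \<open>System moves only after prefixes of \<open>h\<close>; a move after the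
      deviation would force the play to agree with \<open>h\<close> at \<open>i\<close>.\<close>
    have later: "wnth w j \<notin> ?A" if "j \<in> positions w" "i < j" for j
    proof
      assume "wnth w j \<in> ?A"
      then have "S (wtake j w) \<noteq> None" using comp that unfolding compatible_def by auto
      then obtain k where k: "k < N" "wtake j w = take (2 * k) h"
        unfolding S_def by (meson option.distinct(1))
      then have "j = 2 * k" using wtake_nth(1)[OF positions_wlen[OF that(1)]] len by simp
      then have "wnth w i = h ! i"
        using wtake_nth(2)[OF positions_wlen[OF that(1)] that(2)] k that(2) by simp
      then show False using Qi \<open>j = 2 * k\<close> k(1) that(2) by (simp add: Q_def)
    qed
    \<comment> \<open>If the System letter answered at \<open>i\<close> occurs at all, it occurs
      before \<open>i\<close> and within \<open>h\<close>. Its regular acknowledgement then also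
      precedes \<open>i\<close>, and the one at \<open>i\<close> is a duplicate.\<close>
    have "\<exists>j\<in>positions w. j \<noteq> i \<and> wnth w j = ack \<sigma>" if mem: "\<sigma> \<in> letters w"
    proof -
      obtain j where j: "j \<in> positions w" "wnth w j = \<sigma>"
        using mem unfolding letters_def by blast
      have "j < i" using later[OF j(1)] env j(2) \<sigma>(1) by (metis linorder_neqE_nat)
      then have hj: "h ! j = \<sigma>" using before j(2) by simp
      have "j < 2 * length \<sigma>s" using \<open>j < i\<close> i2N by (simp add: N_def)
      then show ?thesis
      proof (cases rule: history_cases)
        case (1 k)
        then have \<sigma>k: "\<sigma> = \<sigma>s ! k" using hj by (simp add: h_def)
        then have ackh: "h ! Suc j = ack \<sigma>" using nth_history[OF 1(1)] 1(2) by (simp add: h_def)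
        have "Suc j \<noteq> i"
        proof
          assume "Suc j = i"
          then have "wnth w i = h ! i" "i < 2 * N" using ackh \<sigma> 1 by (auto simp: N_def)
          then show False using Qi by (simp add: Q_def)
        qed
        then have "Suc j < i" using \<open>j < i\<close> by simp
        then show ?thesis
          using before ackh positions_less[OF pos, of "Suc j"] by (intro bexI[of _ "Suc j"]) auto
      next
        case (2 k)
        then have "fst (\<sigma>s ! k) \<in> sys_acts n" using sub nth_mem by fastforce
        moreover have "ack (\<sigma>s ! k) = \<sigma>" using 2 hj by (simp add: h_def)
        ultimately show ?thesis using ack_not_sys \<sigma>(1) by (metis mem_Times_iff)
      qed
    qed
    then have "env_fault n w"
      unfolding env_fault_def using pos \<sigma> by (metis mem_Times_iff)
    then show ?thesis unfolding models_game_fm[OF w] by blast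
  qed
  then show ?thesis using strat unfolding winning_def by blast
qed

text \<open>If no such chain existed, every chain played according to \<open>S\<close> could be
  prolonged by the answer of \<open>S\<close>. Passing would complete a play in which
  \<open>g\<close> fails; after a move, Environment stays silent, so that this move is the only
  pending one and \<open>f\<close> is tested. As chains do not repeat letters and \<open>P\<close>
  is finite, this cannot go on.\<close>

lemma winning_chain:
  assumes P: "finite P" and S: "is_strategy (sys_acts n) (env_acts n) P S"
    and win: "winning (sys_acts n) (env_acts n) P (game_fm n (fm_of f) (fm_of g)) S"
    and acts: "actions_of (fm_of f) \<subseteq> sys_acts n" "actions_of (fm_of g) \<subseteq> sys_acts n"
    and start: "pmodels P {} f"
  shows "\<exists>\<sigma>s. chain n f P \<sigma>s \<and> pmodels P (set \<sigma>s) g"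
proof (rule ccontr)
  assume contra: "\<nexists>\<sigma>s. chain n f P \<sigma>s \<and> pmodels P (set \<sigma>s) g"
  let ?A = "sys_acts n \<times> P"
  let ?AE = "(sys_acts n \<union> env_acts n) \<times> P"
  define conf where "conf \<sigma>s \<longleftrightarrow> chain n f P \<sigma>s \<and>
    (\<forall>k<length \<sigma>s. S (history (take k \<sigma>s)) = Some (\<sigma>s ! k))" for \<sigma>s
  have extend: "\<exists>\<sigma>. conf (\<sigma>s @ [\<sigma>])" if \<sigma>s: "conf \<sigma>s" for \<sigma>s
  proof -
    let ?h = "history \<sigma>s"
    let ?N = "length \<sigma>s"
    have sub: "set \<sigma>s \<subseteq> ?A" and dist: "distinct \<sigma>s" using \<sigma>s by (auto simp: conf_def chain_def)
    have sys: "\<forall>\<sigma>\<in>set \<sigma>s. fst \<sigma> \<in> sys_acts n" using sub by auto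
    have "ack ` set \<sigma>s \<subseteq> env_acts n \<times> P" using sub ack_env by blast
    then have hl: "?h \<in> lists ?AE"
      using sub by (auto simp: set_history in_lists_conv_set)
    have gen: "S (take i ?h) = Some (?h ! i)" if "i < 2 * ?N" "?h ! i \<in> ?A" for i
      using that(1)
    proof (cases rule: history_cases)
      case (1 k)
      then show ?thesis using \<sigma>s by (simp add: conf_def take_history)
    next
      case (2 k)
      then have "fst (\<sigma>s ! k) \<in> sys_acts n" using sys by simp
      then show ?thesis using ack_not_sys that(2) 2(3) by (metis mem_Times_iff)
    qed
    show ?thesis
    proof (cases "S ?h")
      case None
      let ?w = "FinWord ?h"
      have w: "?w \<in> words_over ?AE"
        using hl by (auto simp: words_over_def positions_def in_lists_conv_set)
      have "compatible (sys_acts n) P S ?w"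
        using None gen by (auto simp: compatible_def positions_def)
      moreover have "fair (sys_acts n) P S ?w" by (simp add: fair_def)
      ultimately have mod: "models P ?w (game_fm n (fm_of f) (fm_of g))"
        using win w unfolding winning_def by blast
      have fol: "follows n \<sigma>s ?w"
        using sys dist by (auto simp: follows_def positions_def)
      have pos: "positions ?w = {..<2 * ?N}" by (auto simp: positions_def)
      have "\<not> is_pending n ?w i" for i unfolding follows_pending[OF fol] pos by simp
      then have "pmodels P (letters ?w) g"
        using mod follows_no_fault[OF fol] unfolding models_game_fm[OF w] by blast
      moreover have "letters ?w \<inter> sys_acts n \<times> UNIV = set \<sigma>s"
        using follows_sys_letters[OF fol, of "{}"] pos by simp
      ultimately have "pmodels P (set \<sigma>s) g" using pmodels_sys_letters[OF acts(2) sub] by blast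
      then show ?thesis using contra \<sigma>s unfolding conf_def by blast
    next
      case (Some \<sigma>)
      let ?u = "?h @ [\<sigma>]"
      have "Some \<sigma> \<in> insert None (Some ` ?A)"
        using S hl Some unfolding is_strategy_def by metis
      then have \<sigma>: "\<sigma> \<in> ?A" by blast
      have "?u \<in> lists ?AE" using hl \<sigma> by auto
      moreover have "S (take i ?u) = Some (?u ! i)" if "i < length ?u" "?u ! i \<in> ?A" for i
      proof (cases "i < 2 * ?N")
        case True
        then show ?thesis using gen[of i] that by (simp add: nth_append)
      next
        case False
        then have "i = 2 * ?N" using that by simp
        then show ?thesis using Some by (simp add: nth_append)
      qed
      ultimately obtain w where w: "w \<in> words_over ?AE" "compatible (sys_acts n) P S w"
        "fair (sys_acts n) P S w" and wu: "enat (length ?u) \<le> wlen w" "wtake (length ?u) w = ?u"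
        and late: "\<And>i. i \<in> positions w \<Longrightarrow> length ?u \<le> i \<Longrightarrow> wnth w i \<in> ?A"
        using strategy_extension[OF S, of ?u] by blast
      have wn: "wnth w i = ?u ! i" if "i \<le> 2 * ?N" for i
        using wtake_nth(2)[OF wu(1), of i] that unfolding wu(2) by simp
      have w\<sigma>: "wnth w (2 * ?N) = \<sigma>" using wn[of "2 * ?N"] by (simp add: nth_append)
      have pos: "i \<in> positions w" if "i \<le> 2 * ?N" for i
        using wu(1) that unfolding positions_def
        by simp (meson enat_ord_simps(2) less_le_trans le_imp_less_Suc)
      have enatN: "enat (2 * ?N) \<le> wlen w" using positions_wlen[OF pos] by simp
      have fol: "follows n \<sigma>s w"
        unfolding follows_def
      proof (intro conjI ballI impI)
        show "wtake (2 * ?N) w = ?h"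
          using wtake_nth[OF enatN] wn by (intro nth_equalityI) (auto simp: nth_append)
        show "fst (wnth w i) \<in> sys_acts n" if "i \<in> positions w" "2 * ?N \<le> i" for i
          using late[OF that(1)] that(2) w\<sigma> \<sigma> by (cases "i = 2 * ?N") (auto simp: mem_Times_iff)
      qed (use sys dist enatN in auto)
      have "models P w (game_fm n (fm_of f) (fm_of g))"
        using win w unfolding winning_def by blast
      then have one: "\<And>i j. is_pending n w i \<Longrightarrow> is_pending n w j \<Longrightarrow> i = j"
        and rep: "repetition_free n w" and J: "pmodels P (letters w) f"
        using follows_no_fault[OF fol] unfolding models_game_fm[OF w(1)] by blast+
      have new: "wnth w i \<notin> set \<sigma>s" if "i \<in> positions w" "2 * ?N \<le> i" for i
      proof
        assume "wnth w i \<in> set \<sigma>s"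
        then obtain k where k: "k < ?N" "\<sigma>s ! k = wnth w i" by (auto simp: in_set_conv_nth)
        then have "wnth w (2 * k) = wnth w i"
          using follows_nth[OF fol, of "2 * k"] nth_history[of k \<sigma>s] by simp
        moreover have "fst (wnth w i) \<in> sys_acts n" using fol that unfolding follows_def by blast
        moreover have "2 * k \<in> positions w" using pos k by simp
        ultimately have "i = 2 * k" using rep that(1) unfolding repetition_free_def by metis
        then show False using k that by simp
      qed
      have pend: "is_pending n w i" if "i \<in> positions w" "2 * ?N \<le> i" for i
        unfolding follows_pending[OF fol] using that new by blast
      \<comment> \<open>Every move of the tail is pending, and only one may be: facing a silent
        Environment, System cannot afford a second move.\<close>
      have "i = 2 * ?N" if "i \<in> positions w" "2 * ?N \<le> i" for i
        using one[OF pend[OF that] pend[OF pos]] by simp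
      then have posw: "positions w = {..<2 * ?N} \<union> {2 * ?N}"
        using pos by (auto, metis le_less_linear)
      then have "letters w \<inter> sys_acts n \<times> UNIV = set (\<sigma>s @ [\<sigma>])"
        using follows_sys_letters[OF fol posw] w\<sigma> by simp
      then have "pmodels P (set (\<sigma>s @ [\<sigma>])) f"
        using J sub \<sigma> pmodels_sys_letters[OF acts(1), of "\<sigma>s @ [\<sigma>]" P "letters w"] by simp
      moreover have "\<sigma> \<notin> set \<sigma>s" using new[OF pos] w\<sigma> by simp
      ultimately have "conf (\<sigma>s @ [\<sigma>])"
        using \<sigma>s \<sigma> Some by (auto simp: conf_def chain_def le_Suc_eq nth_append less_Suc_eq)
      then show ?thesis by blast
    qed
  qed
  have "\<exists>\<sigma>s. conf \<sigma>s \<and> length \<sigma>s = N" for N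
  proof (induction N)
    case 0
    show ?case using start by (simp add: conf_def chain_def)
  next
    case (Suc N)
    then show ?case using extend by (metis length_append_singleton)
  qed
  then obtain \<sigma>s where \<sigma>s: "conf \<sigma>s" "length \<sigma>s = Suc (card ?A)" by blast
  then have "card (set \<sigma>s) = Suc (card ?A)" "set \<sigma>s \<subseteq> ?A"
    by (auto simp: conf_def chain_def distinct_card)
  moreover have "finite ?A" using P by (simp add: sys_acts_def)
  ultimately show False by (metis card_mono Suc_n_not_le_n)
qed

section \<open>Runs as chains of sets of letters\<close>

fun pBigOr :: "(nat \<Rightarrow> pfm) \<Rightarrow> nat \<Rightarrow> pfm" where
  "pBigOr F 0 = PEx X (PNeg (PEq X X))"
| "pBigOr F (Suc n) = POr (F n) (pBigOr F n)"

fun pBigAnd :: "(nat \<Rightarrow> pfm) \<Rightarrow> nat \<Rightarrow> pfm" where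
  "pBigAnd F 0 = PAll X (PEq X X)"
| "pBigAnd F (Suc n) = PAnd (F n) (pBigAnd F n)"

lemma psat_pBigOr [simp]: "psat P B e (pBigOr F n) \<longleftrightarrow> (\<exists>i<n. psat P B e (F i))"
  by (induction n) (auto simp: less_Suc_eq)

lemma psat_pBigAnd [simp]: "psat P B e (pBigAnd F n) \<longleftrightarrow> (\<forall>i<n. psat P B e (F i))"
  by (induction n) (auto simp: less_Suc_eq)

abbreviation "pImp f g \<equiv> POr (PNeg f) g"
text \<open>Conditions on the machine are known when the formula is built, so they are decided
  there; a false one leaves behind a false sentence.\<close>

abbreviation "pIf b f \<equiv> (if b then f else PEx X (PNeg (PEq X X)))"

section \<open>Machine configurations as sets of letters\<close>

definition src :: "trans \<Rightarrow> nat" where "src t = fst t"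
definition opr :: "trans \<Rightarrow> oper" where "opr t = fst (snd t)"
definition tgt :: "trans \<Rightarrow> nat" where "tgt t = snd (snd t)"

fun is_incr :: "oper \<Rightarrow> bool" where "is_incr (Incr c) = True" | "is_incr _ = False"
fun is_decr :: "oper \<Rightarrow> bool" where "is_decr (Decr c) = True" | "is_decr _ = False"

text \<open>Taking transition \<open>j\<close> consists of three System moves. A letter \<open>12 j\<close> is put on the process
  that carries the effect of \<open>j\<close>; before that, the previous transition is marked as ending
  by its letter \<open>+ 4\<close>, afterwards it is closed by its letter \<open>+ 8\<close>. The mark is what tells the old
  transition from the new one in an unordered set of letters. The letters \<open>4 i + 2\<close> are left for
  the labels of the input.\<close>

definition started :: "letter set \<Rightarrow> nat \<Rightarrow> process \<Rightarrow> bool" where "started B j p \<longleftrightarrow> (12 * j, p) \<in> B"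
definition marked :: "letter set \<Rightarrow> nat \<Rightarrow> process \<Rightarrow> bool" where "marked B j p \<longleftrightarrow> (12 * j + 4, p) \<in> B"
definition finished :: "letter set \<Rightarrow> nat \<Rightarrow> process \<Rightarrow> bool" where "finished B j p \<longleftrightarrow> (12 * j + 8, p) \<in> B"
definition active :: "letter set \<Rightarrow> nat \<Rightarrow> process \<Rightarrow> bool" where
  "active B j p \<longleftrightarrow> started B j p \<and> \<not> marked B j p"
definition ending :: "letter set \<Rightarrow> nat \<Rightarrow> process \<Rightarrow> bool" where
  "ending B j p \<longleftrightarrow> marked B j p \<and> \<not> finished B j p"

text \<open>The value of counter \<open>c\<close> is the number of processes with an increment of \<open>c\<close> that no decrement
  has consumed.\<close>

definition alive :: "trans list \<Rightarrow> letter set \<Rightarrow> nat \<Rightarrow> process \<Rightarrow> bool" where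
  "alive T B c p \<longleftrightarrow> (\<exists>j<length T. opr (T ! j) = Incr c \<and> started B j p) \<and>
     \<not> (\<exists>j<length T. is_decr (opr (T ! j)) \<and> started B j p)"

text \<open>That no earlier decrement has consumed the process is left to \<open>place_ok\<close>.
  Zero tests are exact because the absence of live processes is first-order expressible.\<close>

fun counter_ok :: "trans list \<Rightarrow> letter set \<Rightarrow> oper \<Rightarrow> process \<Rightarrow> bool" where
  "counter_ok T B (Decr c) p = (\<exists>k<length T. opr (T ! k) = Incr c \<and> started B k p)"
| "counter_ok T B (IsZero c) p = (\<forall>q. \<not> alive T B c q)"
| "counter_ok T B _ p = True"

text \<open>Uses of a transition are counted by the processes that carry its letter, so each use
  takes a process of its own. Only a decrement shares one, namely with the increment that it
  cancels.\<close>

definition place_ok :: "trans list \<Rightarrow> letter set \<Rightarrow> nat \<Rightarrow> process \<Rightarrow> bool" where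
  "place_ok T B j p \<longleftrightarrow> (\<forall>k<length T. k \<noteq> j \<longrightarrow> started B k p \<longrightarrow>
     is_decr (opr (T ! j)) \<and> is_incr (opr (T ! k)))"

definition ordered :: "trans list \<Rightarrow> letter set \<Rightarrow> bool" where
  "ordered T B \<longleftrightarrow> (\<forall>j<length T. \<forall>p. (marked B j p \<longrightarrow> started B j p) \<and> (finished B j p \<longrightarrow> marked B j p))"

text \<open>A set without order records a step in this way: the latest transition is active, its
  predecessor is still ending, and the two must fit together.\<close>

definition linked :: "trans list \<Rightarrow> letter set \<Rightarrow> bool" where
  "linked T B \<longleftrightarrow> (\<forall>j<length T. \<forall>k<length T. \<forall>p q.
     (active B j p \<longrightarrow> active B k q \<longrightarrow> j = k \<and> p = q) \<and>
     (ending B j p \<longrightarrow> ending B k q \<longrightarrow> j = k \<and> p = q) \<and>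
     (active B j p \<longrightarrow> ending B k q \<longrightarrow> tgt (T ! k) = src (T ! j)))"

text \<open>With no transition active or ending, the current state would be lost and the play could
  resume anywhere; hence the old transition is finished only after a new one has started. The demand
  for transition \<open>1\<close> is already due at the first start letter, which must therefore be
  its own.\<close>

definition running :: "trans list \<Rightarrow> letter set \<Rightarrow> bool" where
  "running T B \<longleftrightarrow> (\<forall>j<length T. \<forall>p. started B j p \<longrightarrow>
     (\<exists>q. started B 1 q) \<and> (\<exists>k<length T. \<exists>q. active B k q \<or> ending B k q))"

text \<open>Only the active transition is examined. No other can start beside it, so it is tested
  against the counters at the time it is taken; once it is marked, they are free to change.\<close>

definition legal :: "trans list \<Rightarrow> letter set \<Rightarrow> bool" where
  "legal T B \<longleftrightarrow> (\<forall>j<length T. \<forall>p. active B j p \<longrightarrow> place_ok T B j p \<and> counter_ok T B (opr (T ! j)) p)"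

text \<open>\<open>legal\<close> forgets transitions that are no longer active, but the counter to
  which a live process belongs has to stay unique.\<close>

definition single :: "trans list \<Rightarrow> letter set \<Rightarrow> bool" where
  "single T B \<longleftrightarrow> (\<forall>j<length T. \<forall>k<length T. \<forall>p. is_incr (opr (T ! j)) \<longrightarrow> is_incr (opr (T ! k)) \<longrightarrow>
     started B j p \<longrightarrow> started B k p \<longrightarrow> j = k)"

definition valid :: "trans list \<Rightarrow> letter set \<Rightarrow> bool" where
  "valid T B \<longleftrightarrow> ordered T B \<and> linked T B \<and> running T B \<and> legal T B \<and> single T B"

section \<open>The conditions as formulas about processes\<close>

definition startedF :: "nat \<Rightarrow> var \<Rightarrow> pfm" where "startedF j v = PAct (12 * j) v"
definition markedF :: "nat \<Rightarrow> var \<Rightarrow> pfm" where "markedF j v = PAct (12 * j + 4) v"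
definition finishedF :: "nat \<Rightarrow> var \<Rightarrow> pfm" where "finishedF j v = PAct (12 * j + 8) v"
definition activeF :: "nat \<Rightarrow> var \<Rightarrow> pfm" where "activeF j v = PAnd (startedF j v) (PNeg (markedF j v))"
definition endingF :: "nat \<Rightarrow> var \<Rightarrow> pfm" where "endingF j v = PAnd (markedF j v) (PNeg (finishedF j v))"

definition aliveF :: "trans list \<Rightarrow> nat \<Rightarrow> var \<Rightarrow> pfm" where
  "aliveF T c v = PAnd (pBigOr (\<lambda>j. pIf (opr (T ! j) = Incr c) (startedF j v)) (length T))
     (PNeg (pBigOr (\<lambda>j. pIf (is_decr (opr (T ! j))) (startedF j v)) (length T)))"

fun counterF :: "trans list \<Rightarrow> oper \<Rightarrow> pfm" where
  "counterF T (Decr c) = pBigOr (\<lambda>k. pIf (opr (T ! k) = Incr c) (startedF k X)) (length T)"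
| "counterF T (IsZero c) = PAll X (PNeg (aliveF T c X))"
| "counterF T _ = PAll X (PEq X X)"

definition placeF :: "trans list \<Rightarrow> nat \<Rightarrow> pfm" where
  "placeF T j = pBigAnd (\<lambda>k. PNeg (pIf (k \<noteq> j \<and> \<not> (is_decr (opr (T ! j)) \<and> is_incr (opr (T ! k)))) (startedF k X)))
     (length T)"

definition orderedF :: "trans list \<Rightarrow> pfm" where
  "orderedF T = pBigAnd (\<lambda>j. PAll X (PAnd (pImp (markedF j X) (startedF j X)) (pImp (finishedF j X) (markedF j X)))) (length T)"

definition linkedF :: "trans list \<Rightarrow> pfm" where
  "linkedF T = pBigAnd (\<lambda>j. pBigAnd (\<lambda>k. PAll X (PAll Y
     (PAnd (pImp (PAnd (activeF j X) (activeF k Y)) (pIf (j = k) (PEq X Y)))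
       (PAnd (pImp (PAnd (endingF j X) (endingF k Y)) (pIf (j = k) (PEq X Y)))
         (pImp (PAnd (activeF j X) (endingF k Y)) (pIf (tgt (T ! k) = src (T ! j)) (PEq X X)))))))
     (length T)) (length T)"

definition runningF :: "trans list \<Rightarrow> pfm" where
  "runningF T = PAll X (pImp (pBigOr (\<lambda>j. startedF j X) (length T))
     (PAnd (PEx X (startedF 1 X)) (PEx X (pBigOr (\<lambda>j. POr (activeF j X) (endingF j X)) (length T)))))"

definition legalF :: "trans list \<Rightarrow> pfm" where
  "legalF T = pBigAnd (\<lambda>j. PAll X (pImp (activeF j X) (PAnd (placeF T j) (counterF T (opr (T ! j))))))
     (length T)"

definition singleF :: "trans list \<Rightarrow> pfm" where
  "singleF T = pBigAnd (\<lambda>j. pBigAnd (\<lambda>k. PAll X (PNeg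
     (pIf (j \<noteq> k \<and> is_incr (opr (T ! j)) \<and> is_incr (opr (T ! k))) (PAnd (startedF j X) (startedF k X)))))
     (length T)) (length T)"

definition validF :: "trans list \<Rightarrow> pfm" where
  "validF T = PAnd (orderedF T) (PAnd (linkedF T) (PAnd (runningF T) (PAnd (legalF T) (singleF T))))"

lemma psat_basic:
  "psat P B e (startedF j v) \<longleftrightarrow> started B j (e v)" "psat P B e (markedF j v) \<longleftrightarrow> marked B j (e v)"
  "psat P B e (finishedF j v) \<longleftrightarrow> finished B j (e v)" "psat P B e (activeF j v) \<longleftrightarrow> active B j (e v)"
  "psat P B e (endingF j v) \<longleftrightarrow> ending B j (e v)" "psat P B e (pIf b f) \<longleftrightarrow> b \<and> psat P B e f"
  by (auto simp: startedF_def markedF_def finishedF_def activeF_def endingF_def started_def marked_def finished_def active_def ending_def)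

lemma psat_aliveF: "psat P B e (aliveF T c v) \<longleftrightarrow> alive T B c (e v)"
  by (simp add: aliveF_def psat_basic alive_def)

context
  fixes P :: "process set" and B :: "letter set"
  assumes B: "B \<subseteq> UNIV \<times> P"
begin

text \<open>The predicates quantify over all processes and the formulas over \<open>P\<close>; the
  two agree because no letter lies outside \<open>P\<close>.\<close>

lemma letter_process: "started B j p \<Longrightarrow> p \<in> P" "marked B j p \<Longrightarrow> p \<in> P" "finished B j p \<Longrightarrow> p \<in> P"
    "active B j p \<Longrightarrow> p \<in> P" "ending B j p \<Longrightarrow> p \<in> P" "alive T B c p \<Longrightarrow> p \<in> P"
  using B by (auto simp: started_def marked_def finished_def active_def ending_def alive_def)

lemma psat_counterF: "psat P B e (counterF T a) \<longleftrightarrow> counter_ok T B a (e X)"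
  using letter_process(6) by (cases a) (auto simp: psat_basic psat_aliveF)

lemma psat_placeF: "psat P B e (placeF T j) \<longleftrightarrow> place_ok T B j (e X)"
  by (auto simp: placeF_def psat_basic place_ok_def)

lemma psat_orderedF: "psat P B e (orderedF T) \<longleftrightarrow> ordered T B"
  unfolding orderedF_def ordered_def using letter_process(2,3) by (simp add: psat_basic) blast

lemma psat_linkedF: "psat P B e (linkedF T) \<longleftrightarrow> linked T B"
  unfolding linkedF_def linked_def using letter_process(4,5) by (simp add: psat_basic) blast

lemma psat_runningF: "psat P B e (runningF T) \<longleftrightarrow> running T B"
  unfolding runningF_def running_def using letter_process(1,4,5) by (simp add: psat_basic) blast

lemma psat_legalF: "psat P B e (legalF T) \<longleftrightarrow> legal T B"
  unfolding legalF_def legal_def using letter_process(4)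
  by (simp add: psat_basic psat_placeF psat_counterF) blast

lemma psat_singleF: "psat P B e (singleF T) \<longleftrightarrow> single T B"
  unfolding singleF_def single_def using letter_process(1) by (simp add: psat_basic) blast

lemma pmodels_validF: "pmodels P B (validF T) \<longleftrightarrow> valid T B"
  unfolding pmodels_def validF_def valid_def
  by (simp add: psat_orderedF psat_linkedF psat_runningF psat_legalF psat_singleF)

end

section \<open>From chains to runs\<close>

inductive run :: "trans list \<Rightarrow> nat \<times> store \<Rightarrow> nat list \<Rightarrow> nat \<times> store \<Rightarrow> bool" for T c where
  run_Nil: "run T c [] c"
| run_snoc: "run T c js (q, s) \<Longrightarrow> j < length T \<Longrightarrow> T ! j = (q, a, q') \<Longrightarrow> oper_sem a s s' \<Longrightarrow>
    run T c (js @ [j]) (q', s')"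

text \<open>Between the start of a transition and the finish of its predecessor both are visible, so
  the active one takes precedence.\<close>

definition in_state :: "trans list \<Rightarrow> letter set \<Rightarrow> nat \<Rightarrow> bool" where
  "in_state T B q \<longleftrightarrow> (\<exists>j<length T. \<exists>p. active B j p \<and> tgt (T ! j) = q) \<or>
     (\<forall>j<length T. \<forall>p. \<not> active B j p) \<and> (\<exists>j<length T. \<exists>p. ending B j p \<and> tgt (T ! j) = q)"

text \<open>Transition \<open>1\<close> is exempt because its initial use precedes the run, which
  begins in the target of that transition.\<close>

definition represents :: "trans list \<Rightarrow> letter set \<Rightarrow> nat list \<Rightarrow> store \<Rightarrow> bool" where
  "represents T B js s \<longleftrightarrow> (\<forall>k<length T. k \<noteq> 1 \<longrightarrow> card {p. started B k p} = count_list js k) \<and>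
     (\<forall>c. s c = card {p. alive T B c p})"

definition traced :: "trans list \<Rightarrow> letter set \<Rightarrow> bool" where
  "traced T B \<longleftrightarrow> (\<forall>j<length T. \<forall>p. \<not> started B j p) \<or>
     (\<exists>js q s. run T (tgt (T ! 1), \<lambda>_. 0) js (q, s) \<and> represents T B js s \<and> in_state T B q)"

lemma letter_code_distinct [simp]: "12 * j \<noteq> 12 * k + (4::nat)" "12 * j \<noteq> 12 * k + (8::nat)"
   "12 * j + 4 \<noteq> 12 * k + (8::nat)" "12 * k + (4::nat) \<noteq> 12 * j" "12 * k + (8::nat) \<noteq> 12 * j"
   "12 * k + (8::nat) \<noteq> 12 * j + 4"
  by presburger+

lemma insert_letter [simp]:
  "started (insert (12 * j, p) B) k q \<longleftrightarrow> k = j \<and> q = p \<or> started B k q"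
  "marked (insert (12 * j, p) B) = marked B" "finished (insert (12 * j, p) B) = finished B"
  "started (insert (12 * j + 4, p) B) = started B" "finished (insert (12 * j + 4, p) B) = finished B"
  "marked (insert (12 * j + 4, p) B) k q \<longleftrightarrow> k = j \<and> q = p \<or> marked B k q"
  "started (insert (12 * j + 8, p) B) = started B" "marked (insert (12 * j + 8, p) B) = marked B"
  "finished (insert (12 * j + 8, p) B) k q \<longleftrightarrow> k = j \<and> q = p \<or> finished B k q"
  by (auto simp: started_def marked_def finished_def fun_eq_iff)

lemma alive_cong: "(\<And>j p. j < length T \<Longrightarrow> started B j p = started B' j p) \<Longrightarrow> alive T B c p = alive T B' c p"
  unfolding alive_def by blast

lemma represents_cong:
  assumes "\<And>j p. j < length T \<Longrightarrow> started B j p = started B' j p"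
  shows "represents T B js s = represents T B' js s"
proof -
  have "started B k = started B' k" if "k < length T" for k using assms that by blast
  moreover have "alive T B = alive T B'" using alive_cong[OF assms] by blast
  ultimately show ?thesis unfolding represents_def by simp
qed

lemma represents_start:
  assumes j1: "j = 1" and op: "opr (T ! j) = Nop" and none: "\<And>j p. j < length T \<Longrightarrow> \<not> started B j p"
  shows "represents T (insert (12 * j, p) B) [] (\<lambda>_. 0)"
proof -
  let ?B = "insert (12 * j, p) B"
  have s: "started ?B k q \<longleftrightarrow> k = j \<and> q = p" if "k < length T" for k q using none that by auto
  have "\<not> alive T ?B c q" for c q
  proof
    assume "alive T ?B c q"
    then obtain k where "k < length T" "opr (T ! k) = Incr c" "started ?B k q"
    unfolding alive_def by blast
    then show False using s op j1 by auto
  qed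
  then have "0 = card {q. alive T ?B c q}" for c by simp
  moreover have "card {q. started ?B k q} = 0" if "k < length T" "k \<noteq> 1" for k
    using s[OF that(1)] that(2) j1 by simp
  ultimately show ?thesis unfolding represents_def count_list.simps by blast
qed

lemma traced_start:
  assumes "1 < length T" and op1: "opr (T ! 1) = Nop" and v: "valid T B"
    and none: "\<And>j p. j < length T \<Longrightarrow> \<not> started B j p" and j: "j < length T"
    and v': "valid T (insert (12 * j, p) B)"
  shows "traced T (insert (12 * j, p) B)"
proof -
  let ?B = "insert (12 * j, p) B"
  have "started ?B j p" by simp
  then have "\<exists>q. started ?B 1 q" using v' j unfolding valid_def running_def by blast
  then have j1: "j = 1" using none[of 1] assms(1) by auto
  have "\<not> marked B j p" using v none j unfolding valid_def ordered_def by blast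
  then have "active ?B j p" by (simp add: active_def)
  then have "active ?B 1 p" unfolding j1 .
  then have "in_state T ?B (tgt (T ! 1))" unfolding in_state_def using assms(1) by blast
  moreover have "represents T ?B [] (\<lambda>_. 0)"
    using represents_start[OF j1 _ none] op1 j1 by simp
  ultimately show ?thesis unfolding traced_def using run_Nil by blast
qed

lemma finite_started: "finite B \<Longrightarrow> finite {p. started B k p}"
  by (rule finite_subset[of _ "snd ` B"]) (auto simp: started_def intro: rev_image_eqI)

lemma finite_alive: "finite B \<Longrightarrow> finite {p. alive T B c p}"
  by (rule finite_subset[of _ "snd ` B"]) (auto simp: alive_def started_def intro: rev_image_eqI)

lemma alive_counter:
  assumes "single T B" "j < length T" "started B j p" "opr (T ! j) = Incr c" "alive T B c' p"
  shows "c' = c"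
proof -
  obtain k where "k < length T" "opr (T ! k) = Incr c'" "started B k p"
    using assms(5) unfolding alive_def by blast
  then have "k = j" using assms unfolding single_def by (metis is_incr.simps(1))
  then show ?thesis using assms(4) \<open>opr (T ! k) = Incr c'\<close> by simp
qed

text \<open>Except for a decrement, the new letter goes to a process without any transition, so
  exactly one live process appears or none does. A decrement ends a process that was alive for
  \<open>c\<close> and, by \<open>single\<close>, for no other counter. The translations in both
  directions rest on this.\<close>

lemma represents_step:
  assumes fin: "finite B" and rep: "represents T B js s" and j: "j < length T" and new: "\<not> started B j p"
    and sgl: "single T (insert (12 * j, p) B)"
    and place: "place_ok T (insert (12 * j, p) B) j p"
    and count: "counter_ok T (insert (12 * j, p) B) (opr (T ! j)) p"
  shows "\<exists>s'. oper_sem (opr (T ! j)) s s' \<and> represents T (insert (12 * j, p) B) (js @ [j]) s'"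
proof -
  let ?B = "insert (12 * j, p) B"
  have counts: "card {q. started ?B k q} = count_list (js @ [j]) k" if "k < length T" "k \<noteq> 1" for k
  proof (cases "k = j")
    case True
    have "{q. started ?B j q} = insert p {q. started B j q}" by auto
    then show ?thesis using True rep that new finite_started[OF fin] by (simp add: represents_def)
  next
    case False
    then show ?thesis using rep that by (simp add: represents_def)
  qed
  have s: "s c = card {q. alive T B c q}" for c using rep by (simp add: represents_def)
  have other: "alive T ?B c q \<longleftrightarrow> alive T B c q" if "q \<noteq> p" for c q
    using that by (simp add: alive_def)
  have fresh: "\<not> started B k p" if "k < length T" "\<not> is_decr (opr (T ! j))" for k
    using place that new unfolding place_ok_def by (cases "k = j") auto
  show ?thesis
  proof (cases "opr (T ! j)")
    case (Incr c)
    have dead: "\<not> alive T B d p" for d using fresh Incr by (simp add: alive_def)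
    have born: "alive T ?B d p \<longleftrightarrow> d = c" for d
      using fresh Incr j by (auto simp: alive_def)
    have "alive T ?B d q \<longleftrightarrow> alive T B d q \<or> d = c \<and> q = p" for d q
      using dead born other by (cases "q = p") auto
    then have "{q. alive T ?B c q} = insert p {q. alive T B c q}"
      "\<And>d. d \<noteq> c \<Longrightarrow> {q. alive T ?B d q} = {q. alive T B d q}"
      by auto
    with dead have "represents T ?B (js @ [j]) (s(c := Suc (s c)))"
      using counts s finite_alive[OF fin] by (simp add: represents_def)
    then show ?thesis by (simp add: Incr)
  next
    case (Decr c)
    obtain k where k: "k < length T" "opr (T ! k) = Incr c" "started B k p"
      using count Decr by (auto split: if_splits)
    have no: "\<not> (\<exists>i<length T. is_decr (opr (T ! i)) \<and> started B i p)"
    proof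
      assume "\<exists>i<length T. is_decr (opr (T ! i)) \<and> started B i p"
      then obtain i where i: "i < length T" "is_decr (opr (T ! i))" "started B i p" by blast
      then have "is_incr (opr (T ! i))" using place new unfolding place_ok_def by (metis insert_letter(1))
      then show False using i(2) by (cases "opr (T ! i)") auto
    qed
    have al: "alive T B c p" using k no unfolding alive_def by blast
    have "is_decr (opr (T ! j))" "started ?B j p" by (simp_all add: Decr)
    then have dead: "\<not> alive T ?B d p" for d using j unfolding alive_def by blast
    have unique: "\<not> alive T B d p" if "d \<noteq> c" for d
    proof
      assume "alive T B d p"
      moreover have "single T B" using sgl unfolding single_def by simp
      ultimately show False using alive_counter k that by metis
    qed
    have "alive T ?B d q \<longleftrightarrow> alive T B d q \<and> (d = c \<longrightarrow> q \<noteq> p)" for d q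
      using dead unique other by (cases "q = p") auto
    then have "{q. alive T ?B c q} = {q. alive T B c q} - {p}"
      "\<And>d. d \<noteq> c \<Longrightarrow> {q. alive T ?B d q} = {q. alive T B d q}"
      by auto
    then have "represents T ?B (js @ [j]) (s(c := s c - 1))"
      using counts s al finite_alive[OF fin] by (simp add: represents_def)
    moreover have "s c > 0" using al s finite_alive[OF fin] by (auto simp: card_gt_0_iff)
    ultimately show ?thesis by (simp add: Decr)
  next
    case (IsZero c)
    have same: "alive T ?B d q \<longleftrightarrow> alive T B d q" for d q
      using fresh IsZero j other by (cases "q = p") (auto simp: alive_def)
    then have "s c = 0" using count s IsZero by simp
    moreover have "represents T ?B (js @ [j]) s" using counts s same by (simp add: represents_def)
    ultimately show ?thesis by (simp add: IsZero)
  next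
    case Nop
    have same: "alive T ?B d q \<longleftrightarrow> alive T B d q" for d q
      using fresh Nop j other by (cases "q = p") (auto simp: alive_def)
    then have "represents T ?B (js @ [j]) s" using counts s same by (simp add: represents_def)
    then show ?thesis by (simp add: Nop)
  qed
qed

text \<open>The new transition is active, so by \<open>linked\<close> none was active before. The
  state was thus read from an ending transition, whose target is now required to be the source of
  the new one, and the run grows by a step.\<close>

lemma traced_insert_start:
  assumes T: "1 < length T" "opr (T ! 1) = Nop" and fin: "finite B" and v: "valid T B" and tr: "traced T B"
    and j: "j < length T" and new: "\<not> started B j p" and v': "valid T (insert (12 * j, p) B)"
  shows "traced T (insert (12 * j, p) B)"
proof (cases "\<forall>j<length T. \<forall>p. \<not> started B j p")
  case True
  then show ?thesis using traced_start[OF T v _ j v'] by blast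
next
  case False
  let ?B = "insert (12 * j, p) B"
  obtain js q s where r: "run T (tgt (T ! 1), \<lambda>_. 0) js (q, s)" "represents T B js s" "in_state T B q"
    using tr False unfolding traced_def by blast
  have nen: "\<not> marked B j p" using v j new unfolding valid_def ordered_def by blast
  then have act: "active ?B j p" by (simp add: active_def)
  have "\<not> active B k q'" if "k < length T" for k q'
  proof
    assume *: "active B k q'"
    then have "active ?B k q'" by (simp add: active_def)
    then have "k = j \<and> q' = p" using v' act j that unfolding valid_def linked_def by blast
    then show False using * new by (simp add: active_def)
  qed
  then obtain k q' where k: "k < length T" "ending B k q'" "tgt (T ! k) = q"
    using r(3) unfolding in_state_def by blast
  then have "ending ?B k q'" by (simp add: ending_def)
  then have "tgt (T ! k) = src (T ! j)" using v' act j k(1) unfolding valid_def linked_def by blast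
  then have Tj: "T ! j = (q, opr (T ! j), tgt (T ! j))" using k(3) by (simp add: src_def opr_def tgt_def prod_eq_iff)
  obtain s' where s': "oper_sem (opr (T ! j)) s s'" "represents T ?B (js @ [j]) s'"
    using represents_step[OF fin r(2) j new] v' act j unfolding valid_def legal_def by blast
  moreover have "in_state T ?B (tgt (T ! j))" unfolding in_state_def using act j by blast
  ultimately show ?thesis unfolding traced_def using run_snoc[OF r(1) j Tj s'(1)] by blast
qed

text \<open>A mark changes only where the state is read: the one active transition turns into an
  ending one with the same target.\<close>

lemma traced_insert_mark:
  assumes v: "valid T B" and tr: "traced T B" and j: "j < length T" and new: "\<not> marked B j p"
    and v': "valid T (insert (12 * j + 4, p) B)"
  shows "traced T (insert (12 * j + 4, p) B)"
proof -
  let ?B = "insert (12 * j + 4, p) B"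
  have started: "started B j p" using v' j unfolding valid_def ordered_def by auto
  then obtain js q s where r: "run T (tgt (T ! 1), \<lambda>_. 0) js (q, s)" "represents T B js s" "in_state T B q"
    using tr j unfolding traced_def by blast
  have act: "active B j p" using started new by (simp add: active_def)
  then have uniq: "k = j \<and> q' = p" if "active B k q'" "k < length T" for k q'
    using v j that unfolding valid_def linked_def by blast
  then have "tgt (T ! j) = q" using r(3) act j unfolding in_state_def by blast
  moreover have "ending ?B j p" using v j new unfolding valid_def ordered_def by (auto simp: ending_def)
  moreover have "\<not> active ?B k q'" if "k < length T" for k q'
  proof
    assume a: "active ?B k q'"
    then have "active B k q'" by (simp add: active_def)
    then have "k = j \<and> q' = p" by (rule uniq) (rule that)
    then show False using a by (simp add: active_def)
  qed
  ultimately have "in_state T ?B q" unfolding in_state_def using j by blast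
  moreover have "represents T ?B js s" using r(2) represents_cong[of T ?B B] by simp
  ultimately show ?thesis unfolding traced_def using r(1) by blast
qed

text \<open>If a transition is active, the state does not depend on the ending one. Otherwise
  \<open>running\<close> leaves some transition ending, and by \<open>linked\<close> it is the one
  from which the state was read.\<close>

lemma traced_insert_finish:
  assumes v: "valid T B" and tr: "traced T B" and j: "j < length T"
    and v': "valid T (insert (12 * j + 8, p) B)"
  shows "traced T (insert (12 * j + 8, p) B)"
proof -
  let ?B = "insert (12 * j + 8, p) B"
  have "started B j p" using v' j unfolding valid_def ordered_def by auto
  then obtain js q s where r: "run T (tgt (T ! 1), \<lambda>_. 0) js (q, s)" "represents T B js s" "in_state T B q"
    using tr j unfolding traced_def by blast
  have stB: "started ?B j p" using \<open>started B j p\<close> by simp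
  have act: "active ?B = active B" by (simp add: active_def fun_eq_iff)
  have "in_state T ?B q"
  proof (cases "\<exists>k<length T. \<exists>q'. active B k q'")
    case True
    then show ?thesis using r(3) unfolding in_state_def act by blast
  next
    case False
    then obtain k q' where k: "k < length T" "ending B k q'" "tgt (T ! k) = q"
      using r(3) unfolding in_state_def by blast
    obtain i r where i: "i < length T" "active ?B i r \<or> ending ?B i r"
      using v' stB j unfolding valid_def running_def by blast
    then have e: "ending ?B i r" using False act by auto
    then have "ending B i r" by (auto simp: ending_def)
    then have "i = k" using v i(1) k unfolding valid_def linked_def by blast
    then show ?thesis using e False k unfolding in_state_def act by blast
  qed
  moreover have "represents T ?B js s" using r(2) represents_cong[of T ?B B] by simp
  ultimately show ?thesis unfolding traced_def using r(1) by blast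
qed

lemma traced_other:
  assumes "traced T B" and "\<And>j. j < length T \<Longrightarrow> a \<noteq> 12 * j \<and> a \<noteq> 12 * j + 4 \<and> a \<noteq> 12 * j + 8"
  shows "traced T (insert (a, p) B)"
proof -
  let ?B = "insert (a, p) B"
  have eq: "started ?B j q = started B j q" "marked ?B j q = marked B j q" "finished ?B j q = finished B j q" if "j < length T" for j q
    using assms(2)[OF that] by (auto simp: started_def marked_def finished_def)
  have "represents T ?B js s = represents T B js s" for js s
    by (rule represents_cong) (rule eq)
  moreover have "in_state T ?B q = in_state T B q" for q
    unfolding in_state_def active_def ending_def using eq by (simp cong: conj_cong)
  ultimately show ?thesis using assms(1) eq(1) unfolding traced_def by simp
qed

lemma chain_traced:
  assumes T: "1 < length T" "opr (T ! 1) = Nop" and chain: "chain n (validF T) P \<sigma>s"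
  shows "traced T (set \<sigma>s)"
  using chain
proof (induction \<sigma>s rule: rev_induct)
  case Nil
  show ?case by (simp add: traced_def started_def)
next
  case (snoc \<sigma> \<sigma>s)
  obtain a p where \<sigma>: "\<sigma> = (a, p)" by fastforce
  have ch: "chain n (validF T) P \<sigma>s"
  proof -
    have "pmodels P (set (take k \<sigma>s)) (validF T)" if "k \<le> length \<sigma>s" for k
    proof -
      have "k \<le> length (\<sigma>s @ [\<sigma>])" using that by simp
      then have "pmodels P (set (take k (\<sigma>s @ [\<sigma>]))) (validF T)"
        using snoc.prems unfolding chain_def by blast
      then show ?thesis using that by simp
    qed
    then show ?thesis using snoc.prems unfolding chain_def by simp
  qed
  then have tr: "traced T (set \<sigma>s)" by (rule snoc.IH)
  have "set (\<sigma>s @ [\<sigma>]) \<subseteq> UNIV \<times> P" using snoc.prems unfolding chain_def by auto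
  moreover have "pmodels P (set (take (length (\<sigma>s @ [\<sigma>])) (\<sigma>s @ [\<sigma>]))) (validF T)"
    using snoc.prems unfolding chain_def by blast
  ultimately have v': "valid T (insert (a, p) (set \<sigma>s))" using pmodels_validF by (simp add: \<sigma>)
  have "set \<sigma>s \<subseteq> UNIV \<times> P" using ch unfolding chain_def by auto
  moreover have "pmodels P (set (take (length \<sigma>s) \<sigma>s)) (validF T)"
    using ch unfolding chain_def by blast
  ultimately have v: "valid T (set \<sigma>s)" using pmodels_validF by simp
  have new: "(a, p) \<notin> set \<sigma>s" using snoc.prems by (simp add: chain_def \<sigma>)
  have "traced T (insert (a, p) (set \<sigma>s))"
  proof (cases "\<exists>j<length T. a = 12 * j \<or> a = 12 * j + 4 \<or> a = 12 * j + 8")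
    case True
    then obtain j where j: "j < length T" "a = 12 * j \<or> a = 12 * j + 4 \<or> a = 12 * j + 8" by blast
    then show ?thesis
      using traced_insert_start[OF T finite_set v tr j(1)] traced_insert_mark[OF v tr j(1)] traced_insert_finish[OF v tr j(1)] v' new
      by (auto simp: started_def marked_def)
  next
    case False
    then show ?thesis by (intro traced_other[OF tr]) blast
  qed
  then show ?case by (simp add: \<sigma>)
qed

section \<open>From runs to chains\<close>

definition play :: "trans list \<Rightarrow> letter list \<Rightarrow> bool" where
  "play T \<sigma>s \<longleftrightarrow> distinct \<sigma>s \<and> (\<forall>k\<le>length \<sigma>s. valid T (set (take k \<sigma>s)))"

text \<open>\<open>valid\<close> reads only actions divisible by 4; the labels
  \<open>4 i + 2\<close> can therefore be added unnoticed.\<close>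

lemma valid_cong:
  assumes "\<And>a p. 4 dvd a \<Longrightarrow> (a, p) \<in> B \<longleftrightarrow> (a, p) \<in> B'"
  shows "valid T B = valid T B'" and "started B = started B'"
proof -
  have 4: "4 dvd 12 * j" "4 dvd 12 * j + 4" "4 dvd 12 * j + 8" for j :: nat by presburger+
  show started: "started B = started B'" by (simp add: started_def fun_eq_iff assms[OF 4(1)])
  have marked: "marked B = marked B'" by (simp add: marked_def fun_eq_iff assms[OF 4(2)])
  have finished: "finished B = finished B'" by (simp add: finished_def fun_eq_iff assms[OF 4(3)])
  have al: "alive T B = alive T B'" by (simp add: alive_def fun_eq_iff started)
  have "counter_ok T B = counter_ok T B'"
  proof (intro ext)
    fix a p show "counter_ok T B a p = counter_ok T B' a p" by (cases a) (simp_all add: started al)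
  qed
  then show "valid T B = valid T B'"
    unfolding valid_def ordered_def linked_def running_def legal_def single_def place_ok_def
      active_def ending_def started marked finished by simp
qed

lemma valid_empty: "valid T {}"
  by (simp add: valid_def ordered_def linked_def running_def legal_def single_def
      active_def ending_def started_def marked_def finished_def)

lemma play_snoc: "play T \<sigma>s \<Longrightarrow> \<sigma> \<notin> set \<sigma>s \<Longrightarrow> valid T (insert \<sigma> (set \<sigma>s)) \<Longrightarrow> play T (\<sigma>s @ [\<sigma>])"
  by (auto simp: play_def le_Suc_eq)

text \<open>The order of the three moves of a step is forced: the mark makes room for a new active
  transition, and the start has to precede the finish because \<open>running\<close> permits no gap.
  Each of the three lemmas also describes which transitions are active or ending for the next
  move.\<close>

lemma valid_mark:
  assumes v: "valid T B" and j: "j < length T" and act: "active B j p"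
    and no: "\<And>k q. k < length T \<Longrightarrow> \<not> ending B k q"
  shows "valid T (insert (12 * j + 4, p) B)"
    and "\<And>k q. k < length T \<Longrightarrow> \<not> active (insert (12 * j + 4, p) B) k q"
    and "\<And>k q. k < length T \<Longrightarrow> ending (insert (12 * j + 4, p) B) k q \<longleftrightarrow> k = j \<and> q = p"
proof -
  let ?B = "insert (12 * j + 4, p) B"
  have uniq: "k = j \<and> q = p" if "active B k q" "k < length T" for k q
    using v j that act unfolding valid_def linked_def by blast
  show na: "\<not> active ?B k q" if "k < length T" for k q
  proof
    assume a: "active ?B k q"
    then have "active B k q" by (simp add: active_def)
    then have "k = j \<and> q = p" by (rule uniq) (rule that)
    then show False using a by (simp add: active_def)
  qed
  have "\<not> finished B j p" using v j act unfolding valid_def ordered_def active_def by blast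
  then show e: "ending ?B k q \<longleftrightarrow> k = j \<and> q = p" if "k < length T" for k q
    using no[OF that, of q] by (auto simp: ending_def)
  have "ordered T ?B" using v act unfolding valid_def ordered_def active_def by auto
  moreover have "linked T ?B" unfolding linked_def using na e by simp
  moreover have "running T ?B"
    unfolding running_def using v e[OF j] j unfolding valid_def running_def by (simp, blast)
  moreover have "legal T ?B" unfolding legal_def using na by blast
  moreover have "single T ?B" using v unfolding valid_def single_def by simp
  ultimately show "valid T ?B" by (simp add: valid_def)
qed

lemma valid_start:
  assumes v: "valid T B" and j: "j < length T" and no: "\<And>k q. k < length T \<Longrightarrow> \<not> active B k q"
    and link: "\<And>k q. k < length T \<Longrightarrow> ending B k q \<Longrightarrow> tgt (T ! k) = src (T ! j)"
    and one: "\<exists>q. started (insert (12 * j, p) B) 1 q" and new: "\<not> started B j p"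
    and place: "place_ok T (insert (12 * j, p) B) j p"
    and count: "counter_ok T (insert (12 * j, p) B) (opr (T ! j)) p"
  shows "valid T (insert (12 * j, p) B)"
    and "\<And>k q. k < length T \<Longrightarrow> active (insert (12 * j, p) B) k q \<longleftrightarrow> k = j \<and> q = p"
    and "\<And>k q. ending (insert (12 * j, p) B) k q = ending B k q"
proof -
  let ?B = "insert (12 * j, p) B"
  have nen: "\<not> marked B j p" using v j new unfolding valid_def ordered_def by blast
  show a: "active ?B k q \<longleftrightarrow> k = j \<and> q = p" if "k < length T" for k q
    using no[OF that, of q] nen by (auto simp: active_def)
  show e: "ending ?B k q = ending B k q" for k q by (simp add: ending_def)
  have "ordered T ?B" using v unfolding valid_def ordered_def by simp
  moreover have "linked T ?B"
    using v unfolding valid_def linked_def by (simp add: a e) (metis link)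
  moreover have "running T ?B" unfolding running_def using one a[OF j] j by blast
  moreover have "legal T ?B" unfolding legal_def using a place count by simp
  moreover have "single T ?B"
    unfolding single_def
  proof (intro allI impI)
    fix i k q assume *: "i < length T" "k < length T" "is_incr (opr (T ! i))" "is_incr (opr (T ! k))"
      "started ?B i q" "started ?B k q"
    have dec: "is_incr x \<Longrightarrow> \<not> is_decr x" for x by (cases x) auto
    show "i = k"
    proof (cases "(i = j \<or> k = j) \<and> q = p")
      case True
      then show ?thesis using place * dec unfolding place_ok_def by metis
    next
      case False
      then have "started B i q" "started B k q" using * by auto
      then show ?thesis using v * unfolding valid_def single_def by blast
    qed
  qed
  ultimately show "valid T ?B" by (simp add: valid_def)
qed

lemma valid_finish:
  assumes v: "valid T B" and j: "j < length T" and e: "\<And>k q. k < length T \<Longrightarrow> ending B k q \<longleftrightarrow> k = j \<and> q = p"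
    and act: "k < length T" "active B k q"
  shows "valid T (insert (12 * j + 8, p) B)"
    and "\<And>k q. active (insert (12 * j + 8, p) B) k q = active B k q"
    and "\<And>k q. k < length T \<Longrightarrow> \<not> ending (insert (12 * j + 8, p) B) k q"
proof -
  let ?B = "insert (12 * j + 8, p) B"
  show a: "active ?B k q = active B k q" for k q by (simp add: active_def)
  show ne: "\<not> ending ?B k q" if "k < length T" for k q
    using e[OF that, of q] by (auto simp: ending_def)
  have "marked B j p" using e[OF j, of p] by (simp add: ending_def)
  then have "ordered T ?B" using v unfolding valid_def ordered_def by auto
  moreover have "linked T ?B"
    using v unfolding valid_def linked_def a using ne by blast
  moreover have "running T ?B"
    using v act unfolding valid_def running_def a by (simp, blast)
  moreover have "legal T ?B"
  proof -
    have "alive T ?B = alive T B" by (simp add: alive_def fun_eq_iff)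
    then have "counter_ok T ?B x q = counter_ok T B x q" for x q by (cases x) simp_all
    then show ?thesis using v unfolding valid_def legal_def a place_ok_def by simp
  qed
  moreover have "single T ?B" using v unfolding valid_def single_def by simp
  ultimately show "valid T ?B" by (simp add: valid_def)
qed

definition base_letters :: "trans list \<Rightarrow> nat \<Rightarrow> letter set" where
  "base_letters T N = {(12 * j + 4 * i, p) | j i p. j < length T \<and> i < 3 \<and> p < N}"

lemma base_lettersI: "j < length T \<Longrightarrow> p < N \<Longrightarrow>
   (12 * j, p) \<in> base_letters T N \<and> (12 * j + 4, p) \<in> base_letters T N \<and> (12 * j + 8, p) \<in> base_letters T N"
proof -
  assume "j < length T" "p < N"
  then have "(12 * j + 4 * i, p) \<in> base_letters T N" if "i < 3" for i
    unfolding base_letters_def using that by blast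
  from this[of 0] this[of 1] this[of 2] show ?thesis by simp
qed

text \<open>One process per step and one for transition \<open>1\<close> are enough. Between steps
  the last transition is active and none is ending, which is the situation in which a mark is
  allowed. The last conjunct implies that a live process carries nothing but increments, so that a
  decrement can be placed on it.\<close>

lemma run_play:
  assumes T: "1 < length T" "opr (T ! 1) = Nop"
  shows "run T (tgt (T ! 1), \<lambda>_. 0) js (q, s) \<Longrightarrow>
    \<exists>\<sigma>s j p. play T \<sigma>s \<and> set \<sigma>s \<subseteq> base_letters T (Suc (length js)) \<and> represents T (set \<sigma>s) js s \<and>
      j < length T \<and> active (set \<sigma>s) j p \<and> tgt (T ! j) = q \<and>
      (\<forall>k<length T. \<forall>q. \<not> ending (set \<sigma>s) k q) \<and> (\<exists>p. started (set \<sigma>s) 1 p) \<and>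
      (\<forall>i k p. i < length T \<longrightarrow> k < length T \<longrightarrow> started (set \<sigma>s) i p \<longrightarrow> started (set \<sigma>s) k p \<longrightarrow> i \<noteq> k \<longrightarrow>
        is_decr (opr (T ! i)) \<or> is_decr (opr (T ! k)))"
proof (induction js "(q, s)" arbitrary: q s rule: run.induct)
  case run_Nil
  let ?B = "insert (12 * 1, 0) {} :: letter set"
  have op: "place_ok T ?B 1 0" "counter_ok T ?B (opr (T ! 1)) 0"
    by (simp add: place_ok_def started_def) (simp only: T(2) counter_ok.simps)
  have v: "valid T ?B" "\<And>k q. k < length T \<Longrightarrow> active ?B k q \<longleftrightarrow> k = 1 \<and> q = 0"
    "\<And>k q. ending ?B k q = ending {} k q"
    by (rule valid_start[OF valid_empty T(1)]; use op in \<open>auto simp: active_def ending_def started_def marked_def\<close>)+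
  have "represents T ?B [] (\<lambda>_. 0)"
    by (rule represents_start[OF refl T(2)]) (simp add: started_def)
  moreover have "play T [(12 * 1, 0)]"
    using v(1) play_snoc[of T "[]" "(12 * 1, 0)"] valid_empty by (simp add: play_def)
  moreover have "started ?B k q \<longleftrightarrow> k = 1 \<and> q = 0" for k q by (auto simp: started_def)
  moreover have "\<not> ending ?B k q" for k q unfolding v(3) by (simp add: ending_def marked_def)
  moreover have "active ?B 1 0" using v(2)[OF T(1), of 0] by blast
  moreover have "?B \<subseteq> base_letters T (Suc (length []))"
    using base_lettersI[OF T(1), of 0 "Suc 0"] by simp
  moreover have "set [(12 * 1, 0)] = ?B" by simp
  ultimately show ?case using T(1) by metis
next
  case (run_snoc js q s j a q' s')
  obtain \<sigma>s i p where IH: "play T \<sigma>s" "set \<sigma>s \<subseteq> base_letters T (Suc (length js))"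
      "represents T (set \<sigma>s) js s" "i < length T" "active (set \<sigma>s) i p" "tgt (T ! i) = q"
      "\<And>k q. k < length T \<Longrightarrow> \<not> ending (set \<sigma>s) k q" "\<exists>p. started (set \<sigma>s) 1 p"
      "\<And>i k p. i < length T \<Longrightarrow> k < length T \<Longrightarrow> started (set \<sigma>s) i p \<Longrightarrow> started (set \<sigma>s) k p \<Longrightarrow> i \<noteq> k \<Longrightarrow>
        is_decr (opr (T ! i)) \<or> is_decr (opr (T ! k))"
    using run_snoc.hyps(2) by blast
  let ?B = "set \<sigma>s" and ?N = "Suc (length js)"
  have v: "valid T ?B" using IH(1) unfolding play_def by (metis order_refl take_all)
  have opj: "opr (T ! j) = a" "src (T ! j) = q" "tgt (T ! j) = q'"
    using run_snoc.hyps(4) by (simp_all add: opr_def src_def tgt_def)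
  let ?B1 = "insert (12 * i + 4, p) ?B"
  have v1: "valid T ?B1" "\<And>k q. k < length T \<Longrightarrow> \<not> active ?B1 k q"
    "\<And>k q. k < length T \<Longrightarrow> ending ?B1 k q \<longleftrightarrow> k = i \<and> q = p"
    using valid_mark[OF v IH(4,5)] IH(7) by blast+
  have st_less: "started ?B k r \<Longrightarrow> r < ?N" for k r
    using IH(2) unfolding started_def base_letters_def by blast
  have p: "p < ?N" using st_less[of i p] IH(5) by (simp add: active_def)
  \<comment> \<open>A decrement goes to some live process, any other operation to process
    \<open>?N\<close>, on which no transition has started yet.\<close>
  obtain r where r: "r < Suc ?N" "\<not> started ?B j r" "place_ok T (insert (12 * j, r) ?B1) j r"
    "counter_ok T (insert (12 * j, r) ?B1) (opr (T ! j)) r"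
  proof (cases "is_decr a")
    case True
    then obtain c where a: "a = Decr c" by (cases a) auto
    then have "s c > 0" using run_snoc.hyps(5) by simp
    then have "{r. alive T ?B c r} \<noteq> {}" using IH(3) unfolding represents_def by (metis card.empty less_irrefl)
    then obtain r where r: "alive T ?B c r" by blast
    then obtain k where k: "k < length T" "opr (T ! k) = Incr c" "started ?B k r"
      and nd: "\<And>k. k < length T \<Longrightarrow> started ?B k r \<Longrightarrow> \<not> is_decr (opr (T ! k))"
      unfolding alive_def by blast
    have inc: "is_incr (opr (T ! i))" if i: "i < length T" "started ?B i r" for i
      using IH(9)[OF i(1) k(1) i(2) k(3)] nd[OF i] nd[OF k(1,3)] k(2) by (cases "i = k") auto
    show thesis
    proof (rule that[of r])
      show "r < Suc ?N" using st_less[OF k(3)] by simp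
      show "\<not> started ?B j r" using nd[OF run_snoc.hyps(3)] by (auto simp: opj a)
      show "place_ok T (insert (12 * j, r) ?B1) j r"
        using inc by (auto simp: place_ok_def opj a)
      show "counter_ok T (insert (12 * j, r) ?B1) (opr (T ! j)) r"
        using k by (auto simp: opj a)
    qed
  next
    case False
    have new: "\<not> started ?B k ?N" for k using st_less[of k ?N] by auto
    show thesis
    proof (rule that[of ?N])
      show "place_ok T (insert (12 * j, ?N) ?B1) j ?N" using new by (simp add: place_ok_def)
      show "counter_ok T (insert (12 * j, ?N) ?B1) (opr (T ! j)) ?N"
      proof (cases a)
        case (IsZero c)
        have "card {r. alive T ?B c r} = 0"
          using IH(3) run_snoc.hyps(5) IsZero unfolding represents_def by simp
        then have "\<not> alive T ?B c r" for r using finite_alive[of ?B T c] by auto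
        then have "\<not> alive T (insert (12 * j, ?N) ?B1) c r" for r
          using IsZero opj(1) by (auto simp: alive_def)
        then show ?thesis by (simp add: opj IsZero)
      qed (use False in \<open>simp_all add: opj\<close>)
    qed (use new in auto)
  qed
  let ?B2 = "insert (12 * j, r) ?B1"
  let ?B3 = "insert (12 * i + 8, p) ?B2"
  have link: "tgt (T ! k) = src (T ! j)" if "k < length T" "ending ?B1 k x" for k x
    using that v1(3) IH(6) opj(2) by simp
  have one: "\<exists>x. started ?B2 1 x" using IH(8) by auto
  have new1: "\<not> started ?B1 j r" using r(2) by simp
  have v2: "valid T ?B2" "\<And>k q. k < length T \<Longrightarrow> active ?B2 k q \<longleftrightarrow> k = j \<and> q = r"
    "\<And>k q. ending ?B2 k q = ending ?B1 k q"
    using valid_start[OF v1(1) run_snoc.hyps(3) _ _ one new1 r(3,4)] v1(2) link by blast+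
  have "active ?B2 j r" using v2(2)[OF run_snoc.hyps(3)] by simp
  moreover have "ending ?B2 k q \<longleftrightarrow> k = i \<and> q = p" if "k < length T" for k q
    unfolding v2(3) using v1(3) that by blast
  ultimately have v3: "valid T ?B3" "\<And>k q. active ?B3 k q = active ?B2 k q"
    "\<And>k q. k < length T \<Longrightarrow> \<not> ending ?B3 k q"
    using valid_finish[OF v2(1) IH(4) _ run_snoc.hyps(3)] by blast+
  have "active ?B2 j r" using v2(2)[OF run_snoc.hyps(3)] by simp
  let ?\<tau>s = "((\<sigma>s @ [(12 * i + 4, p)]) @ [(12 * j, r)]) @ [(12 * i + 8, p)]"
  have set: "set ?\<tau>s = ?B3" by auto
  have new_en: "(12 * i + 4, p) \<notin> ?B" using IH(5) by (simp add: active_def marked_def)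
  have new_st: "(12 * j, r) \<notin> ?B1" using r(2) by (auto simp: started_def)
  have new_dn: "(12 * i + 8, p) \<notin> ?B2"
  proof -
    have "\<not> finished ?B i p" using v IH(4,5) unfolding valid_def ordered_def active_def by blast
    then show ?thesis by (auto simp: finished_def)
  qed
  let ?\<sigma>1 = "\<sigma>s @ [(12 * i + 4, p)]" and ?\<sigma>2 = "(\<sigma>s @ [(12 * i + 4, p)]) @ [(12 * j, r)]"
  have set1: "set ?\<sigma>1 = ?B1" and set2: "set ?\<sigma>2 = ?B2" by auto
  have "play T ?\<sigma>1" by (rule play_snoc[OF IH(1) new_en v1(1)])
  then have "play T ?\<sigma>2"
    by (rule play_snoc) (simp_all only: set1 new_st v2(1) not_False_eq_True)
  then have "play T ?\<tau>s"
    by (rule play_snoc) (simp_all only: set2 new_dn v3(1) not_False_eq_True)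
  moreover have "set ?\<tau>s \<subseteq> base_letters T (Suc (length (js @ [j])))"
  proof -
    have "base_letters T ?N \<subseteq> base_letters T (Suc ?N)" unfolding base_letters_def by fastforce
    then show ?thesis
      using IH(2) base_lettersI[OF IH(4), of p "Suc ?N"] base_lettersI[OF run_snoc.hyps(3) r(1)] p by auto
  qed
  moreover have "represents T ?B3 (js @ [j]) s'"
  proof -
    have "represents T ?B1 js s" using IH(3) represents_cong[of T ?B1 ?B] by simp
    moreover have "single T ?B2" using v2(1) unfolding valid_def by blast
    ultimately obtain s'' where "oper_sem (opr (T ! j)) s s''" "represents T ?B2 (js @ [j]) s''"
      using represents_step[OF _ _ run_snoc.hyps(3) new1 _ r(3,4)] by auto
    moreover have "s'' = s'" using calculation(1) run_snoc.hyps(5) by (cases a) (auto simp: opj)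
    ultimately show ?thesis using represents_cong[of T ?B3 ?B2] by simp
  qed
  moreover have "active ?B3 j r" using v3(2) \<open>active ?B2 j r\<close> by blast
  moreover have "\<exists>x. started ?B3 1 x" using one by (metis insert_letter(7))
  moreover have "is_decr (opr (T ! k)) \<or> is_decr (opr (T ! l))"
    if "k < length T" "l < length T" "started ?B3 k x" "started ?B3 l x" "k \<noteq> l" for k l x
  proof -
    have pl: "is_decr (opr (T ! j))" if "k < length T" "k \<noteq> j" "started ?B k r" for k
      using r(3) that unfolding place_ok_def by auto
    have "k = j \<and> x = r \<or> started ?B k x" "l = j \<and> x = r \<or> started ?B l x" using that by auto
    then show ?thesis using pl[of k] pl[of l] IH(9)[of k l x] that by auto
  qed
  ultimately show ?case
    using run_snoc.hyps(3) opj(3) v3(3) unfolding set[symmetric] by blast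
qed

section \<open>The diagonal instance\<close>

text \<open>The machine loads its input by a nondeterministic number of uses of transition \<open>2\<close>, whose
  letter is \<open>24\<close>. The acceptance formula makes the labels \<open>4 i + 2\<close> with \<open>i < x\<close> a bijection with these
  uses. This is the only place where the instance depends on \<open>x\<close> other than through the
  size of the alphabet and the code of the formula for \<open>valid\<close>.\<close>

definition labelF :: "nat \<Rightarrow> pfm" where
  "labelF i = PEx X (PAnd (PAct (4 * i + 2) X) (PAnd (PAct 24 X)
     (PAnd (PNeg (pBigOr (\<lambda>k. PAct (4 * k + 2) X) i))
       (PAll Y (pImp (PAct (4 * i + 2) Y) (PEq X Y))))))"

definition finalF :: "nat \<Rightarrow> pfm" where
  "finalF x = PAnd (PEx X (PAct 0 X)) (PAnd (pBigAnd labelF x)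
     (PAll X (pImp (PAct 24 X) (pBigOr (\<lambda>k. PAct (4 * k + 2) X) x))))"

lemma pmodels_finalF:
  "pmodels P B (finalF x) \<longleftrightarrow> (\<exists>p\<in>P. (0, p) \<in> B) \<and>
    (\<forall>i<x. \<exists>p\<in>P. (4 * i + 2, p) \<in> B \<and> (24, p) \<in> B \<and> (\<forall>k<i. (4 * k + 2, p) \<notin> B) \<and>
      (\<forall>q\<in>P. (4 * i + 2, q) \<in> B \<longrightarrow> p = q)) \<and>
    (\<forall>p\<in>P. (24, p) \<in> B \<longrightarrow> (\<exists>i<x. (4 * i + 2, p) \<in> B))"
  unfolding pmodels_def finalF_def labelF_def by simp

text \<open>The process \<open>g i\<close> chosen for label \<open>i\<close> carries no smaller
  label, which makes \<open>g\<close> injective. It is the only bearer of label \<open>i\<close>,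
  and each process with letter \<open>24\<close> bears some label, which makes \<open>g\<close>
  surjective onto the uses of transition \<open>2\<close>.\<close>

lemma finalF_card:
  assumes B: "B \<subseteq> UNIV \<times> P" and f: "pmodels P B (finalF x)"
  shows "\<exists>p. started B 0 p" and "card {p. started B 2 p} = x"
proof -
  note f' = f[unfolded pmodels_finalF]
  show "\<exists>p. started B 0 p" using f' unfolding started_def by auto
  have "\<forall>i<x. \<exists>p\<in>P. (4 * i + 2, p) \<in> B \<and> (24, p) \<in> B \<and> (\<forall>k<i. (4 * k + 2, p) \<notin> B) \<and>
      (\<forall>q\<in>P. (4 * i + 2, q) \<in> B \<longrightarrow> p = q)" using f' by blast
  then obtain g where g: "\<And>i. i < x \<Longrightarrow> g i \<in> P \<and> (4 * i + 2, g i) \<in> B \<and> (24, g i) \<in> B \<and>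
      (\<forall>k<i. (4 * k + 2, g i) \<notin> B) \<and> (\<forall>q\<in>P. (4 * i + 2, q) \<in> B \<longrightarrow> g i = q)"
    by metis
  have "inj_on g {..<x}"
  proof (rule linorder_inj_onI)
    show "g i \<noteq> g k" if "i < k" "i \<in> {..<x}" "k \<in> {..<x}" for i k
    proof -
      have "(4 * i + 2, g i) \<in> B" "(4 * i + 2, g k) \<notin> B"
        using g[of i] g[of k] that by blast+
      then show ?thesis by metis
    qed
  qed auto
  moreover have "g ` {..<x} = {p. started B 2 p}"
  proof
    show "g ` {..<x} \<subseteq> {p. started B 2 p}" using g by (auto simp: started_def)
    show "{p. started B 2 p} \<subseteq> g ` {..<x}"
    proof
      fix p assume "p \<in> {p. started B 2 p}"
      then have p: "(24, p) \<in> B" "p \<in> P" using B by (auto simp: started_def)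
      then obtain i where "i < x" "(4 * i + 2, p) \<in> B" using f' by blast
      then show "p \<in> g ` {..<x}" using g p by blast
    qed
  qed
  ultimately show "card {p. started B 2 p} = x" using card_image by fastforce
qed

text \<open>The labels are played after the run, once the processes to be labelled are known, and
  leave \<open>valid\<close> untouched. The two bounds on \<open>n\<close> make room in the alphabet
  for the letters of the transitions and for the labels.\<close>

lemma play_final:
  assumes play: "play T \<sigma>s" and sub: "set \<sigma>s \<subseteq> base_letters T N"
    and n: "12 * length T \<le> 2 * n" "4 * x \<le> 2 * n"
    and acc: "\<exists>p. started (set \<sigma>s) 0 p" and card: "card {p. started (set \<sigma>s) 2 p} = x"
  shows "\<exists>\<tau>s. chain n (validF T) {..<N} \<tau>s \<and> pmodels {..<N} (set \<tau>s) (finalF x)"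
proof -
  define ps where "ps = sorted_list_of_set {p. started (set \<sigma>s) 2 p}"
  have ps: "set ps = {p. started (set \<sigma>s) 2 p}" "distinct ps" "length ps = x"
    using finite_started[of "set \<sigma>s" 2] card by (simp_all add: ps_def)
  define ls where "ls = map (\<lambda>i. (4 * i + 2, ps ! i)) [0..<x]"
  have lt: "p < N" if "(a, p) \<in> set \<sigma>s" for a p using that sub by (auto simp: base_letters_def)
  have psN: "ps ! i < N" if "i < x" for i
  proof -
    have "ps ! i \<in> set ps" using that ps(3) by simp
    then show ?thesis unfolding ps(1) started_def using lt by blast
  qed
  have ls: "set ls = {(4 * i + 2, ps ! i) | i. i < x}" by (auto simp: ls_def)
  have four: "4 dvd a" if "(a, p) \<in> base_letters T N" for a p
    using that by (auto simp: base_letters_def intro!: dvd_add)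
  have lab: "\<not> 4 dvd a" if "(a, p) \<in> set ls" for a p
    using that unfolding ls by auto presburger
  have dist: "distinct (\<sigma>s @ ls)"
  proof -
    have "distinct ls" unfolding ls_def by (simp add: distinct_map inj_on_def)
    moreover have "set \<sigma>s \<inter> set ls = {}" using four lab sub by fastforce
    ultimately show ?thesis using play by (simp add: play_def)
  qed
  have vl: "valid T (set (take k (\<sigma>s @ ls)))" if "k \<le> length (\<sigma>s @ ls)" for k
  proof (cases "k \<le> length \<sigma>s")
    case True
    then show ?thesis using play by (simp add: play_def)
  next
    case False
    have "valid T (set \<sigma>s)" using play unfolding play_def by (metis order_refl take_all)
    moreover have "valid T (set (take k (\<sigma>s @ ls))) = valid T (set \<sigma>s)"
    proof (rule valid_cong(1))
      fix a p :: nat assume "4 dvd a"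
      then have "(a, p) \<notin> set (take (k - length \<sigma>s) ls)" using lab by (meson in_set_takeD)
      then show "(a, p) \<in> set (take k (\<sigma>s @ ls)) \<longleftrightarrow> (a, p) \<in> set \<sigma>s" using False by simp
    qed
    ultimately show ?thesis by simp
  qed
  have sys: "\<sigma> \<in> sys_acts n \<times> {..<N}" if mem: "\<sigma> \<in> set (\<sigma>s @ ls)" for \<sigma>
  proof (cases "\<sigma> \<in> set \<sigma>s")
    case True
    then obtain j i p where *: "\<sigma> = (12 * j + 4 * i, p)" "j < length T" "i < 3" "p < N"
      using sub unfolding base_letters_def by blast
    have "12 * j + 4 * i \<in> sys_acts n"
      unfolding sys_acts_def by (rule image_eqI[of _ _ "6 * j + 2 * i"]) (use * n(1) in auto)
    then show ?thesis using * by simp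
  next
    case False
    then have "\<sigma> \<in> set ls" using mem by simp
    then obtain i where i: "\<sigma> = (4 * i + 2, ps ! i)" "i < x" unfolding ls by blast
    have "4 * i + 2 \<in> sys_acts n"
      unfolding sys_acts_def by (rule image_eqI[of _ _ "2 * i + 1"]) (use i n(2) in auto)
    then show ?thesis using i psN by simp
  qed
  have chain: "chain n (validF T) {..<N} (\<sigma>s @ ls)"
    unfolding chain_def
  proof (intro conjI allI impI)
    show "pmodels {..<N} (set (take k (\<sigma>s @ ls))) (validF T)" if "k \<le> length (\<sigma>s @ ls)" for k
    proof -
      have "set (take k (\<sigma>s @ ls)) \<subseteq> UNIV \<times> {..<N}"
      proof
        fix \<sigma> assume "\<sigma> \<in> set (take k (\<sigma>s @ ls))"
        then have "\<sigma> \<in> sys_acts n \<times> {..<N}" using sys by (meson in_set_takeD)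
        then show "\<sigma> \<in> UNIV \<times> {..<N}" by (simp add: mem_Times_iff)
      qed
      then show ?thesis using vl[OF that] pmodels_validF by blast
    qed
  qed (use dist sys in blast)+
  have two: "(4 * i + 2, p) \<in> set (\<sigma>s @ ls) \<longleftrightarrow> i < x \<and> p = ps ! i" for i p
  proof -
    have "\<not> 4 dvd 4 * i + 2" by presburger
    then have "(4 * i + 2, p) \<notin> set \<sigma>s" using four sub by blast
    then show ?thesis using ls by auto
  qed
  have load: "(24, p) \<in> set (\<sigma>s @ ls) \<longleftrightarrow> p \<in> set ps" for p
  proof -
    have "4 dvd (24::nat)" by simp
    then have "(24, p) \<notin> set ls" using lab by blast
    then show ?thesis by (simp add: ps(1) started_def)
  qed
  have "pmodels {..<N} (set (\<sigma>s @ ls)) (finalF x)"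
    unfolding pmodels_finalF two load
  proof (intro conjI allI impI ballI)
    obtain p where "(0, p) \<in> set \<sigma>s" using acc by (auto simp: started_def)
    then show "\<exists>p\<in>{..<N}. (0, p) \<in> set (\<sigma>s @ ls)" using lt by auto
    show "\<exists>p\<in>{..<N}. (i < x \<and> p = ps ! i) \<and> p \<in> set ps \<and> (\<forall>k<i. \<not> (k < x \<and> p = ps ! k)) \<and>
        (\<forall>q\<in>{..<N}. i < x \<and> q = ps ! i \<longrightarrow> p = q)" if "i < x" for i
      using that psN ps(2,3) by (intro bexI[of _ "ps ! i"]) (auto simp: nth_eq_iff_index_eq)
    show "\<exists>i<x. i < x \<and> p = ps ! i" if "p \<in> set ps" for p
      using that ps(3) by (auto simp: in_set_conv_nth)
  qed
  then show ?thesis using chain by blast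
qed

text \<open>The conditions on \<open>js\<close> are those read off by \<open>finalF\<close>: the
  start letters of transitions \<open>0\<close> and \<open>2\<close> are \<open>0\<close> and
  \<open>24\<close>, and \<open>represents\<close> equates numbers of processes with numbers of
  uses.\<close>

lemma shared_synth_run:
  assumes T: "2 < length T" "opr (T ! 1) = Nop" and n: "12 * length T \<le> 2 * n" "4 * x \<le> 2 * n"
    and acts: "actions_of (fm_of (validF T)) \<subseteq> sys_acts n" "actions_of (fm_of (finalF x)) \<subseteq> sys_acts n"
  shows "shared_synth (sys_acts n, env_acts n, game_fm n (fm_of (validF T)) (fm_of (finalF x))) \<longleftrightarrow>
    (\<exists>js c. run T (tgt (T ! 1), \<lambda>_. 0) js c \<and> 0 \<in> set js \<and> count_list js 2 = x)"
proof
  assume "shared_synth (sys_acts n, env_acts n, game_fm n (fm_of (validF T)) (fm_of (finalF x)))"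
  then obtain P S where "finite P" "is_strategy (sys_acts n) (env_acts n) P S"
    "winning (sys_acts n) (env_acts n) P (game_fm n (fm_of (validF T)) (fm_of (finalF x))) S"
    unfolding shared_synth_def by auto
  moreover have "pmodels P {} (validF T)" using pmodels_validF[of "{}"] valid_empty by simp
  ultimately obtain \<sigma>s where \<sigma>s: "chain n (validF T) P \<sigma>s" "pmodels P (set \<sigma>s) (finalF x)"
    using winning_chain acts by blast
  have "set \<sigma>s \<subseteq> UNIV \<times> P" using \<sigma>s(1) unfolding chain_def by auto
  note fin = finalF_card[OF this \<sigma>s(2)]
  have "traced T (set \<sigma>s)" using chain_traced[OF _ T(2) \<sigma>s(1)] T(1) by simp
  then obtain js q s where r: "run T (tgt (T ! 1), \<lambda>_. 0) js (q, s)" "represents T (set \<sigma>s) js s"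
    using fin(1) T(1) unfolding traced_def by (metis less_trans zero_less_numeral)
  have "card {p. started (set \<sigma>s) 0 p} > 0" using fin(1) finite_started[of "set \<sigma>s" 0] by (auto simp: card_gt_0_iff)
  have cnt: "card {p. started (set \<sigma>s) k p} = count_list js k" if "k < length T" "k \<noteq> 1" for k
    using r(2) that unfolding represents_def by blast
  have "card {p. started (set \<sigma>s) 0 p} = count_list js 0" by (rule cnt) (use T(1) in auto)
  then have "count_list js 0 > 0" using \<open>card {p. started (set \<sigma>s) 0 p} > 0\<close> by (simp only:)
  then have "0 \<in> set js" using count_list_0_iff[of js 0] by auto
  moreover have "count_list js 2 = x" using cnt[of 2] T(1) fin(2) by simp
  ultimately show "\<exists>js c. run T (tgt (T ! 1), \<lambda>_. 0) js c \<and> 0 \<in> set js \<and> count_list js 2 = x"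
    using r(1) by blast
next
  assume "\<exists>js c. run T (tgt (T ! 1), \<lambda>_. 0) js c \<and> 0 \<in> set js \<and> count_list js 2 = x"
  then obtain js q s where r: "run T (tgt (T ! 1), \<lambda>_. 0) js (q, s)" "0 \<in> set js" "count_list js 2 = x"
    by auto
  have "1 < length T" using T(1) by simp
  from run_play[OF this T(2) r(1)] obtain \<sigma>s where \<sigma>s: "play T \<sigma>s"
    "set \<sigma>s \<subseteq> base_letters T (Suc (length js))" "represents T (set \<sigma>s) js s" by blast
  have cnt: "card {p. started (set \<sigma>s) k p} = count_list js k" if "k < length T" "k \<noteq> 1" for k
    using \<sigma>s(3) that unfolding represents_def by blast
  have "card {p. started (set \<sigma>s) 0 p} = count_list js 0" by (rule cnt) (use T(1) in auto)
  then have "card {p. started (set \<sigma>s) 0 p} \<noteq> 0" using r(2) count_list_0_iff[of js 0] by simp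
  then have "{p. started (set \<sigma>s) 0 p} \<noteq> {}" by (metis card.empty)
  moreover have "card {p. started (set \<sigma>s) 2 p} = x" using cnt[of 2] r(3) T(1) by simp
  ultimately obtain \<tau>s where "chain n (validF T) {..<Suc (length js)} \<tau>s"
    "pmodels {..<Suc (length js)} (set \<tau>s) (finalF x)"
    using play_final[OF \<sigma>s(1,2) n] by blast
  from chain_winning[OF this acts]
  show "shared_synth (sys_acts n, env_acts n, game_fm n (fm_of (validF T)) (fm_of (finalF x)))"
    unfolding shared_synth_def by blast
qed

text \<open>The deterministic part, without the loading of the input. Computation enters at state
  \<open>5\<close> and leaves its answer in register \<open>1\<close>: zero, for no, leads to
  \<open>2\<close> and on to acceptance in \<open>3\<close>, a positive value to the sink
  \<open>4\<close>.\<close>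

definition machine :: "com \<Rightarrow> trans set" where
  "machine c = {(2, Nop, 3), (5 + sz c, Decr 1, 4), (5 + sz c, IsZero 1, 2)} \<union> set (code c 5)"

text \<open>Transition \<open>0\<close> signals acceptance and transition \<open>1\<close> must be played first.\<close>

definition prog :: "com \<Rightarrow> trans list" where
  "prog c = [(2, Nop, 3), (0, Nop, 1), (1, Incr 0, 1), (1, Nop, 5),
     (5 + sz c, Decr 1, 4), (5 + sz c, IsZero 1, 2)] @ code c 5"

lemma set_prog: "set (prog c) = machine c \<union> {(0, Nop, 1), (1, Incr 0, 1), (1, Nop, 5)}"
  by (auto simp: prog_def machine_def)

lemma machine_states: "(q, a, q') \<in> machine c \<Longrightarrow> 2 \<le> q \<and> q \<noteq> 3 \<and> q \<noteq> 4 \<and> 2 \<le> q' \<and> (q' = 3 \<longrightarrow> q = 2)"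
  by (auto simp: machine_def dest: code_bounds)

lemma prog_nth_machine: "j < length (prog c) \<Longrightarrow> j \<noteq> 1 \<Longrightarrow> j \<noteq> 2 \<Longrightarrow> j \<noteq> 3 \<Longrightarrow> prog c ! j \<in> machine c"
proof -
  assume j: "j < length (prog c)" "j \<noteq> 1" "j \<noteq> 2" "j \<noteq> 3"
  show ?thesis
  proof (cases "j < 6")
    case True
    then have "j \<in> {0, 4, 5}" using j by auto
    then show ?thesis by (auto simp: prog_def machine_def)
  next
    case False
    then have "prog c ! j = code c 5 ! (j - 6)" by (simp add: prog_def nth_append eval_nat_numeral)
    moreover have "j - 6 < length (code c 5)" using j(1) False by (simp add: prog_def)
    ultimately show ?thesis by (simp add: machine_def)
  qed
qed

lemma prog_nth [simp]:
  "prog c ! 0 = (2, Nop, 3)" "prog c ! 1 = (0, Nop, 1)" "prog c ! Suc 0 = (0, Nop, 1)"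
  "prog c ! 2 = (1, Incr 0, 1)" "prog c ! 3 = (1, Nop, 5)" "6 \<le> length (prog c)"
  by (simp_all add: prog_def numeral_2_eq_2 numeral_3_eq_3)

lemma deterministic_machine: "deterministic (machine c)"
proof -
  have "5 \<le> q \<and> q < 5 + sz c" if "(q, a, q') \<in> set (code c 5)" for q a q'
    using code_bounds[OF that] by simp
  then show ?thesis
    using deterministic_code[of c 5] unfolding deterministic_def machine_def
    by (auto; fastforce)
qed

text \<open>Transition \<open>2\<close> does not belong to \<open>M\<close>, so computing does not
  alter the number of loads.\<close>

lemma run_steps:
  "(step M)\<^sup>*\<^sup>* d e \<Longrightarrow> run T c js d \<Longrightarrow> M \<subseteq> set T \<Longrightarrow> T ! 2 \<notin> M \<Longrightarrow>
    \<exists>ks. run T c ks e \<and> count_list ks 2 = count_list js 2"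
proof (induction rule: rtranclp_induct)
  case (step e f)
  then obtain ks where ks: "run T c ks e" "count_list ks 2 = count_list js 2" by blast
  obtain q a q' s s' where ef: "e = (q, s)" "f = (q', s')" "(q, a, q') \<in> M" "oper_sem a s s'"
    using step.hyps(2) by (auto elim: step.cases)
  then obtain j where j: "j < length T" "T ! j = (q, a, q')"
    using step.prems(2) by (metis in_set_conv_nth subsetD)
  then have "j \<noteq> 2" using ef(3) step.prems(3) by auto
  then show ?case using run_snoc[OF ks(1)[unfolded ef(1)] j ef(4)] ks(2) ef(2) by auto
qed blast

definition input :: "nat \<Rightarrow> store" where "input x = (\<lambda>_. 0)(0 := x)"

lemma input_0: "input 0 = (\<lambda>_. 0)"
  by (simp add: input_def fun_eq_iff)

lemma input_Suc: "(input x)(0 := Suc (input x 0)) = input (Suc x)"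
  by (simp add: input_def fun_eq_iff)

lemma run_load: "run (prog c) (1, \<lambda>_. 0) (replicate x 2) (1, input x)"
proof (induction x)
  case 0
  show ?case using run_Nil by (simp add: input_0)
next
  case (Suc x)
  have "2 < length (prog c)" using prog_nth(6)[of c] by linarith
  from run_snoc[OF Suc this prog_nth(4)[of c], of "input (Suc x)"] show ?case
    by (simp add: input_Suc replicate_append_same)
qed

text \<open>Loading is nondeterministic, but its result is fixed by the number of uses of transition
  \<open>2\<close>; state \<open>1\<close> is never entered again, so this number remains the
  input.\<close>

lemma run_cases:
  "run (prog c) (1, \<lambda>_. 0) js (q, s) \<Longrightarrow>
    q = 1 \<and> s = input (count_list js 2) \<and> 0 \<notin> set js \<or>
    2 \<le> q \<and> (step (machine c))\<^sup>*\<^sup>* (5, input (count_list js 2)) (q, s) \<and>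
      (0 \<in> set js \<longrightarrow> (\<exists>s'. (step (machine c))\<^sup>*\<^sup>* (5, input (count_list js 2)) (3, s')))"
proof (induction js "(q, s)" arbitrary: q s rule: run.induct)
  case run_Nil
  then show ?case by (simp add: input_0)
next
  case (run_snoc js q s j a q' s')
  consider "q = 1" "s = input (count_list js 2)" "0 \<notin> set js"
    | "2 \<le> q" "(step (machine c))\<^sup>*\<^sup>* (5, input (count_list js 2)) (q, s)"
      "0 \<in> set js \<Longrightarrow> (\<exists>s'. (step (machine c))\<^sup>*\<^sup>* (5, input (count_list js 2)) (3, s'))"
    using run_snoc.hyps(2) by blast
  then show ?case
  proof cases
    case 1
    have "j = 2 \<or> j = 3"
    proof (rule ccontr)
      assume "\<not> (j = 2 \<or> j = 3)"
      moreover have "j \<noteq> 1" using run_snoc.hyps(4) 1 by auto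
      ultimately have "(q, a, q') \<in> machine c"
        using prog_nth_machine[OF run_snoc.hyps(3)] run_snoc.hyps(4) by metis
      then show False using machine_states 1(1) by fastforce
    qed
    then show ?thesis using 1 run_snoc.hyps(4,5) by (auto simp: input_Suc)
  next
    case 2
    have j: "j \<notin> {1, 2, 3}" using run_snoc.hyps(4) 2(1) by auto
    then have m: "(q, a, q') \<in> machine c"
      using prog_nth_machine[OF run_snoc.hyps(3)] run_snoc.hyps(4) by (metis insertCI)
    then have "step (machine c) (q, s) (q', s')" using run_snoc.hyps(5) by (rule step.intros)
    then have started: "(step (machine c))\<^sup>*\<^sup>* (5, input (count_list js 2)) (q', s')"
      using 2(2) by (rule rtranclp.rtrancl_into_rtrancl[rotated])
    moreover have "count_list (js @ [j]) 2 = count_list js 2" using j by simp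
    moreover have "\<exists>s'. (step (machine c))\<^sup>*\<^sup>* (5, input (count_list js 2)) (3, s')"
      if "0 \<in> set (js @ [j])"
    proof (cases "0 \<in> set js")
      case False
      then have "j = 0" using that by simp
      then have "q' = 3" using run_snoc.hyps(4) by simp
      then show ?thesis using started by blast
    qed (use 2(3) in blast)
    ultimately show ?thesis using machine_states[OF m] by simp
  qed
qed

text \<open>The count fixes the only nondeterministic choice to \<open>x\<close>. If the answer is
  not zero, the deterministic rest gets stuck in \<open>4\<close> and cannot have reached
  \<open>3\<close>, where it would be stuck as well.\<close>

lemma accepting_run:
  assumes e: "exec c (input x) s"
  shows "(\<exists>js d. run (prog c) (1, \<lambda>_. 0) js d \<and> 0 \<in> set js \<and> count_list js 2 = x) \<longleftrightarrow> s 1 = 0"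
proof
  have started: "(step (machine c))\<^sup>*\<^sup>* (5, input x) (5 + sz c, s)"
    by (rule steps_code[OF e]) (auto simp: machine_def)
  have len: "0 < length (prog c)" "3 < length (prog c)" using prog_nth(6)[of c] by linarith+
  show "\<exists>js d. run (prog c) (1, \<lambda>_. 0) js d \<and> 0 \<in> set js \<and> count_list js 2 = x" if "s 1 = 0"
  proof -
    have "step (machine c) (5 + sz c, s) (2, s)"
      by (rule step.intros[where a = "IsZero 1"]) (use that in \<open>auto simp: machine_def\<close>)
    then have "(step (machine c))\<^sup>*\<^sup>* (5, input x) (2, s)" using started by simp
    moreover have "run (prog c) (1, \<lambda>_. 0) (replicate x 2 @ [3]) (5, input x)"
      by (rule run_snoc[OF run_load len(2) prog_nth(5)]) simp
    moreover have "prog c ! 2 \<notin> machine c" using machine_states[of 1 "Incr 0" 1 c] by auto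
    moreover have "machine c \<subseteq> set (prog c)" by (auto simp: set_prog)
    ultimately obtain ks where "run (prog c) (1, \<lambda>_. 0) ks (2, s)"
      "count_list ks 2 = count_list (replicate x 2 @ [3 :: nat]) 2"
      using run_steps by blast
    moreover have "count_list (replicate x 2 @ [3 :: nat]) 2 = x" by (induction x) auto
    ultimately show ?thesis
      using run_snoc[of "prog c" _ ks 2 s 0 Nop 3 s] len(1) by (intro exI[of _ "ks @ [0]"]) auto
  qed
  show "s 1 = 0" if "\<exists>js d. run (prog c) (1, \<lambda>_. 0) js d \<and> 0 \<in> set js \<and> count_list js 2 = x"
  proof (rule ccontr)
    assume "s 1 \<noteq> 0"
    obtain js q s1 where js: "run (prog c) (1, \<lambda>_. 0) js (q, s1)" "0 \<in> set js" "count_list js 2 = x"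
      using \<open>\<exists>js d. _ js d\<close> by auto
    then obtain s2 where acc: "(step (machine c))\<^sup>*\<^sup>* (5, input x) (3, s2)"
      using run_cases[OF js(1)] by blast
    have stuck: "\<not> step (machine c) (q, s) d" if "q = 3 \<or> q = 4" for q s d
    proof
      assume "step (machine c) (q, s) d"
      then show False using that machine_states by (fastforce elim: step.cases)
    qed
    have "step (machine c) (5 + sz c, s) (4, s(1 := s 1 - 1))"
      by (rule step.intros[where a = "Decr 1"]) (use \<open>s 1 \<noteq> 0\<close> in \<open>auto simp: machine_def\<close>)
    then have "(step (machine c))\<^sup>*\<^sup>* (5, input x) (4, s(1 := s 1 - 1))" using started by simp
    then have "(step (machine c))\<^sup>*\<^sup>* (3, s2) (4, s(1 := s 1 - 1))"
      using steps_to_stuck[OF deterministic_machine _ _ acc] stuck by blast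
    then show False
    proof (cases rule: converse_rtranclpE)
      case (step d)
      then show ?thesis using stuck by blast
    qed simp
  qed
qed


text \<open>Pairing never goes below its components. The number \<open>x\<close> alone thus bounds
  the actions of the formula it encodes, and the alphabet can be computed from \<open>x\<close>
  without decoding.\<close>

lemma action_le_code: "a \<in> actions_of f \<Longrightarrow> a \<le> fm_code f"
proof (induction f)
  case (Act b v)
  then show ?case using le_prod_encode_1 le_prod_encode_2 by simp (meson order_trans)
next
  case (Neg f)
  then show ?case using le_prod_encode_2 by simp (meson order_trans)
next
  case (And f g)
  then show ?case using le_prod_encode_1 le_prod_encode_2 by simp (meson order_trans)
next
  case (Or f g)
  then show ?case using le_prod_encode_1 le_prod_encode_2 by simp (meson order_trans)
next
  case (Exists v f)
  then show ?case using le_prod_encode_2 by simp (meson order_trans)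
next
  case (Forall v f)
  then show ?case using le_prod_encode_2 by simp (meson order_trans)
qed auto

section \<open>Variables and actions of the formulas\<close>

lemma fm_of_pBig [simp]:
  "fm_of (pBigOr F n) = bigOr (\<lambda>i. fm_of (F i)) n"
  "fm_of (pBigAnd F n) = bigAnd (\<lambda>i. fm_of (F i)) n"
  by (induction n) auto

lemma actions_of_big [simp]:
  "actions_of (bigOr F n) = (\<Union>i<n. actions_of (F i))"
  "actions_of (bigAnd F n) = (\<Union>i<n. actions_of (F i))"
  by (induction n) (auto simp: less_Suc_eq)

lemma free_vars_big [simp]:
  "free_vars (bigOr F n) = (\<Union>i<n. free_vars (F i))"
  "free_vars (bigAnd F n) = (\<Union>i<n. free_vars (F i))"
  by (induction n) (auto simp: less_Suc_eq)

lemma fm_of_pIf [simp]: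
  "free_vars (fm_of (pIf b f)) = (if b then free_vars (fm_of f) else {})"
  "actions_of (fm_of (pIf b f)) = (if b then actions_of (fm_of f) else {})"
  by simp_all

lemma fm_of_atoms [simp]:
  "free_vars (fm_of (startedF j v)) = {v}" "free_vars (fm_of (markedF j v)) = {v}" "free_vars (fm_of (finishedF j v)) = {v}"
  "actions_of (fm_of (startedF j v)) = {12 * j}" "actions_of (fm_of (markedF j v)) = {12 * j + 4}"
  "actions_of (fm_of (finishedF j v)) = {12 * j + 8}"
  by (cases v; auto simp: startedF_def markedF_def finishedF_def)+

lemma fm_of_active [simp]:
  "free_vars (fm_of (activeF j v)) = {v}" "free_vars (fm_of (endingF j v)) = {v}"
  "actions_of (fm_of (activeF j v)) = {12 * j, 12 * j + 4}"
  "actions_of (fm_of (endingF j v)) = {12 * j + 4, 12 * j + 8}"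
  by (auto simp: activeF_def endingF_def)

lemma free_vars_counterF: "v \<in> free_vars (fm_of (counterF T a)) \<Longrightarrow> v = X"
  by (cases a) (auto simp: aliveF_def split: if_splits)

lemma free_vars_placeF: "v \<in> free_vars (fm_of (placeF T j)) \<Longrightarrow> v = X"
  by (auto simp: placeF_def split: if_splits)

lemma free_vars_legalF: "free_vars (fm_of (legalF T)) = {}"
  by (auto simp: legalF_def dest: free_vars_counterF free_vars_placeF)

lemma free_vars_Forall2: "free_vars (Forall X (Forall Y g)) = {}"
  using var.exhaust by auto

lemma free_vars_linkedF: "free_vars (fm_of (linkedF T)) = {}"
  unfolding linkedF_def fm_of_pBig free_vars_big fm_of.simps free_vars_Forall2 by simp

lemma free_vars_singleF: "free_vars (fm_of (singleF T)) = {}"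
  unfolding singleF_def fm_of_pBig free_vars_big fm_of.simps free_vars.simps fm_of_pIf fm_of_atoms
  by simp

lemma free_vars_validF: "free_vars (fm_of (validF T)) = {}"
  by (auto simp: validF_def orderedF_def runningF_def
      free_vars_legalF free_vars_linkedF free_vars_singleF)

lemma dvd_12: "(4::nat) dvd 12 * j"
  by presburger

lemma actions_counterF: "a \<in> actions_of (fm_of (counterF T b)) \<Longrightarrow> 4 dvd a"
  by (cases b) (auto simp: aliveF_def dvd_12 split: if_splits)

lemma actions_placeF: "a \<in> actions_of (fm_of (placeF T j)) \<Longrightarrow> 4 dvd a"
  by (auto simp: placeF_def dvd_12 split: if_splits)

lemma actions_linkedF: "actions_of (fm_of (linkedF T)) \<subseteq> {a. 4 dvd a}"
  unfolding linkedF_def fm_of_pBig actions_of_big fm_of.simps actions_of.simps fm_of_pIf fm_of_active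
  by (simp add: UN_subset_iff dvd_12)

lemma actions_singleF: "a \<in> actions_of (fm_of (singleF T)) \<Longrightarrow> 4 dvd a"
  by (auto simp: singleF_def dvd_12 split: if_splits)

lemma actions_legalF: "a \<in> actions_of (fm_of (legalF T)) \<Longrightarrow> 4 dvd a"
  by (auto simp: legalF_def dvd_12 dest: actions_counterF actions_placeF)

lemma actions_validF: "a \<in> actions_of (fm_of (validF T)) \<Longrightarrow> 4 dvd a"
  by (auto simp: validF_def orderedF_def runningF_def dvd_12
      dest: subsetD[OF actions_linkedF] actions_singleF actions_legalF)

text \<open>For the last transition this is the largest action of the machine; with
  \<open>action_le_code\<close>, the code of the formula bounds the length of the machine.\<close>

lemma finish_action_validF: "j < length T \<Longrightarrow> 12 * j + 8 \<in> actions_of (fm_of (validF T))"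
  by (auto simp: validF_def orderedF_def)

lemma finalF_vars: "free_vars (fm_of (finalF x)) = {}"
  by (auto simp: finalF_def labelF_def)

lemma finalF_actions:
  "actions_of (fm_of (finalF x)) \<subseteq> {0, 24} \<union> (\<lambda>i. 4 * i + 2) ` {..<x}"
  by (auto simp: finalF_def labelF_def)

text \<open>With \<open>2 * x\<close> actions per player the largest System action is
  \<open>4 * x - 2\<close>, which is exactly the last label \<open>4 * (x - 1) + 2\<close>.\<close>

definition synth_instance :: "nat \<Rightarrow> fm \<Rightarrow> synth_instance" where
  "synth_instance x f = (sys_acts (2 * x), env_acts (2 * x), game_fm (2 * x) f (fm_of (finalF x)))"

lemma synth_instance_in:
  assumes "free_vars f = {}" "actions_of f \<subseteq> sys_acts (2 * x)"
    "actions_of (fm_of (finalF x)) \<subseteq> sys_acts (2 * x)"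
  shows "synth_instance x f \<in> synth_instances"
proof -
  let ?n = "2 * x"
  have "sys_acts ?n \<inter> env_acts ?n = {}" unfolding sys_acts_def env_acts_def by auto presburger
  moreover have "2 * l \<in> sys_acts ?n" "Suc (2 * l) \<in> env_acts ?n" if "l < ?n" for l
    using that by (auto simp: sys_acts_def env_acts_def)
  ultimately show ?thesis
    using assms finalF_vars[of x]
    by (auto simp: synth_instance_def synth_instances_def game_fm_def ack_fault_def pending_def
        no_repeat_def sys_acts_def env_acts_def)
qed

text \<open>The code of the inner formula is the argument \<open>x\<close> itself, so it is copied
  and never decoded; all other parts depend on \<open>x\<close> only through lengths of
  iterations.\<close>

lemma computable1_instance_code:
  "\<exists>t. computable1 t \<and> (\<forall>f. t (fm_code f) = instance_code (synth_instance (fm_code f) f))"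
proof -
  let ?one = "\<lambda>n. Forall X (Forall Y (Or (Neg (And (bigOr (pending X) n) (bigOr (pending Y) n))) (Eq X Y)))"
  let ?t = "\<lambda>x. prod_encode (set_encode (sys_acts (2 * x)), prod_encode (set_encode (env_acts (2 * x)),
    prod_encode (8, prod_encode (fm_code (bigOr ack_fault (2 * x)),
      prod_encode (7, prod_encode (fm_code (?one (2 * x)),
        prod_encode (7, prod_encode (fm_code (bigAnd no_repeat (2 * x)),
          prod_encode (7, prod_encode (x,
            prod_encode (8, prod_encode (fm_code (Exists X (bigOr (pending X) (2 * x))),
              fm_code (fm_of (finalF x))))))))))))))"
  note rules = computable1_prod_encode computable1_const computable1_id computable1_mult_const computable1_add computable1_Suc computable1_bigOr computable1_bigAnd computable1_set_encode
  have "computable1 (\<lambda>l. fm_code (ack_fault l))" "computable1 (\<lambda>l. fm_code (pending X l))"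
    "computable1 (\<lambda>l. fm_code (pending Y l))" "computable1 (\<lambda>l. fm_code (no_repeat l))"
    unfolding ack_fault_def pending_def no_repeat_def fm_code.simps by (intro rules)+
  moreover have "computable1 (\<lambda>x. fm_code (fm_of (finalF x)))"
    unfolding finalF_def labelF_def fm_of.simps fm_of_pBig
    by (intro rules | unfold fm_code.simps)+
  ultimately have "computable1 ?t" unfolding fm_code.simps by (intro rules)
  moreover have "?t (fm_code f) = instance_code (synth_instance (fm_code f) f)" for f
    by (simp add: instance_code_def synth_instance_def game_fm_def)
  ultimately show ?thesis by blast
qed

theorem theorem5: "\<not> decidable_problem instance_code synth_instances shared_synth"
proof
  assume "decidable_problem instance_code synth_instances shared_synth"
  then obtain d where d: "\<forall>i\<in>synth_instances. reval d [instance_code i] = Some (if shared_synth i then 1 else 0)"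
    unfolding decidable_problem_def by blast
  obtain t where t: "computable1 t" "\<And>f. t (fm_code f) = instance_code (synth_instance (fm_code f) f)"
    using computable1_instance_code by blast
  then obtain r where r: "\<forall>x. reval r [x] = Some (t x)" unfolding computable1_def by blast
  \<comment> \<open>The argument is in register \<open>0\<close>, the answer goes to register
    \<open>1\<close>, and the scratch registers start at \<open>2\<close>.\<close>
  define c where "c = cmp (Comp d [r]) [0] 1 2"
  define T where "T = prog c"
  \<comment> \<open>\<open>T\<close> is built from \<open>d\<close> and \<open>r\<close> alone, so
    its formula and the code \<open>x\<close> can be formed afterwards and \<open>x\<close> used as
    its input.\<close>
  define f where "f = fm_of (validF T)"
  define x where "x = fm_code f"
  have T: "6 \<le> length T" "opr (T ! 1) = Nop" "tgt (T ! 1) = 1"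
    by (simp_all add: T_def opr_def tgt_def del: One_nat_def)
  have "12 * (length T - 1) + 8 \<le> x"
    unfolding x_def f_def by (intro action_le_code finish_action_validF) (use T in auto)
  \<comment> \<open>\<open>68\<close> is \<open>12 * 5 + 8\<close>, owed to the six fixed
    transitions; it also makes \<open>24\<close> an action of the instance.\<close>
  then have x: "12 * length T \<le> x + 4" "68 \<le> x" using T(1) by auto
  have acts: "actions_of f \<subseteq> sys_acts (2 * x)"
  proof
    fix a assume a: "a \<in> actions_of f"
    then have "a \<le> x" "4 dvd a" using action_le_code actions_validF unfolding x_def f_def by blast+
    then show "a \<in> sys_acts (2 * x)" unfolding sys_acts_def using x(2)
      by (intro image_eqI[of _ _ "a div 2"]) (auto elim!: dvdE)
  qed
  have "{0, 24} \<union> (\<lambda>i. 4 * i + 2) ` {..<x} \<subseteq> sys_acts (2 * x)"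
  proof -
    have "0 \<in> sys_acts (2 * x)" "24 \<in> sys_acts (2 * x)" using x(2)
      unfolding sys_acts_def by (auto intro!: image_eqI[of _ _ 12])
    moreover have "4 * i + 2 \<in> sys_acts (2 * x)" if "i < x" for i
      unfolding sys_acts_def by (rule image_eqI[of _ _ "2 * i + 1"]) (use that in auto)
    ultimately show ?thesis by blast
  qed
  with finalF_actions have acts': "actions_of (fm_of (finalF x)) \<subseteq> sys_acts (2 * x)" by blast
  define i where "i = synth_instance x f"
  define v where "v = (if shared_synth i then 1 else 0 :: nat)"
  have "i \<in> synth_instances"
    unfolding i_def by (rule synth_instance_in) (use acts acts' free_vars_validF in \<open>simp_all add: f_def\<close>)
  then have "reval d [t x] = Some v" using d t(2)[of f] by (simp add: i_def x_def v_def)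
  then have "reval (Comp d [r]) (map (input x) [0]) = Some v" using r by (simp add: input_def)
  moreover have "ready [0] 1 2 (input x)" by (simp add: ready_def input_def)
  ultimately have e: "exec c (input x) ((input x)(1 := v))"
    unfolding c_def by (rule exec_cmp(1))
  \<comment> \<open>The instance asks for an accepting run, on input \<open>x\<close>, of the very
    machine that evaluates the decision procedure at this instance and accepts iff the answer is
    no.\<close>
  have "shared_synth i \<longleftrightarrow>
      (\<exists>js d. run T (tgt (T ! 1), \<lambda>_. 0) js d \<and> 0 \<in> set js \<and> count_list js 2 = x)"
    unfolding i_def synth_instance_def f_def
    by (rule shared_synth_run[OF _ T(2) _ _ acts[unfolded f_def] acts']) (use T(1) x in auto)
  also have "\<dots> \<longleftrightarrow> (\<exists>js d. run T (1, \<lambda>_. 0) js d \<and> 0 \<in> set js \<and> count_list js 2 = x)"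
    by (simp only: T(3))
  also have "\<dots> \<longleftrightarrow> v = 0" unfolding T_def using accepting_run[OF e] by simp
  finally show False unfolding v_def by (simp split: if_splits)
qed

end
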